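(* Let $\mathcal F$ be the Farey tree. The group $\mathsf{Aut}^\infty_s(\mathcal F)$ of partial automorphisms of $\mathcal F$ generated by ribbon graph near-automorphisms and shuffles is isomorphic to Thompson's group $\mathsf V$.
   Context: **Farey tree.** $\mathcal F$ is the infinite planar (ribbon) tree obtained from the regular trivalent planar tree by placing a degree-2 vertex at the midpoint of each edge; thus each edge joins a vertex of degree 2 and a vertex of degree 3, and each vertex carries the cyclic (counterclockwise) order of its incident edges. Two edges sharing a degree-2 vertex are called twins. **Near and partial automorphisms.** A ribbon graph near-automorphism of $\mathcal F$ is a bijection $\sigma:E(\mathcal F)\to E(\mathcal F)$, sending twins to twins, for which there are finite subtrees $\mathcal T_1,\mathcal T_2$ such that $\sigma$ restricts to a ribbon graph isomorphism $\mathcal F\setminus\mathcal T_1\to\mathcal F\setminus\mathcal T_2$ respecting the cyclic orders on the sets of components (branches) of $\mathcal F\setminus\mathcal T_1$, $\mathcal F\setminus\mathcal T_2$ induced by the planar structure (here $\setminus$ removes the vertices and edges of the subtree). Dropping the requirements that the isomorphism $\mathcal F\setminus\mathcal T_1\to\mathcal F\setminus\mathcal T_2$ respects ribbon structure and cyclic order gives the notion of a (combinatorial) near-automorphism. Two near-automorphisms are equivalent if they agree on the complement of a finite subtree; equivalence classes (germs) are called partial automorphisms and form a group under composition. **Shuffles.** A shuffle at a degree-3 vertex $v$ of a ribbon graph is the operation of reversing the cyclic order at $v$, leaving the underlying graph unchanged. The ribbon tree $\mathcal F'$ obtained from $\mathcal F$ by a shuffle at $v$ is again isomorphic to $\mathcal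 F$ as a ribbon graph; composing with a ribbon graph isomorphism $\mathcal F'\to\mathcal F$, the shuffle gives a combinatorial automorphism of $\mathcal F$ (well defined up to ribbon automorphisms of $\mathcal F$): for instance, if $x,y,z$ are the edges at $v$, the one which fixes the branch at $v$ starting with $x$ and interchanges the branches at $v$ starting with $y$ and $z$ by the ribbon isomorphisms taking $y$ to $z$ and $z$ to $y$. $\mathsf{Aut}^\infty_s(\mathcal F)$ is the group of germs generated by the germs of ribbon graph near-automorphisms and of shuffles. **Thompson's group $\mathsf V$** is the group of (right-continuous) bijections of $[0,1)$ that map the intervals of some finite dyadic subdivision (into intervals $[k/2^m,(k+1)/2^m)$) affinely and order-preservingly onto the intervals of another finite dyadic subdivision, the order of the intervals being arbitrarily permuted. *)

theory Defs
  imports Complex_Main "HOL-Library.Disjoint_Sets" "HOL-Algebra.Bij" "HOL-Algebra.Elementary_Groups"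
begin

section \<open>Ribbon graphs\<close>

text \<open>
  \<open>rot G v e\<close> is the edge following \<open>e\<close> counterclockwise around \<open>v\<close>; it is meaningful
  only for edges \<open>e\<close> incident to \<open>v\<close>.  Graphs have no loops.  An edge has two ends, except that deleting
  vertices (see \<open>remove\<close> below) leaves open edges, which have only one.
\<close>

record ('v, 'e) ribbon_graph =
  verts :: "'v set"
  edges :: "'e set"
  ends :: "'e \<Rightarrow> 'v set"
  rot :: "'v \<Rightarrow> 'e \<Rightarrow> 'e"

definition incident :: "('v, 'e) ribbon_graph \<Rightarrow> 'v \<Rightarrow> 'e set" where
  "incident G v = {e \<in> edges G. v \<in> ends G e}"

definition degree :: "('v, 'e) ribbon_graph \<Rightarrow> 'v \<Rightarrow> nat" where
  "degree G v = card (incident G v)"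

definition twins :: "('v, 'e) ribbon_graph \<Rightarrow> 'e \<Rightarrow> 'e \<Rightarrow> bool" where
  "twins G e f \<longleftrightarrow>
     e \<noteq> f \<and> (\<exists>v\<in>verts G. degree G v = 2 \<and> e \<in> incident G v \<and> f \<in> incident G v)"

definition graph_iso ::
  "('v, 'e) ribbon_graph \<Rightarrow> ('w, 'f) ribbon_graph \<Rightarrow> ('v \<Rightarrow> 'w) \<Rightarrow> ('e \<Rightarrow> 'f) \<Rightarrow> bool" where
  "graph_iso G H \<phi> \<sigma> \<longleftrightarrow>
     bij_betw \<phi> (verts G) (verts H) \<and> bij_betw \<sigma> (edges G) (edges H) \<and>
     (\<forall>e\<in>edges G. ends H (\<sigma> e) = \<phi> ` ends G e)"

definition ribbon_iso ::
  "('v, 'e) ribbon_graph \<Rightarrow> ('w, 'f) ribbon_graph \<Rightarrow> ('v \<Rightarrow> 'w) \<Rightarrow> ('e \<Rightarrow> 'f) \<Rightarrow> bool" where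
  "ribbon_iso G H \<phi> \<sigma> \<longleftrightarrow>
     graph_iso G H \<phi> \<sigma> \<and>
     (\<forall>v\<in>verts G. \<forall>e\<in>incident G v. \<sigma> (rot G v e) = rot H (\<phi> v) (\<sigma> e))"

text \<open>
  A subtree of a tree is determined by its vertex set \<open>T\<close>: its edges are all the edges with both ends
  in \<open>T\<close>.  Subtrees are therefore represented by their vertex sets.
\<close>

definition finite_subtree :: "('v, 'e) ribbon_graph \<Rightarrow> 'v set \<Rightarrow> bool" where
  "finite_subtree G T \<longleftrightarrow>
     finite T \<and> T \<noteq> {} \<and> T \<subseteq> verts G \<and>
     (\<forall>u\<in>T. \<forall>w\<in>T. (u, w) \<in> {(a, b). a \<in> T \<and> b \<in> T \<and> (\<exists>e\<in>edges G. ends G e = {a, b})}\<^sup>*)"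

text \<open>
  Only the vertices and edges of the subtree are deleted: an edge with exactly one end in \<open>T\<close> survives
  as an open edge, and is the starting edge of a branch.
\<close>

definition remove :: "('v, 'e) ribbon_graph \<Rightarrow> 'v set \<Rightarrow> ('v, 'e) ribbon_graph" where
  "remove G T =
     \<lparr> verts = verts G - T,
       edges = {e \<in> edges G. \<not> ends G e \<subseteq> T},
       ends = (\<lambda>e. ends G e - T),
       rot = rot G \<rparr>"

text \<open>
  Connected components are represented by their edge sets.
\<close>

definition component :: "('v, 'e) ribbon_graph \<Rightarrow> 'e \<Rightarrow> 'e set" where
  "component G e =
     {f. (e, f) \<in> {(a, b). a \<in> edges G \<and> b \<in> edges G \<and> ends G a \<inter> ends G b \<noteq> {}}\<^sup>*}"

definition components :: "('v, 'e) ribbon_graph \<Rightarrow> 'e set set" where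
  "components G = component G ` edges G"

definition branch :: "('v, 'e) ribbon_graph \<Rightarrow> 'v \<Rightarrow> 'e \<Rightarrow> 'e set" where
  "branch G v x = component (remove G {v}) x"

text \<open>
  The cyclic order on the components of the complement of \<open>T\<close>, as a ternary relation, for trees with
  all degrees at most 3.  Three distinct components lie in the three different branches at exactly one
  vertex of \<open>T\<close> (their median), and inherit the cyclic order of these branches around it.
\<close>

definition cyclic_ord ::
  "('v, 'e) ribbon_graph \<Rightarrow> 'v set \<Rightarrow> 'e set \<Rightarrow> 'e set \<Rightarrow> 'e set \<Rightarrow> bool" where
  "cyclic_ord G T A B C \<longleftrightarrow>
     (\<exists>v\<in>T. \<exists>x\<in>incident G v. \<exists>y\<in>incident G v. \<exists>z\<in>incident G v.
        x \<noteq> y \<and> y \<noteq> z \<and> z \<noteq> x \<and> y = rot G v x \<and> z = rot G v y \<and>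
        A \<subseteq> branch G v x \<and> B \<subseteq> branch G v y \<and> C \<subseteq> branch G v z)"


section \<open>The Farey tree\<close>

text \<open>
  The regular trivalent planar tree.  Its vertices are words: the root is the empty word, a first letter
  in \<open>{0, 1, 2}\<close> selects one of the three branches at the root, and each later letter in \<open>{0, 1}\<close> selects
  one of the two children.  An edge is named by its end farther from the root.  The counterclockwise
  order is \<open>[0], [1], [2]\<close> at the root, and parent edge, child \<open>0\<close>, child \<open>1\<close> at any other vertex.
\<close>

definition trivalent_tree :: "(nat list, nat list) ribbon_graph" where
  "trivalent_tree =
     \<lparr> verts = {w. w = [] \<or> hd w < 3 \<and> set (tl w) \<subseteq> {0, 1}},
       edges = {w. w \<noteq> [] \<and> hd w < 3 \<and> set (tl w) \<subseteq> {0, 1}},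
       ends = (\<lambda>w. {butlast w, w}),
       rot = (\<lambda>v e. if v = [] then [(hd e + 1) mod 3]
                    else if e = v then v @ [0]
                    else if e = v @ [0] then v @ [1]
                    else v) \<rparr>"

text \<open>
  Insertion of a degree-2 vertex \<open>Inr e\<close> at the midpoint of each edge \<open>e\<close>; \<open>(v, e)\<close> is the half of \<open>e\<close>
  at the end \<open>v\<close>.
\<close>

definition subdivision :: "('v, 'e) ribbon_graph \<Rightarrow> ('v + 'e, 'v \<times> 'e) ribbon_graph" where
  "subdivision G =
     \<lparr> verts = Inl ` verts G \<union> Inr ` edges G,
       edges = {(v, e). e \<in> edges G \<and> v \<in> ends G e},
       ends = (\<lambda>(v, e). {Inl v, Inr e}),
       rot = (\<lambda>p (v, e). case p of
                 Inl _ \<Rightarrow> (v, rot G v e)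
               | Inr _ \<Rightarrow> (the_elem (ends G e - {v}), e)) \<rparr>"

definition farey_tree :: "(nat list + nat list, nat list \<times> nat list) ribbon_graph" where
  "farey_tree = subdivision trivalent_tree"


section \<open>Near-automorphisms and their germs\<close>

text \<open>
  As in \<^theory>\<open>HOL-Algebra.Bij\<close>, bijections of a set are extensional functions and are composed with
  \<^const>\<open>compose\<close>.
\<close>

definition near_auts :: "('v, 'e) ribbon_graph \<Rightarrow> ('e \<Rightarrow> 'e) set" where
  "near_auts G =
     {\<sigma> \<in> Bij (edges G).
        (\<forall>e\<in>edges G. \<forall>f\<in>edges G. twins G e f \<longrightarrow> twins G (\<sigma> e) (\<sigma> f)) \<and>
        (\<exists>T1 T2 \<phi>. finite_subtree G T1 \<and> finite_subtree G T2 \<and>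
           graph_iso (remove G T1) (remove G T2) \<phi> \<sigma>)}"

definition ribbon_near_auts :: "('v, 'e) ribbon_graph \<Rightarrow> ('e \<Rightarrow> 'e) set" where
  "ribbon_near_auts G =
     {\<sigma> \<in> Bij (edges G).
        (\<forall>e\<in>edges G. \<forall>f\<in>edges G. twins G e f \<longrightarrow> twins G (\<sigma> e) (\<sigma> f)) \<and>
        (\<exists>T1 T2 \<phi>. finite_subtree G T1 \<and> finite_subtree G T2 \<and>
           ribbon_iso (remove G T1) (remove G T2) \<phi> \<sigma> \<and>
           (\<forall>A\<in>components (remove G T1). \<forall>B\<in>components (remove G T1).
              \<forall>C\<in>components (remove G T1).
                cyclic_ord G T1 A B C \<longrightarrow> cyclic_ord G T2 (\<sigma> ` A) (\<sigma> ` B) (\<sigma> ` C)))}"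

definition germ :: "('v, 'e) ribbon_graph \<Rightarrow> ('e \<Rightarrow> 'e) \<Rightarrow> ('e \<Rightarrow> 'e) set" where
  "germ G \<sigma> =
     {\<tau> \<in> near_auts G. \<exists>T. finite_subtree G T \<and> (\<forall>e\<in>edges (remove G T). \<tau> e = \<sigma> e)}"

text \<open>
  The group of all combinatorial partial automorphisms.
\<close>

definition germ_group :: "('v, 'e) ribbon_graph \<Rightarrow> ('e \<Rightarrow> 'e) set monoid" where
  "germ_group G =
     \<lparr> carrier = germ G ` near_auts G,
       mult = (\<lambda>A B. \<Union>\<sigma>\<in>A. \<Union>\<tau>\<in>B. germ G (compose (edges G) \<sigma> \<tau>)),
       one = germ G (\<lambda>e\<in>edges G. e) \<rparr>"


section \<open>Shuffles\<close>

definition shuffle_at :: "('v, 'e) ribbon_graph \<Rightarrow> 'v \<Rightarrow> ('v, 'e) ribbon_graph" where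
  "shuffle_at G v = G\<lparr>rot := (rot G)(v := inv_into (incident G v) (rot G v))\<rparr>"

text \<open>
  All the combinatorial automorphisms induced by a shuffle, one for each choice of a ribbon graph
  isomorphism from the shuffled graph back to \<open>G\<close>.
\<close>

definition shuffles :: "('v, 'e) ribbon_graph \<Rightarrow> ('e \<Rightarrow> 'e) set" where
  "shuffles G =
     {\<sigma> \<in> Bij (edges G).
        \<exists>v\<in>verts G. degree G v = 3 \<and> (\<exists>\<phi>. ribbon_iso (shuffle_at G v) G \<phi> \<sigma>)}"

definition Aut_inf_s :: "('v, 'e) ribbon_graph \<Rightarrow> ('e \<Rightarrow> 'e) set monoid" where
  "Aut_inf_s G =
     subgroup_generated (germ_group G) (germ G ` (ribbon_near_auts G \<union> shuffles G))"


section \<open>Thompson's group V\<close>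

definition dyadic_subdivision :: "real set set \<Rightarrow> bool" where
  "dyadic_subdivision P \<longleftrightarrow>
     finite P \<and> partition_on {0..<1} P \<and>
     (\<forall>I\<in>P. \<exists>k m :: nat. I = {real k / 2 ^ m ..< (real k + 1) / 2 ^ m})"

definition thompson_V :: "(real \<Rightarrow> real) monoid" where
  "thompson_V =
     (BijGroup {0..<1})
       \<lparr> carrier := {f \<in> Bij {0..<1}. \<exists>P Q.
           dyadic_subdivision P \<and> dyadic_subdivision Q \<and> (\<lambda>I. f ` I) ` P = Q \<and>
           (\<forall>I\<in>P. \<exists>a b. a > 0 \<and> (\<forall>x\<in>I. f x = a * x + b))} \<rparr>"

end

theory Submission
  imports Defs "HOL-Library.Sublist" "HOL-Combinatorics.Permutations"
begin

text \<open>
  The edges of the trivalent tree are coded by binary words, hence by dyadic subintervals of the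
  boundary circle \<open>[0,1)\<close>.  A generator sends all but finitely many of these edges to edges,
  compatibly with passing to children, so it acts on the boundary circle by an element of \<open>V\<close>; a germ
  is determined by this element, and germs compose as the elements do.  Conversely an element of \<open>V\<close> is
  a bijection \<open>g\<close> between the leaves of two finite subtrees with equally many leaves.  The number of
  leaves determines the number of inner edges, so \<open>g\<close> extends to a near-automorphism, which is a ribbon
  one when \<open>g\<close> preserves the cyclic order of the leaves.  Up to such a \<open>g\<close> only permutations of the
  leaves of a ball remain, and these are generated by the rotations, which preserve the cyclic order, and
  one transposition of sibling leaves, which is a shuffle.
\<close>

section \<open>Words and dyadic intervals\<close>

text \<open>The main obstacle is direction. Words record which end of an edge is nearer to the root,
  but a generator need not respect the root: it may reverse some edges, and prefixes then do not go
  to prefixes. Reversed edges reach only finitely far (\<open>realized\<close>), and a germ does not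
  see them. Ribbon near-automorphisms and shuffles are handled together by the locale
  \<open>ribbon_off\<close>, which asks for compatibility with rotations away from a finite set; for
  a shuffle this set is the shuffled vertex alone. Cutting the circle open at a dyadic point does no
  harm, since elements of V may jump there. The group laws of \<open>germ_group\<close> are not
  established. All computation goes through the relation \<open>realizes\<close> between maps of the
  circle and maps of edges, and the inverse of a germ is found directly from its definition as a
  definite description. A near-automorphism is a bijection of all edges, including those inside the
  deleted subtrees. This is why the inner edges of the two subtrees must be equal in number.\<close>

abbreviation bwords :: "nat list set" where
  "bwords \<equiv> lists {0, 1}"

definition words :: "nat list set" where
  "words = {w. w = [] \<or> hd w < 3 \<and> set (tl w) \<subseteq> {0, 1}}"

text \<open>An edge is named by its outer end, so these words serve both as the edges and as the
  vertices other than the root.\<close>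

definition ewords :: "nat list set" where
  "ewords = {w. w \<noteq> [] \<and> hd w < 3 \<and> set (tl w) \<subseteq> {0, 1}}"

lemma ewords_Cons [simp]: "a # u \<in> ewords \<longleftrightarrow> a < 3 \<and> u \<in> bwords"
  by (auto simp: ewords_def in_lists_conv_set)

lemma ewords_Nil [simp]: "[] \<notin> ewords"
  by (simp add: ewords_def)

lemma ewords_E:
  assumes "w \<in> ewords"
  obtains a u where "w = a # u" "a < 3" "u \<in> bwords"
  using assms by (cases w) auto

lemma words_eq: "words = insert [] ewords"
  by (auto simp: words_def ewords_def)

lemma ewords_append [simp]: "w \<in> ewords \<Longrightarrow> w @ u \<in> ewords \<longleftrightarrow> u \<in> bwords"
  by (erule ewords_E) auto

lemma ewords_take: "w \<in> ewords \<Longrightarrow> 0 < n \<Longrightarrow> take n w \<in> ewords"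
  by (erule ewords_E) (cases n, auto simp: in_lists_conv_set dest: in_set_takeD)

lemma ewords_drop: "w \<in> ewords \<Longrightarrow> 0 < n \<Longrightarrow> drop n w \<in> bwords"
  by (erule ewords_E) (cases n, auto simp: in_lists_conv_set dest: in_set_dropD)

lemma ewords_prefix:
  assumes "p @ u \<in> ewords" "p \<noteq> []"
  shows "p \<in> ewords" "u \<in> bwords"
  using assms by (cases p; auto)+

lemma butlast_words: "w \<in> ewords \<Longrightarrow> butlast w \<in> words"
  by (erule ewords_E) (auto simp: words_eq in_lists_conv_set dest: in_set_butlastD)

lemma ewords_snoc: "p @ [d] \<in> ewords \<longleftrightarrow> (if p = [] then d < 3 else p \<in> ewords \<and> d \<in> {0, 1})"
  by (cases p) auto

lemma finite_ewords_length: "finite {w \<in> ewords. length w \<le> n}"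
proof (rule finite_subset)
  show "{w \<in> ewords. length w \<le> n} \<subseteq> {w. set w \<subseteq> {0,1,2} \<and> length w \<le> n}"
    by (auto elim!: ewords_E simp: in_lists_conv_set)
  show "finite {w. set w \<subseteq> {0,1,2::nat} \<and> length w \<le> n}"
    by (rule finite_lists_length_le) simp
qed

lemma finite_ewords_less: "finite {w \<in> ewords. length w < n}"
  by (rule finite_subset[OF _ finite_ewords_length[of n]]) auto

lemma finite_ewords_eq: "finite {w \<in> ewords. length w = n}"
  by (rule finite_subset[OF _ finite_ewords_length[of n]]) auto

text \<open>Puts the binary digits \<open>u\<close> in front of the expansion of \<open>t\<close>.
  Over [0,1) this is the increasing affine parametrization of the dyadic interval coded by
  \<open>u\<close>.\<close>

fun pt :: "nat list \<Rightarrow> real \<Rightarrow> real" where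
  "pt [] t = t"
| "pt (a # u) t = (real a + pt u t) / 2"

lemma pt_append: "pt (u @ v) t = pt u (pt v t)"
  by (induction u) auto

lemma pt_affine: "pt u t = pt u 0 + t / 2 ^ length u"
  by (induction u) (auto simp: field_simps)

lemma pt_range: "u \<in> bwords \<Longrightarrow> t \<in> {0..<1} \<Longrightarrow> pt u t \<in> {0..<1}"
  by (induction u) auto

lemma pt_inj:
  assumes "length u = length v" "u \<in> bwords" "v \<in> bwords" "t \<in> {0..<1}" "s \<in> {0..<1}"
    and "pt u t = pt v s"
  shows "u = v \<and> t = s"
  using assms
proof (induction u v rule: list_induct2)
  case (Cons a u b v)
  have "pt u t \<in> {0..<1}" "pt v s \<in> {0..<1}"
    using Cons.prems by (auto intro!: pt_range simp del: atLeastLessThan_iff)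
  then have "a = b" using Cons.prems by auto
  then show ?case using Cons by auto
qed auto

lemma pt_ex:
  "x \<in> {0..<1} \<Longrightarrow> \<exists>u\<in>bwords. length u = n \<and> (\<exists>t\<in>{0..<1}. x = pt u t)"
proof (induction n arbitrary: x)
  case 0
  then show ?case by (auto intro!: bexI[of _ "[]"])
next
  case (Suc n)
  define a :: nat where "a = (if x < 1/2 then 0 else 1)"
  have "2 * x - real a \<in> {0..<1}" using Suc.prems by (auto simp: a_def)
  from Suc.IH[OF this] obtain u t where
    "u \<in> bwords" "length u = n" "t \<in> {0..<1}" "2 * x - real a = pt u t" by blast
  then show ?case
    by (intro bexI[of _ "a # u"] conjI bexI[of _ t]) (auto simp: a_def)
qed

lemma pt_nat: "\<exists>j. pt u 0 = real j / 2 ^ length u"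
proof (induction u)
  case Nil
  then show ?case by (auto intro!: exI[of _ 0])
next
  case (Cons a u)
  then obtain j where "pt u 0 = real j / 2 ^ length u" by blast
  then show ?case
    by (intro exI[of _ "a * 2 ^ length u + j"]) (auto simp: field_simps)
qed

lemma image_affine_unit:
  fixes a b :: real
  assumes "b > 0"
  shows "(\<lambda>t. a + t * b) ` {0..<1} = {a..<a + b}"
proof
  show "(\<lambda>t. a + t * b) ` {0..<1} \<subseteq> {a..<a + b}" using assms by auto
  show "{a..<a + b} \<subseteq> (\<lambda>t. a + t * b) ` {0..<1}"
  proof
    fix x assume "x \<in> {a..<a + b}"
    then show "x \<in> (\<lambda>t. a + t * b) ` {0..<1}"
      using assms by (intro image_eqI[of _ _ "(x - a) / b"]) (auto simp: field_simps)
  qed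
qed

lemma pt_image: "pt u ` {0..<1} = {pt u 0 ..< pt u 0 + 1 / 2 ^ length u}"
proof -
  have "pt u = (\<lambda>t. pt u 0 + t * (1 / 2 ^ length u))"
    by (rule ext) (subst pt_affine, simp)
  then show ?thesis
    using image_affine_unit[of "1 / 2 ^ length u" "pt u 0"] by (metis zero_less_divide_1_iff zero_less_numeral zero_less_power)
qed

text \<open>Dyadic intervals are nested or disjoint. Cutting \<open>v\<close> at the length of
  \<open>u\<close> reduces this to words of equal length, where \<open>pt_inj\<close>
  applies.\<close>

lemma pt_prefix:
  assumes "u \<in> bwords" "v \<in> bwords" "t \<in> {0..<1}" "s \<in> {0..<1}"
    and "pt u t = pt v s" "length u \<le> length v"
  obtains v' where "v = u @ v'" "v' \<in> bwords" "t = pt v' s"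
proof -
  define p q where "p = take (length u) v" and "q = drop (length u) v"
  have v: "v = p @ q" by (simp add: p_def q_def)
  then have "p \<in> bwords" "q \<in> bwords" using assms(2) by auto
  moreover have "length u = length p" using assms(6) by (simp add: p_def)
  moreover have "pt u t = pt p (pt q s)" using assms(5) v by (simp add: pt_append)
  ultimately have "u = p \<and> t = pt q s"
    using assms pt_range by (intro pt_inj) blast+
  then show thesis using that v \<open>q \<in> bwords\<close> by blast
qed

lemma dyadic_interval_word:
  assumes I: "I = {real k / 2 ^ m ..< (real k + 1) / 2 ^ m}" and sub: "I \<subseteq> {0..<1}"
  obtains u where "u \<in> bwords" "length u = m" "I = pt u ` {0..<1}"
proof -
  have mem: "real k / 2 ^ m \<in> I" by (simp add: I divide_strict_right_mono)
  then have "real k / 2 ^ m \<in> {0..<1}" using sub by blast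
  then obtain u t where u: "u \<in> bwords" "length u = m" "t \<in> {0..<1}" "real k / 2 ^ m = pt u t"
    using pt_ex by blast
  obtain j where j: "pt u 0 = real j / 2 ^ m" using pt_nat u(2) by metis
  \<comment> \<open>The left end of \<open>I\<close> lies in the interval of some word of length
    \<open>m\<close>. Comparing numerators forces the fractional part \<open>t\<close> to vanish, so
    it is the left end of that interval too.\<close>
  have "real k / 2 ^ m = (real j + t) / 2 ^ m"
    using u(4) pt_affine[of u t] j u(2) by (simp add: add_divide_distrib)
  then have "real k = real j + t" by simp
  with u(3) have "k = j" by auto
  then have "I = pt u ` {0..<1}" by (simp add: I pt_image j u(2) add_divide_distrib)
  then show thesis using that u by blast
qed

text \<open>
  The boundary circle of the tree is cut open at the left end of branch \<open>0\<close>; the branches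
  \<open>0\<close>, \<open>1\<close>, \<open>2\<close> at the root become \<open>[0,1/2)\<close>, \<open>[1/2,3/4)\<close>, \<open>[3/4,1)\<close>, and
  children halve intervals.  Every binary word except \<open>[]\<close> and \<open>[1]\<close> is the code of an edge.
\<close>

fun enc :: "nat list \<Rightarrow> nat list" where
  "enc [] = []"
| "enc (a # u) = (if a = 0 then [0] else [1, a - 1]) @ u"

text \<open>\<open>pe w\<close> is the affine parametrization over \<open>[0,1)\<close> of the boundary interval of the edge \<open>w\<close>.\<close>

definition pe :: "nat list \<Rightarrow> real \<Rightarrow> real" where
  "pe w = pt (enc w)"

lemma enc_bwords: "w \<in> ewords \<Longrightarrow> enc w \<in> bwords"
  by (erule ewords_E) auto

lemma enc_append: "w \<in> ewords \<Longrightarrow> enc (w @ u) = enc w @ u"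
  by (erule ewords_E) auto

lemma length_enc_ge: "length w \<le> length (enc w)"
  by (cases w) auto

text \<open>Length 2 is the least bound that keeps away from \<open>[1]\<close>, a union of two
  branches at the root that is not the interval of a single edge.\<close>

lemma enc_ex:
  assumes "u \<in> bwords" "2 \<le> length u"
  obtains w where "w \<in> ewords" "enc w = u"
proof -
  obtain a b v where u: "u = a # b # v"
    using assms(2) by (metis Suc_le_length_iff numeral_2_eq_2)
  show thesis
  proof (cases "a = 0")
    case True
    then show thesis using that[of "0 # b # v"] assms u by auto
  next
    case False
    then have "a = 1" using assms u by auto
    then show thesis by (intro that[of "Suc b # v"]) (use assms u in auto)
  qed
qed

lemma pe_append: "w \<in> ewords \<Longrightarrow> pe (w @ u) t = pe w (pt u t)"
  by (simp add: pe_def enc_append pt_append)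

lemma pe_range: "w \<in> ewords \<Longrightarrow> t \<in> {0..<1} \<Longrightarrow> pe w t \<in> {0..<1}"
  unfolding pe_def by (intro pt_range enc_bwords)

lemma pe_affine: "pe w t = pe w 0 + t / 2 ^ length (enc w)"
  unfolding pe_def by (rule pt_affine)

lemma pe_ex:
  assumes x: "x \<in> {0..<1}" and n: "0 < n"
  obtains w t where "w \<in> ewords" "length w = n" "t \<in> {0..<1}" "x = pe w t"
proof -
  define a :: nat where "a = (if x < 1/2 then 0 else if x < 3/4 then 1 else 2)"
  define s where "s = (if x < 1/2 then 2 * x else if x < 3/4 then 4 * x - 2 else 4 * x - 3)"
  have xs: "x = pe [a] s" by (auto simp: pe_def a_def s_def field_simps)
  have "s \<in> {0..<1}" using x by (auto simp: s_def)
  then obtain u t where u: "u \<in> bwords" "length u = n - 1" "t \<in> {0..<1}" "s = pt u t"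
    using pt_ex by blast
  have "[a] \<in> ewords" by (simp add: a_def)
  then show thesis
    using that[of "[a] @ u" t] u n xs pe_append[of "[a]" u t] by auto
qed

lemma pe_prefix:
  assumes w: "w \<in> ewords" "v \<in> ewords" and t: "t \<in> {0..<1}" "s \<in> {0..<1}"
    and eq: "pe w t = pe v s" and le: "length w \<le> length v"
  obtains u where "v = w @ u" "u \<in> bwords" "t = pt u s"
proof -
  obtain a w' where w': "w = a # w'" "a < 3" "w' \<in> bwords" by (rule ewords_E[OF w(1)])
  obtain b v' where v': "v = b # v'" "b < 3" "v' \<in> bwords" by (rule ewords_E[OF w(2)])
  have r: "pt w' t \<in> {0..<1}" "pt v' s \<in> {0..<1}" using w' v' t pt_range by blast+
  have ab: "a = 0 \<or> a = 1 \<or> a = 2" "b = 0 \<or> b = 1 \<or> b = 2" using w' v' by auto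
  \<comment> \<open>The intervals of the three root branches are disjoint, so a common point
    determines the first letter; below it only binary digits remain.\<close>
  have "a = b \<and> pt w' t = pt v' s"
    using eq r ab by (auto simp: w' v' pe_def field_simps)
  then have ab: "a = b" and e: "pt w' t = pt v' s" by auto
  obtain u where "v' = w' @ u" "u \<in> bwords" "t = pt u s"
    by (rule pt_prefix[OF w'(3) v'(3) t e]) (use le w' v' in auto)
  then show thesis using that w' v' ab by simp
qed

lemma pe_same_length:
  assumes "w \<in> ewords" "v \<in> ewords" "t \<in> {0..<1}" "s \<in> {0..<1}" "pe w t = pe v s"
    and "length w = length v"
  shows "w = v" "t = s"
proof -
  obtain u where "v = w @ u" "t = pt u s"
    by (rule pe_prefix[OF assms(1-5)]) (use assms(6) in auto)
  then show "w = v" "t = s" using assms(6) by auto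
qed

text \<open>Prefix replacement: on binary expansions that start with the code of \<open>w\<close>,
  the map \<open>f\<close> exchanges this prefix for the code of \<open>w'\<close>.\<close>

definition acts :: "(real \<Rightarrow> real) \<Rightarrow> nat list \<Rightarrow> nat list \<Rightarrow> bool" where
  "acts f w w' \<longleftrightarrow> (\<forall>t\<in>{0..<1}. f (pe w t) = pe w' t)"

lemma acts_append:
  assumes "acts f w w'" "w \<in> ewords" "w' \<in> ewords" "u \<in> bwords"
  shows "acts f (w @ u) (w' @ u)"
  using assms pt_range[OF assms(4)] by (simp add: acts_def pe_append)

text \<open>The slope of \<open>pe v\<close>, read off from the values at 0 and 1/2, gives the
  length of the code; the left end then gives the code, and \<open>enc\<close> is injective on edge
  words.\<close>

lemma acts_unique:
  assumes "acts f w v" "acts f w v'" "v \<in> ewords" "v' \<in> ewords"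
  shows "v = v'"
proof -
  have eq: "pe v t = pe v' t" if "t \<in> {0..<1}" for t
    using assms that by (auto simp: acts_def)
  have "pe v 0 = pe v' 0" "pe v (1/2) = pe v' (1/2)" by (auto intro!: eq)
  then have "length (enc v) = length (enc v')"
    using pe_affine[of v "1/2"] pe_affine[of v' "1/2"] by simp
  moreover have "pt (enc v) 0 = pt (enc v') 0" using \<open>pe v 0 = _\<close> by (simp add: pe_def)
  ultimately have e: "enc v = enc v'"
    using pt_inj[of "enc v" "enc v'" 0 0] assms enc_bwords by simp
  obtain a w where w: "v = a # w" "a < 3" by (rule ewords_E[OF assms(3)])
  obtain b u where u: "v' = b # u" "b < 3" by (rule ewords_E[OF assms(4)])
  show ?thesis using e w u by (auto split: if_splits)
qed

lemma acts_compose: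
  assumes "acts f v w" "acts g u v" "u \<in> ewords"
  shows "acts (compose {0..<1} f g) u w"
  unfolding acts_def
proof
  fix t :: real assume t: "t \<in> {0..<1}"
  then have "pe u t \<in> {0..<1}" using pe_range assms by blast
  then have "compose {0..<1} f g (pe u t) = f (g (pe u t))" by (simp add: compose_def)
  then show "compose {0..<1} f g (pe u t) = pe w t" using assms t by (simp add: acts_def)
qed

section \<open>Thompson's group in terms of words\<close>

lemma pe_image: "\<exists>k m. pe w ` {0..<1} = {real k / 2 ^ m ..< (real k + 1) / 2 ^ m}"
proof -
  obtain j where "pt (enc w) 0 = real j / 2 ^ length (enc w)" using pt_nat by blast
  then show ?thesis unfolding pe_def pt_image
    by (intro exI[of _ j] exI[of _ "length (enc w)"]) (simp add: add_divide_distrib)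
qed

lemma acts_image: "acts f w w' \<Longrightarrow> f ` pe w ` {0..<1} = pe w' ` {0..<1}"
  unfolding acts_def image_image by (rule image_cong) auto

lemma acts_affine:
  assumes "acts f w w'"
  obtains a b where "a > 0" "\<forall>x\<in>pe w ` {0..<1}. f x = a * x + b"
proof -
  define a :: real where "a = 2 ^ length (enc w) / 2 ^ length (enc w')"
  have "f (pe w t) = a * pe w t + (pe w' 0 - a * pe w 0)" if "t \<in> {0..<1}" for t
  proof -
    have "f (pe w t) = pe w' 0 + t / 2 ^ length (enc w')"
      using assms that pe_affine[of w' t] by (simp add: acts_def)
    also have "t / 2 ^ length (enc w') = a * (pe w t - pe w 0)"
      using pe_affine[of w t] by (simp add: a_def)
    finally show ?thesis by (simp add: algebra_simps)
  qed
  then show thesis by (intro that[of a "pe w' 0 - a * pe w 0"]) (auto simp: a_def)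
qed

lemma partition_pe:
  assumes "0 < n"
  shows "partition_on {0..<1} ((\<lambda>w. pe w ` {0..<1}) ` {w \<in> ewords. length w = n})"
proof (rule partition_onI)
  show "\<Union> ((\<lambda>w. pe w ` {0..<1}) ` {w \<in> ewords. length w = n}) = {0..<1}"
  proof
    show "\<Union> ((\<lambda>w. pe w ` {0..<1}) ` {w \<in> ewords. length w = n}) \<subseteq> {0..<1}"
      using pe_range by blast
    show "{0..<1} \<subseteq> \<Union> ((\<lambda>w. pe w ` {0..<1}) ` {w \<in> ewords. length w = n})"
    proof
      fix x :: real assume "x \<in> {0..<1}"
      then obtain w t where "w \<in> ewords" "length w = n" "t \<in> {0..<1}" "x = pe w t"
        using pe_ex assms by blast
      then show "x \<in> \<Union> ((\<lambda>w. pe w ` {0..<1}) ` {w \<in> ewords. length w = n})" by blast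
    qed
  qed
  show "disjnt p q" if p: "p \<in> (\<lambda>w. pe w ` {0..<1}) ` {w \<in> ewords. length w = n}"
    and q: "q \<in> (\<lambda>w. pe w ` {0..<1}) ` {w \<in> ewords. length w = n}" and "p \<noteq> q" for p q
  proof -
    obtain w where w: "w \<in> ewords" "length w = n" "p = pe w ` {0..<1}" using p by blast
    obtain v where v: "v \<in> ewords" "length v = n" "q = pe v ` {0..<1}" using q by blast
    have "pe w t \<noteq> pe v s" if "t \<in> {0..<1}" "s \<in> {0..<1}" for t s
      using pe_same_length(1)[OF w(1) v(1) that] w v \<open>p \<noteq> q\<close> by auto
    then show ?thesis unfolding disjnt_def w v by blast
  qed
  show "{} \<notin> (\<lambda>w. pe w ` {0..<1}) ` {w \<in> ewords. length w = n}" by auto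
qed

text \<open>An increasing affine map is determined by the end points of its image. The word
  parametrizations of both intervals are increasing and affine as well, so \<open>f\<close> must
  carry one to the other.\<close>

lemma dyadic_subdivision_affine:
  assumes I: "I = {real k / 2 ^ m ..< (real k + 1) / 2 ^ m}" "I \<subseteq> {0..<1}"
    and J: "f ` I = {real k' / 2 ^ m' ..< (real k' + 1) / 2 ^ m'}" "f ` I \<subseteq> {0..<1}"
    and aff: "a > 0" "\<forall>x\<in>I. f x = a * x + b"
  obtains p q where "p \<in> bwords" "q \<in> bwords" "I = pt p ` {0..<1}"
    "\<forall>t\<in>{0..<1}. f (pt p t) = pt q t"
proof -
  obtain p where p: "p \<in> bwords" "length p = m" "I = pt p ` {0..<1}"
    by (rule dyadic_interval_word[OF I])
  obtain q where q: "q \<in> bwords" "length q = m'" "f ` I = pt q ` {0..<1}"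
    by (rule dyadic_interval_word[OF J])
  define A B where "A = a * pt p 0 + b" and "B = a / 2 ^ length p"
  have B: "B > 0" using aff by (simp add: B_def)
  have f: "f (pt p t) = A + t * B" if "t \<in> {0..<1}" for t
  proof -
    have "f (pt p t) = a * pt p t + b" using that aff(2) p(3) by blast
    then show ?thesis using pt_affine[of p t] by (simp add: A_def B_def algebra_simps)
  qed
  then have "f ` I = (\<lambda>t. A + t * B) ` {0..<1}" unfolding p(3) image_image by (intro image_cong) auto
  then have "{A..<A + B} = {pt q 0 ..< pt q 0 + 1 / 2 ^ length q}"
    using q(3) image_affine_unit[OF B] by (simp add: pt_image)
  then have "A = pt q 0" "A + B = pt q 0 + 1 / 2 ^ length q"
    using B by (simp_all add: Ico_eq_Ico)
  then have "f (pt p t) = pt q t" if "t \<in> {0..<1}" for t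
    using f[OF that] pt_affine[of q t] by (simp add: B_def)
  then have "\<forall>t\<in>{0..<1}. f (pt p t) = pt q t" by blast
  then show thesis by (rule that[OF p(1) q(1) p(3)])
qed

text \<open>Trades subdivisions for a condition on all sufficiently long words, which makes common
  refinements unnecessary later. A word longer than all codes of a given subdivision lies inside one
  of its intervals; conversely, all words of one large length form a subdivision.\<close>

lemma thompson_V_carrier_iff:
  "f \<in> carrier thompson_V \<longleftrightarrow>
     f \<in> Bij {0..<1} \<and> (\<exists>n. \<forall>w\<in>ewords. n \<le> length w \<longrightarrow> (\<exists>w'\<in>ewords. acts f w w'))"
proof (intro iffI conjI)
  assume f: "f \<in> carrier thompson_V"
  then show "f \<in> Bij {0..<1}" by (simp add: thompson_V_def)
  obtain P Q where PQ: "dyadic_subdivision P" "dyadic_subdivision Q" "(\<lambda>I. f ` I) ` P = Q"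
    "\<forall>I\<in>P. \<exists>a b. a > 0 \<and> (\<forall>x\<in>I. f x = a * x + b)"
    using f by (auto simp: thompson_V_def)
  have "\<exists>p q. p \<in> bwords \<and> q \<in> bwords \<and> I = pt p ` {0..<1} \<and> (\<forall>t\<in>{0..<1}. f (pt p t) = pt q t)"
    if I: "I \<in> P" for I
  proof -
    have "I \<subseteq> {0..<1}" using I PQ(1) by (auto simp: dyadic_subdivision_def partition_on_def)
    moreover have "f ` I \<in> Q" using I PQ(3) by blast
    moreover from this have "f ` I \<subseteq> {0..<1}"
      using PQ(2) by (auto simp: dyadic_subdivision_def partition_on_def)
    moreover obtain k m where "I = {real k / 2 ^ m ..< (real k + 1) / 2 ^ m}"
      using I PQ(1) unfolding dyadic_subdivision_def by blast
    moreover obtain k' m' where "f ` I = {real k' / 2 ^ m' ..< (real k' + 1) / 2 ^ m'}"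
      using \<open>f ` I \<in> Q\<close> PQ(2) unfolding dyadic_subdivision_def by blast
    moreover obtain a b where "a > 0" "\<forall>x\<in>I. f x = a * x + b" using I PQ(4) by blast
    ultimately show ?thesis by (metis dyadic_subdivision_affine)
  qed
  then obtain p q where pq: "\<And>I. I \<in> P \<Longrightarrow> p I \<in> bwords" "\<And>I. I \<in> P \<Longrightarrow> q I \<in> bwords"
    "\<And>I. I \<in> P \<Longrightarrow> I = pt (p I) ` {0..<1}"
    "\<And>I t. I \<in> P \<Longrightarrow> t \<in> {0..<1} \<Longrightarrow> f (pt (p I) t) = pt (q I) t" by metis
  have "finite P" using PQ(1) by (simp add: dyadic_subdivision_def)
  then obtain n where n: "\<And>I. I \<in> P \<Longrightarrow> length (p I) \<le> n"
    using finite_nat_set_iff_bounded_le[of "(\<lambda>I. length (p I)) ` P"] by auto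
  have "\<exists>w'\<in>ewords. acts f w w'" if w: "w \<in> ewords" "n + 2 \<le> length w" for w
  proof -
    have len: "n + 2 \<le> length (enc w)" using w length_enc_ge[of w] by simp
    have "pt (enc w) 0 \<in> {0..<1}" using w by (intro pt_range enc_bwords) auto
    moreover have "\<Union> P = {0..<1}"
      using PQ(1) by (simp add: dyadic_subdivision_def partition_on_def)
    ultimately obtain I where I: "I \<in> P" "pt (enc w) 0 \<in> I" by blast
    then obtain t where t: "t \<in> {0..<1}" "pt (p I) t = pt (enc w) 0" using pq(3) by force
    obtain v where v: "enc w = p I @ v" "v \<in> bwords"
      by (rule pt_prefix[OF pq(1)[OF I(1)] enc_bwords[OF w(1)] t(1) _ t(2)])
        (use n[OF I(1)] len in auto)
    \<comment> \<open>The bound \<open>n + 2\<close> leaves two letters after \<open>p I\<close>, so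
      that \<open>q I @ v\<close> is the code of an edge even if \<open>q I\<close> is
      empty.\<close>
    have "2 \<le> length v" using v len n[OF I(1)] by simp
    then obtain w' where w': "w' \<in> ewords" "enc w' = q I @ v"
      using enc_ex[of "q I @ v"] pq(2)[OF I(1)] v by auto
    have "acts f w w'"
      unfolding acts_def pe_def w' v
      using pq(4)[OF I(1)] pt_range[OF v(2)] by (simp add: pt_append)
    then show ?thesis using w' by blast
  qed
  then show "\<exists>n. \<forall>w\<in>ewords. n \<le> length w \<longrightarrow> (\<exists>w'\<in>ewords. acts f w w')" by blast
next
  assume "f \<in> Bij {0..<1} \<and> (\<exists>n. \<forall>w\<in>ewords. n \<le> length w \<longrightarrow> (\<exists>w'\<in>ewords. acts f w w'))"
  then obtain n where f: "f \<in> Bij {0..<1}"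
    and n: "\<And>w. w \<in> ewords \<Longrightarrow> n \<le> length w \<Longrightarrow> \<exists>w'\<in>ewords. acts f w w'" by blast
  \<comment> \<open>\<open>Suc n\<close> and not \<open>n\<close>, because there is no edge word of
    length 0.\<close>
  define P where "P = (\<lambda>w. pe w ` {0..<1}) ` {w \<in> ewords. length w = Suc n}"
  have bij: "inj_on f {0..<1}" "f ` {0..<1} = {0..<1}"
    using f by (auto simp: Bij_def bij_betw_def)
  have part: "partition_on {0..<1} P" unfolding P_def by (rule partition_pe) simp
  have fin: "finite P" unfolding P_def by (intro finite_imageI finite_ewords_eq)
  have "partition_on {0..<1} ((\<lambda>I. f ` I) ` P)"
    using part bij unfolding partition_on_def
    by (auto simp: image_Union[symmetric] intro!: disjoint_image)
  moreover have "\<exists>k m. f ` I = {real k / 2 ^ m ..< (real k + 1) / 2 ^ m}" if I: "I \<in> P" for I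
  proof -
    obtain w where w: "w \<in> ewords" "length w = Suc n" "I = pe w ` {0..<1}"
      using I unfolding P_def by blast
    then obtain w' where "acts f w w'" using n[of w] by auto
    then have "f ` I = pe w' ` {0..<1}" using w(3) acts_image by simp
    then show ?thesis using pe_image[of w'] by simp
  qed
  ultimately have "dyadic_subdivision ((\<lambda>I. f ` I) ` P)"
    using fin unfolding dyadic_subdivision_def by blast
  moreover have "dyadic_subdivision P"
    unfolding dyadic_subdivision_def using fin part pe_image by (auto simp: P_def)
  moreover have "\<forall>I\<in>P. \<exists>a b. a > 0 \<and> (\<forall>x\<in>I. f x = a * x + b)"
  proof
    fix I assume "I \<in> P"
    then obtain w where w: "w \<in> ewords" "length w = Suc n" "I = pe w ` {0..<1}"
      unfolding P_def by blast
    then obtain w' where "acts f w w'" using n[of w] by auto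
    then show "\<exists>a b. a > 0 \<and> (\<forall>x\<in>I. f x = a * x + b)" unfolding w(3) by (metis acts_affine)
  qed
  ultimately show "f \<in> carrier thompson_V"
    using f unfolding thompson_V_def by auto
qed

lemma thompson_V_Bij: "f \<in> carrier thompson_V \<Longrightarrow> f \<in> Bij {0..<1}"
  by (simp add: thompson_V_carrier_iff)

text \<open>The letters beyond a fixed prefix are copied to the image, so long words have long
  images. This is what lets two conditions on sufficiently long words be composed.\<close>

lemma thompson_V_acts_long:
  assumes "f \<in> carrier thompson_V"
  obtains n where "\<And>w. w \<in> ewords \<Longrightarrow> n \<le> length w \<Longrightarrow> \<exists>w'\<in>ewords. m \<le> length w' \<and> acts f w w'"
proof -
  obtain n where n: "\<And>w. w \<in> ewords \<Longrightarrow> n \<le> length w \<Longrightarrow> \<exists>w'\<in>ewords. acts f w w'"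
    using assms by (auto simp: thompson_V_carrier_iff)
  show thesis
  proof (rule that[of "Suc n + m"])
    fix w assume w: "w \<in> ewords" "Suc n + m \<le> length w"
    define p u where "p = take (Suc n) w" and "u = drop (Suc n) w"
    have p: "p \<in> ewords" "u \<in> bwords" "w = p @ u" "n \<le> length p" "m \<le> length u"
      using w ewords_take ewords_drop by (auto simp: p_def u_def)
    then obtain p' where "p' \<in> ewords" "acts f p p'" using n by blast
    then show "\<exists>w'\<in>ewords. m \<le> length w' \<and> acts f w w'"
      using p acts_append by (intro bexI[of _ "p' @ u"]) auto
  qed
qed

lemma thompson_V_eqI:
  assumes "f \<in> carrier thompson_V" "g \<in> carrier thompson_V"
    and "\<And>w. w \<in> ewords \<Longrightarrow> length w = Suc n \<Longrightarrow> \<exists>w'. acts f w w' \<and> acts g w w'"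
  shows "f = g"
proof (rule extensionalityI)
  show "f \<in> extensional {0..<1}" "g \<in> extensional {0..<1}"
    using assms thompson_V_Bij by (auto simp: Bij_def)
  fix x :: real assume "x \<in> {0..<1}"
  then obtain w t where "w \<in> ewords" "length w = Suc n" "t \<in> {0..<1}" "x = pe w t"
    using pe_ex by blast
  then show "f x = g x" using assms(3)[of w] by (auto simp: acts_def)
qed

section \<open>Closure of V under composition and inverses\<close>

lemma acts_id: "w \<in> ewords \<Longrightarrow> acts (\<lambda>x\<in>{0..<1}. x) w w"
  using pe_range by (auto simp: acts_def)

lemma thompson_V_id: "(\<lambda>x\<in>{0..<1}. x) \<in> carrier thompson_V"
  unfolding thompson_V_carrier_iff using acts_id id_Bij by blast

lemma thompson_V_compose:
  assumes "f \<in> carrier thompson_V" "g \<in> carrier thompson_V"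
  shows "compose {0..<1} f g \<in> carrier thompson_V"
proof -
  obtain m where m: "\<And>w. w \<in> ewords \<Longrightarrow> m \<le> length w \<Longrightarrow> \<exists>w'\<in>ewords. acts f w w'"
    using assms by (auto simp: thompson_V_carrier_iff)
  obtain n where n: "\<And>w. w \<in> ewords \<Longrightarrow> n \<le> length w \<Longrightarrow> \<exists>w'\<in>ewords. m \<le> length w' \<and> acts g w w'"
    using thompson_V_acts_long[OF assms(2)] by blast
  have "\<exists>w'\<in>ewords. acts (compose {0..<1} f g) w w'" if "w \<in> ewords" "n \<le> length w" for w
    using n[OF that] m acts_compose that by meson
  then show ?thesis
    using assms compose_Bij unfolding thompson_V_carrier_iff by blast
qed

lemma acts_inv:
  assumes "f \<in> Bij {0..<1}" "acts f w v" "w \<in> ewords" "v \<in> ewords"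
  shows "acts (restrict (inv_into {0..<1} f) {0..<1}) v w"
  unfolding acts_def
proof
  fix t :: real assume t: "t \<in> {0..<1}"
  then have "pe w t \<in> {0..<1}" "pe v t \<in> {0..<1}" "f (pe w t) = pe v t"
    using assms pe_range by (auto simp: acts_def simp del: atLeastLessThan_iff)
  moreover have "inj_on f {0..<1}" using assms by (simp add: Bij_def bij_betw_def)
  ultimately show "restrict (inv_into {0..<1} f) {0..<1} (pe v t) = pe w t"
    by (metis inv_into_f_f restrict_apply')
qed

lemma thompson_V_inv:
  assumes f: "f \<in> carrier thompson_V"
  shows "restrict (inv_into {0..<1} f) {0..<1} \<in> carrier thompson_V"
proof -
  let ?g = "restrict (inv_into {0..<1} f) {0..<1}"
  have bij: "f \<in> Bij {0..<1}" using f by (rule thompson_V_Bij)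
  then have inj: "inj_on f {0..<1}" and surj: "f ` {0..<1} = {0..<1}"
    by (auto simp: Bij_def bij_betw_def)
  obtain n where n: "\<And>w. w \<in> ewords \<Longrightarrow> n \<le> length w \<Longrightarrow> \<exists>w'\<in>ewords. acts f w w'"
    using f by (auto simp: thompson_V_carrier_iff)
  then obtain h where h: "\<And>w. w \<in> ewords \<Longrightarrow> n \<le> length w \<Longrightarrow> h w \<in> ewords \<and> acts f w (h w)"
    by metis
  \<comment> \<open>A word \<open>v\<close> at least as long as all these images extends one of
    them: the image interval that contains the left end of \<open>v\<close> must contain all of its
    interval. The remaining letters are then carried back to \<open>w\<close>.\<close>
  obtain m where m: "\<And>w. w \<in> ewords \<Longrightarrow> length w = Suc n \<Longrightarrow> length (h w) \<le> m"
    using finite_nat_set_iff_bounded_le[of "(\<lambda>w. length (h w)) ` {w \<in> ewords. length w = Suc n}"]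
      finite_ewords_eq by auto
  have "\<exists>w'\<in>ewords. acts ?g v w'" if v: "v \<in> ewords" "m \<le> length v" for v
  proof -
    have "pe v 0 \<in> {0..<1}" using v pe_range by auto
    then obtain x where x: "x \<in> {0..<1}" "pe v 0 = f x" using surj by (metis imageE)
    then obtain w t where w: "w \<in> ewords" "length w = Suc n" "t \<in> {0..<1}" "x = pe w t"
      using pe_ex by blast
    then have hw: "h w \<in> ewords" "acts f w (h w)" using h by auto
    then have eq: "pe (h w) t = pe v 0" using x w by (simp add: acts_def)
    obtain u where "v = h w @ u" "u \<in> bwords"
      by (rule pe_prefix[OF hw(1) v(1) w(3) _ eq]) (use m[OF w(1,2)] v in auto)
    then have "acts ?g v (w @ u)" "w @ u \<in> ewords"
      using acts_inv[OF bij acts_append[OF hw(2) w(1) hw(1)]] w hw by auto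
    then show ?thesis by blast
  qed
  then show ?thesis using restrict_inv_into_Bij[OF bij] unfolding thompson_V_carrier_iff by blast
qed

text \<open>Glues prefix replacements along two partitions of [0,1). The uniqueness in
  \<open>ran\<close> concerns the index \<open>w\<close> and not its image, so it contains the
  injectivity of \<open>g\<close> on \<open>L\<close>.\<close>

lemma thompson_V_from_code:
  assumes L: "finite L" "L \<subseteq> ewords" and g: "g ` L \<subseteq> ewords"
    and dom: "\<And>x. x \<in> {0..<1} \<Longrightarrow> \<exists>!w. w \<in> L \<and> x \<in> pe w ` {0..<1}"
    and ran: "\<And>x. x \<in> {0..<1} \<Longrightarrow> \<exists>!w. w \<in> L \<and> x \<in> pe (g w) ` {0..<1}"
  obtains f where "f \<in> carrier thompson_V" "\<forall>w\<in>L. acts f w (g w)"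
proof -
  define W where "W x = (THE w. w \<in> L \<and> x \<in> pe w ` {0..<1})" for x
  define f where "f = (\<lambda>x\<in>{0..<1}. pe (g (W x)) (inv_into {0..<1} (pe (W x)) x))"
  have inj: "inj_on (pe w) {0..<1}" if "w \<in> ewords" for w
    using that by (auto intro!: inj_onI dest: pe_same_length(2))
  have act: "acts f w (g w)" if w: "w \<in> L" for w
    unfolding acts_def
  proof
    fix t :: real assume t: "t \<in> {0..<1}"
    then have x: "pe w t \<in> {0..<1}" using pe_range w L by blast
    then have "W (pe w t) = w" unfolding W_def using dom[OF x] w t by (intro the1_equality) auto
    then show "f (pe w t) = pe (g w) t"
      using x t inv_into_f_f[OF inj t] w L by (simp add: f_def subset_iff)
  qed
  have "bij_betw f {0..<1} {0..<1}"
    unfolding bij_betw_def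
  proof
    show "inj_on f {0..<1}"
    proof (rule inj_onI)
      fix x y :: real assume x: "x \<in> {0..<1}" and y: "y \<in> {0..<1}" and eq: "f x = f y"
      obtain w t where w: "w \<in> L" "t \<in> {0..<1}" "x = pe w t" using dom[OF x] by blast
      obtain v s where v: "v \<in> L" "s \<in> {0..<1}" "y = pe v s" using dom[OF y] by blast
      have fx: "f x = pe (g w) t" "f y = pe (g v) s" using act w v by (auto simp: acts_def)
      have gE: "g w \<in> ewords" "g v \<in> ewords" using g w(1) v(1) by auto
      have "f x \<in> {0..<1}" unfolding fx(1) by (rule pe_range[OF gE(1) w(2)])
      moreover have "f x \<in> pe (g w) ` {0..<1}" using fx w by blast
      moreover have "f x \<in> pe (g v) ` {0..<1}" using fx(2) v(2) eq by simp
      ultimately have wv: "w = v" using ran w(1) v(1) by blast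
      then have "t = s" using inj[OF gE(1)] fx eq w(2) v(2) by (auto dest!: inj_onD)
      then show "x = y" using wv w v by simp
    qed
    show "f ` {0..<1} = {0..<1}"
    proof
      show "f ` {0..<1} \<subseteq> {0..<1}"
      proof (rule image_subsetI)
        fix x :: real assume x: "x \<in> {0..<1}"
        obtain w t where w: "w \<in> L" "t \<in> {0..<1}" "x = pe w t" using dom[OF x] by blast
        then have "f x = pe (g w) t" using act by (auto simp: acts_def)
        moreover have "g w \<in> ewords" using g w(1) by auto
        ultimately show "f x \<in> {0..<1}" using pe_range[OF _ w(2)] by simp
      qed
      show "{0..<1} \<subseteq> f ` {0..<1}"
      proof
        fix y :: real assume "y \<in> {0..<1}"
        then obtain w t where w: "w \<in> L" "t \<in> {0..<1}" "y = pe (g w) t" using ran by blast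
        then have "y = f (pe w t)" "pe w t \<in> {0..<1}"
          using act pe_range L by (auto simp: acts_def simp del: atLeastLessThan_iff)
        then show "y \<in> f ` {0..<1}" by blast
      qed
    qed
  qed
  then have bij: "f \<in> Bij {0..<1}" by (simp add: Bij_def f_def)
  obtain n where n: "\<And>w. w \<in> L \<Longrightarrow> length w \<le> n"
    using finite_nat_set_iff_bounded_le[of "length ` L"] L by auto
  have "\<exists>w'\<in>ewords. acts f w w'" if w: "w \<in> ewords" "n \<le> length w" for w
  proof -
    have "pe w 0 \<in> {0..<1}" using w pe_range by auto
    then obtain v t where v: "v \<in> L" "t \<in> {0..<1}" "pe w 0 = pe v t" using dom by blast
    have vE: "v \<in> ewords" "g v \<in> ewords" using v L g by auto
    obtain u where u: "w = v @ u" "u \<in> bwords"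
      by (rule pe_prefix[OF vE(1) w(1) v(2) _ v(3)[symmetric]]) (use n[OF v(1)] w in auto)
    then have "acts f w (g v @ u)" using acts_append[OF act[OF v(1)] vE] by blast
    moreover have "g v @ u \<in> ewords" using vE u by simp
    ultimately show ?thesis by blast
  qed
  then have "f \<in> carrier thompson_V" using bij unfolding thompson_V_carrier_iff by blast
  then show thesis using that act by blast
qed

section \<open>The Farey tree in terms of words\<close>

text \<open>The two halves of the edge \<open>w\<close>: the outer one (at \<open>w\<close> itself) if \<open>b\<close>, the inner one otherwise.\<close>

definition hf :: "nat list \<Rightarrow> bool \<Rightarrow> nat list \<times> nat list" where
  "hf w b = (if b then w else butlast w, w)"

abbreviation (input) F :: "(nat list + nat list, nat list \<times> nat list) ribbon_graph" where
  "F \<equiv> farey_tree"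

lemma hf_eq_iff: "w \<in> ewords \<Longrightarrow> hf w b = hf v c \<longleftrightarrow> w = v \<and> b = c"
  by (cases w rule: rev_cases) (auto simp: hf_def)

lemma verts_farey: "verts F = Inl ` words \<union> Inr ` ewords"
  by (simp add: farey_tree_def subdivision_def trivalent_tree_def words_def ewords_def)

lemma edges_farey: "edges F = {hf w b | w b. w \<in> ewords}"
  by (auto simp: farey_tree_def subdivision_def trivalent_tree_def ewords_def hf_def)

lemma hf_in_edges: "w \<in> ewords \<Longrightarrow> hf w b \<in> edges F"
  by (auto simp: edges_farey)

lemma edges_fareyE:
  assumes "e \<in> edges F" obtains w b where "w \<in> ewords" "e = hf w b"
  using assms by (auto simp: edges_farey)

lemma ends_farey: "ends F (hf w b) = {Inl (if b then w else butlast w), Inr w}"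
  by (simp add: farey_tree_def subdivision_def hf_def)

lemma rot_farey_Inr: "w \<in> ewords \<Longrightarrow> rot F (Inr w) (hf w b) = hf w (\<not> b)"
proof -
  assume "w \<in> ewords"
  then have "butlast w \<noteq> w" by (cases w rule: rev_cases) auto
  then have "{butlast w, w} - {w} = {butlast w}" "{butlast w, w} - {butlast w} = {w}" by auto
  then show ?thesis
    by (simp add: farey_tree_def subdivision_def trivalent_tree_def hf_def)
qed

lemma rot_farey_root: "rot F (Inl []) (hf [a] False) = hf [(a + 1) mod 3] False"
  by (simp add: farey_tree_def subdivision_def trivalent_tree_def hf_def)

lemma rot_farey_Inl:
  assumes "v \<noteq> []"
  shows "rot F (Inl v) (hf v True) = hf (v @ [0]) False"
    and "rot F (Inl v) (hf (v @ [0]) False) = hf (v @ [1]) False"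
    and "rot F (Inl v) (hf (v @ [1]) False) = hf v True"
  using assms by (simp_all add: farey_tree_def subdivision_def trivalent_tree_def hf_def)

lemma hf_in_incident:
  "w \<in> ewords \<Longrightarrow> hf w b \<in> incident F x \<longleftrightarrow> x = Inr w \<or> x = Inl (if b then w else butlast w)"
  by (auto simp: incident_def ends_farey hf_in_edges)

lemma incident_InlE:
  assumes "e \<in> incident F (Inl v)"
  obtains w b where "w \<in> ewords" "e = hf w b" "v = (if b then w else butlast w)"
proof -
  have "e \<in> edges F" using assms by (simp add: incident_def)
  then obtain w b where w: "w \<in> ewords" "e = hf w b" by (rule edges_fareyE)
  then show thesis using that[OF w] assms hf_in_incident[OF w(1), of b "Inl v"] by simp
qed

lemma incident_Inr: "w \<in> ewords \<Longrightarrow> incident F (Inr w) = {hf w False, hf w True}"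
proof (intro equalityI subsetI)
  fix e assume "w \<in> ewords" and e: "e \<in> incident F (Inr w)"
  have "e \<in> edges F" using e by (simp add: incident_def)
  then obtain v b where v: "v \<in> ewords" "e = hf v b" by (rule edges_fareyE)
  then have "w = v" using e hf_in_incident[OF v(1), of b "Inr w"] by simp
  with v show "e \<in> {hf w False, hf w True}" by (cases b) auto
qed (auto simp: hf_in_incident)

lemma incident_root: "incident F (Inl []) = {hf [a] False | a. a < 3}"
proof (intro equalityI subsetI)
  fix e assume "e \<in> incident F (Inl [])"
  then obtain w b where w: "w \<in> ewords" "e = hf w b" "[] = (if b then w else butlast w)"
    by (rule incident_InlE)
  then have "\<not> b" "butlast w = []" by (auto split: if_splits)
  moreover from w(1) obtain a u where "w = a # u" "a < 3" by (rule ewords_E)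
  ultimately show "e \<in> {hf [a] False | a. a < 3}" using w by (auto split: if_splits)
next
  fix e assume "e \<in> {hf [a] False | a. a < 3}"
  then obtain a where "e = hf [a] False" "a < 3" by blast
  then show "e \<in> incident F (Inl [])" by (simp add: hf_in_incident)
qed

lemma ewords_children: "v \<in> ewords \<Longrightarrow> w \<in> ewords \<Longrightarrow> butlast w = v \<Longrightarrow> w = v @ [0] \<or> w = v @ [1]"
  by (cases w rule: rev_cases) (auto simp: ewords_snoc split: if_splits)

lemma incident_Inl:
  assumes "v \<in> ewords"
  shows "incident F (Inl v) = {hf v True, hf (v @ [0]) False, hf (v @ [1]) False}"
proof (intro equalityI subsetI)
  fix e assume "e \<in> incident F (Inl v)"
  then obtain w b where w: "w \<in> ewords" "e = hf w b" "v = (if b then w else butlast w)"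
    by (rule incident_InlE)
  then show "e \<in> {hf v True, hf (v @ [0]) False, hf (v @ [1]) False}"
    using ewords_children[OF assms w(1)] by (auto split: if_splits)
next
  fix e assume "e \<in> {hf v True, hf (v @ [0]) False, hf (v @ [1]) False}"
  moreover have "v @ [0] \<in> ewords" "v @ [1] \<in> ewords" using assms by auto
  ultimately show "e \<in> incident F (Inl v)" using assms by (auto simp: hf_in_incident)
qed

lemma degree_Inl: "v \<in> words \<Longrightarrow> degree F (Inl v) = 3"
proof (cases "v = []")
  case True
  have "{hf [a] False | a. a < 3} = (\<lambda>a. hf [a] False) ` {..<3}" by auto
  moreover have "inj_on (\<lambda>a. hf [a] False) {..<3}" by (auto simp: inj_on_def hf_def)
  ultimately show ?thesis using True by (simp add: degree_def incident_root card_image)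
next
  case False
  assume "v \<in> words"
  with False have v: "v \<in> ewords" by (simp add: words_eq)
  then show ?thesis using hf_eq_iff[OF v] hf_eq_iff[of "v @ [0]"]
    by (simp add: degree_def incident_Inl)
qed

lemma degree_Inr: "w \<in> ewords \<Longrightarrow> degree F (Inr w) = 2"
  by (simp add: degree_def incident_Inr hf_eq_iff)

lemma twins_iff:
  assumes "w \<in> ewords" "v \<in> ewords"
  shows "twins F (hf w b) (hf v c) \<longleftrightarrow> w = v \<and> b \<noteq> c"
proof
  assume t: "twins F (hf w b) (hf v c)"
  then obtain x where x: "x \<in> verts F" "degree F x = 2" "hf w b \<in> incident F x" "hf v c \<in> incident F x"
    by (auto simp: twins_def)
  then obtain u where "u \<in> ewords" "x = Inr u" by (auto simp: verts_farey degree_Inl)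
  then show "w = v \<and> b \<noteq> c" using x t assms
    by (auto simp: incident_Inr hf_eq_iff twins_def)
next
  assume "w = v \<and> b \<noteq> c"
  then show "twins F (hf w b) (hf v c)"
    unfolding twins_def using assms
    by (auto simp: hf_eq_iff verts_farey degree_Inr incident_Inr intro!: bexI[of _ "Inr v"])
qed

section \<open>Finite subtrees containing the root\<close>

text \<open>A finite subtree containing the root is given by its degree-3 vertices; the degree-2 vertices
  taken with them are the midpoints of the edges leading to them.\<close>

definition tree_dom :: "nat list set \<Rightarrow> bool" where
  "tree_dom I \<longleftrightarrow> finite I \<and> [] \<in> I \<and> I \<subseteq> words \<and> (\<forall>w\<in>I. butlast w \<in> I)"

definition full_subtree :: "nat list set \<Rightarrow> (nat list + nat list) set" where
  "full_subtree I = Inl ` I \<union> Inr ` (I - {[]})"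

lemma finite_full_subtree:
  assumes I: "tree_dom I"
  shows "finite_subtree F (full_subtree I)"
proof -
  define R where "R = {(a, b). a \<in> full_subtree I \<and> b \<in> full_subtree I \<and> (\<exists>e\<in>edges F. ends F e = {a, b})}"
  have "sym R" by (auto simp: R_def sym_def insert_commute)
  have R: "(Inl w, Inr w) \<in> R" "(Inr w, Inl (butlast w)) \<in> R" if w: "w \<in> I" "w \<noteq> []" for w
  proof -
    have "w \<in> ewords" using w I by (auto simp: tree_dom_def words_eq)
    then have "hf w True \<in> edges F" "hf w False \<in> edges F" by (auto intro: hf_in_edges)
    moreover have "Inl w \<in> full_subtree I" "Inr w \<in> full_subtree I" "Inl (butlast w) \<in> full_subtree I"
      using w I by (auto simp: tree_dom_def full_subtree_def)
    moreover have "ends F (hf w True) = {Inl w, Inr w}" "ends F (hf w False) = {Inr w, Inl (butlast w)}"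
      by (auto simp: ends_farey)
    ultimately show "(Inl w, Inr w) \<in> R" "(Inr w, Inl (butlast w)) \<in> R"
      unfolding R_def by blast+
  qed
  have root: "w \<in> I \<Longrightarrow> (Inl w, Inl []) \<in> R\<^sup>*" for w
  proof (induction w rule: rev_induct)
    case (snoc a w)
    then have "w \<in> I" using I by (force simp: tree_dom_def)
    then show ?case using R[OF snoc.prems] snoc.IH
      by (simp add: converse_rtrancl_into_rtrancl)
  qed auto
  have "(x, Inl []) \<in> R\<^sup>*" if "x \<in> full_subtree I" for x
  proof (cases x)
    case (Inl w)
    then show ?thesis using that root by (auto simp: full_subtree_def)
  next
    case (Inr w)
    then have w: "w \<in> I" "w \<noteq> []" using that by (auto simp: full_subtree_def)
    then have "butlast w \<in> I" using I by (auto simp: tree_dom_def)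
    then show ?thesis using R(2)[OF w] root Inr by (simp add: converse_rtrancl_into_rtrancl)
  qed
  moreover have "sym (R\<^sup>*)" using \<open>sym R\<close> by (rule sym_rtrancl)
  ultimately have "\<forall>u\<in>full_subtree I. \<forall>w\<in>full_subtree I. (u, w) \<in> R\<^sup>*" by (meson rtrancl_trans symD)
  moreover have "finite (full_subtree I)" "full_subtree I \<noteq> {}" using I by (auto simp: full_subtree_def tree_dom_def)
  moreover have "full_subtree I \<subseteq> verts F" using I by (auto simp: full_subtree_def verts_farey tree_dom_def words_eq)
  ultimately show ?thesis unfolding finite_subtree_def R_def by blast
qed

text \<open>A midpoint belongs to a full subtree exactly when the outer end of its edge does, so the
  two halves of an edge are kept or deleted together.\<close>

lemma edges_remove_full_subtree:
  assumes "tree_dom I"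
  shows "edges (remove F (full_subtree I)) = {hf w b | w b. w \<in> ewords \<and> w \<notin> I}"
proof -
  have "hf w b \<in> edges (remove F (full_subtree I)) \<longleftrightarrow> w \<notin> I" if "w \<in> ewords" for w b
    using assms that by (auto simp: remove_def ends_farey full_subtree_def tree_dom_def hf_in_edges)
  moreover have "edges (remove F (full_subtree I)) \<subseteq> edges F" by (auto simp: remove_def)
  ultimately show ?thesis by (blast elim: edges_fareyE)
qed

lemma tree_dom_ball: "0 < n \<Longrightarrow> tree_dom {w \<in> words. length w < n}"
  unfolding tree_dom_def
proof (intro conjI ballI)
  assume n: "0 < n"
  have "{w \<in> words. length w < n} \<subseteq> insert [] {w \<in> ewords. length w < n}" by (auto simp: words_eq)
  then show "finite {w \<in> words. length w < n}"
    using finite_ewords_less by (meson finite.insertI finite_subset)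
  show "butlast w \<in> {w \<in> words. length w < n}" if "w \<in> {w \<in> words. length w < n}" for w
    using that butlast_words by (auto simp: words_eq)
qed (auto simp: words_eq)

lemma finite_vertices_bound:
  assumes "finite T"
  obtains n where "\<And>w. Inl w \<in> T \<Longrightarrow> length w < n" "\<And>w. Inr w \<in> T \<Longrightarrow> length w < n"
proof -
  have "finite (case_sum length length ` T)" using assms by simp
  then obtain n where n: "\<forall>k\<in>case_sum length length ` T. k < n"
    using finite_nat_set_iff_bounded by blast
  then show thesis by (intro that[of n]) force+
qed

section \<open>Germs and elements of Thompson's group\<close>

text \<open>Being a condition on long words only, it depends on \<open>s\<close> only through its
  germ. The same \<open>b\<close> on both sides says that far edges keep their direction away from
  the root.\<close>

definition realizes :: "(real \<Rightarrow> real) \<Rightarrow> (nat list \<times> nat list \<Rightarrow> nat list \<times> nat list) \<Rightarrow> bool" where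
  "realizes f s \<longleftrightarrow> (\<exists>n. \<forall>w\<in>ewords. n \<le> length w \<longrightarrow>
     (\<exists>w'\<in>ewords. acts f w w' \<and> (\<forall>b. s (hf w b) = hf w' b)))"

lemma realizesE:
  assumes "realizes f s"
  obtains n where "\<And>w. w \<in> ewords \<Longrightarrow> n \<le> length w \<Longrightarrow>
    \<exists>w'\<in>ewords. acts f w w' \<and> (\<forall>b. s (hf w b) = hf w' b)"
  using assms by (auto simp: realizes_def)

lemma realizes_agree:
  assumes "realizes f s" "finite_subtree F T" "\<forall>e\<in>edges (remove F T). t e = s e"
  shows "realizes f t"
proof -
  obtain n where n: "\<And>w. w \<in> ewords \<Longrightarrow> n \<le> length w \<Longrightarrow>
    \<exists>w'\<in>ewords. acts f w w' \<and> (\<forall>b. s (hf w b) = hf w' b)" using realizesE[OF assms(1)] by blast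
  have "finite T" using assms(2) by (simp add: finite_subtree_def)
  then obtain m where m: "\<And>w. Inr w \<in> T \<Longrightarrow> length w < m" using finite_vertices_bound by blast
  have "t (hf w b) = s (hf w b)" if w: "w \<in> ewords" "m \<le> length w" for w b
  proof -
    have "Inr w \<notin> T" using m[of w] w by auto
    then have "hf w b \<in> edges (remove F T)"
      using w by (auto simp: remove_def ends_farey hf_in_edges)
    then show ?thesis using assms(3) by blast
  qed
  then show ?thesis unfolding realizes_def using n by (intro exI[of _ "max n m"]) auto
qed

lemma realizes_same:
  assumes "realizes f s" "realizes f t"
  obtains T where "finite_subtree F T" "\<forall>e\<in>edges (remove F T). t e = s e"
proof -
  obtain n where n: "\<And>w. w \<in> ewords \<Longrightarrow> n \<le> length w \<Longrightarrow>
    \<exists>w'\<in>ewords. acts f w w' \<and> (\<forall>b. s (hf w b) = hf w' b)" using realizesE[OF assms(1)] by blast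
  obtain m where m: "\<And>w. w \<in> ewords \<Longrightarrow> m \<le> length w \<Longrightarrow>
    \<exists>w'\<in>ewords. acts f w w' \<and> (\<forall>b. t (hf w b) = hf w' b)" using realizesE[OF assms(2)] by blast
  define I where "I = {w \<in> words. length w < Suc (max n m)}"
  have I: "tree_dom I" unfolding I_def by (rule tree_dom_ball) simp
  have "t (hf w b) = s (hf w b)" if "w \<in> ewords" "w \<notin> I" for w b
  proof -
    have "n \<le> length w" "m \<le> length w" using that by (auto simp: I_def words_eq)
    then show ?thesis using n[of w] m[of w] that acts_unique by metis
  qed
  then have "\<forall>e\<in>edges (remove F (full_subtree I)). t e = s e" by (auto simp: edges_remove_full_subtree[OF I])
  then show thesis using that finite_full_subtree[OF I] by blast
qed

text \<open>If nonempty, this is a single germ: any two maps realizing \<open>f\<close> agree off a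
  finite subtree.\<close>

definition germ_of :: "(real \<Rightarrow> real) \<Rightarrow> (nat list \<times> nat list \<Rightarrow> nat list \<times> nat list) set" where
  "germ_of f = {t \<in> near_auts F. realizes f t}"

lemma germ_eq_germ_of: "realizes f s \<Longrightarrow> germ F s = germ_of f"
  unfolding germ_def germ_of_def using realizes_agree realizes_same by (metis (lifting))

lemma realizes_unique:
  assumes "f \<in> carrier thompson_V" "g \<in> carrier thompson_V" "realizes f s" "realizes g s"
  shows "f = g"
proof -
  obtain n where n: "\<And>w. w \<in> ewords \<Longrightarrow> n \<le> length w \<Longrightarrow>
    \<exists>w'\<in>ewords. acts f w w' \<and> (\<forall>b. s (hf w b) = hf w' b)" using realizesE[OF assms(3)] by blast
  obtain m where m: "\<And>w. w \<in> ewords \<Longrightarrow> m \<le> length w \<Longrightarrow>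
    \<exists>w'\<in>ewords. acts g w w' \<and> (\<forall>b. s (hf w b) = hf w' b)" using realizesE[OF assms(4)] by blast
  have "\<exists>w'. acts f w w' \<and> acts g w w'" if w: "w \<in> ewords" "length w = Suc (max n m)" for w
  proof -
    have nm: "n \<le> length w" "m \<le> length w" using w by auto
    obtain w' where w': "w' \<in> ewords" "acts f w w'" "\<forall>b. s (hf w b) = hf w' b"
      using n[OF w(1)] nm by blast
    obtain v' where "v' \<in> ewords" "acts g w v'" "\<forall>b. s (hf w b) = hf v' b"
      using m[OF w(1)] nm by blast
    then show ?thesis using hf_eq_iff w' by metis
  qed
  then show ?thesis using thompson_V_eqI assms by blast
qed

lemma realizes_id: "realizes (\<lambda>x\<in>{0..<1}. x) (\<lambda>e\<in>edges F. e)"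
  unfolding realizes_def using acts_id hf_in_edges by auto

lemma realizes_compose:
  assumes g: "g \<in> carrier thompson_V" and fs: "realizes f s" and gt: "realizes g t"
  shows "realizes (compose {0..<1} f g) (compose (edges F) s t)"
proof -
  obtain m where m: "\<And>w. w \<in> ewords \<Longrightarrow> m \<le> length w \<Longrightarrow>
    \<exists>w'\<in>ewords. acts f w w' \<and> (\<forall>b. s (hf w b) = hf w' b)" using realizesE[OF fs] by blast
  obtain n where n: "\<And>w. w \<in> ewords \<Longrightarrow> n \<le> length w \<Longrightarrow>
    \<exists>w'\<in>ewords. acts g w w' \<and> (\<forall>b. t (hf w b) = hf w' b)" using realizesE[OF gt] by blast
  obtain k where k: "\<And>w. w \<in> ewords \<Longrightarrow> k \<le> length w \<Longrightarrow> \<exists>w'\<in>ewords. m \<le> length w' \<and> acts g w w'"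
    using thompson_V_acts_long[OF g] by blast
  have "\<exists>w'\<in>ewords. acts (compose {0..<1} f g) w w' \<and> (\<forall>b. compose (edges F) s t (hf w b) = hf w' b)"
    if w: "w \<in> ewords" "max n k \<le> length w" for w
  proof -
    obtain v where v: "v \<in> ewords" "acts g w v" "\<And>b. t (hf w b) = hf v b" using n[of w] w by auto
    obtain v' where "v' \<in> ewords" "m \<le> length v'" "acts g w v'" using k[of w] w by auto
    then have "m \<le> length v" using acts_unique v by metis
    then obtain u where u: "u \<in> ewords" "acts f v u" "\<And>b. s (hf v b) = hf u b" using m v by blast
    have "acts (compose {0..<1} f g) w u" using acts_compose u v w by blast
    moreover have "compose (edges F) s t (hf w b) = hf u b" for b
      using w u v hf_in_edges by (simp add: compose_def)
    ultimately show ?thesis using u by blast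
  qed
  then show ?thesis unfolding realizes_def by blast
qed

section \<open>Products and inverses of realized germs\<close>

abbreviation V_inv :: "(real \<Rightarrow> real) \<Rightarrow> real \<Rightarrow> real" where
  "V_inv f \<equiv> restrict (inv_into {0..<1} f) {0..<1}"

text \<open>Nothing is assumed of \<open>s\<close> itself. As \<open>f\<close> is onto, every long
  edge \<open>v\<close> is the image under \<open>t\<close> of an edge \<open>w\<close>, and
  \<open>w\<close> is long as well if \<open>v\<close> is long enough; the composition then dictates
  the value of \<open>s\<close> at \<open>v\<close>.\<close>

lemma realizes_left_inverse:
  assumes f: "f \<in> carrier thompson_V" and ft: "realizes f t"
    and st: "realizes (\<lambda>x\<in>{0..<1}. x) (compose (edges F) s t)"
  shows "realizes (V_inv f) s"
proof -
  obtain m where m: "\<And>w. w \<in> ewords \<Longrightarrow> m \<le> length w \<Longrightarrow>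
    \<exists>w'\<in>ewords. acts f w w' \<and> (\<forall>b. t (hf w b) = hf w' b)" using realizesE[OF ft] by blast
  obtain n where n: "\<And>w. w \<in> ewords \<Longrightarrow> n \<le> length w \<Longrightarrow>
    \<exists>w'\<in>ewords. acts (\<lambda>x\<in>{0..<1}. x) w w' \<and> (\<forall>b. compose (edges F) s t (hf w b) = hf w' b)"
    using realizesE[OF st] by blast
  obtain k where k: "\<And>w. w \<in> ewords \<Longrightarrow> k \<le> length w \<Longrightarrow>
      \<exists>w'\<in>ewords. max m n \<le> length w' \<and> acts (V_inv f) w w'"
    using thompson_V_acts_long[OF thompson_V_inv[OF f]] by blast
  have bij: "f ` {0..<1} = {0..<1}" using thompson_V_Bij[OF f] by (simp add: Bij_def bij_betw_def)
  have "\<exists>w\<in>ewords. acts (V_inv f) v w \<and> (\<forall>b. s (hf v b) = hf w b)"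
    if v: "v \<in> ewords" "k \<le> length v" for v
  proof -
    obtain w where w: "w \<in> ewords" "max m n \<le> length w" "acts (V_inv f) v w" using k v by blast
    have "acts f w v"
      unfolding acts_def
    proof
      fix x :: real assume x: "x \<in> {0..<1}"
      have y: "pe v x \<in> {0..<1}" using pe_range v x by blast
      then have "V_inv f (pe v x) = pe w x" using w(3) x unfolding acts_def by blast
      then have "pe w x = inv_into {0..<1} f (pe v x)" using y by simp
      then show "f (pe w x) = pe v x" using y bij by (simp add: f_inv_into_f)
    qed
    then have t: "t (hf w b) = hf v b" for b using m[of w] w v acts_unique by fastforce
    have "compose (edges F) s t (hf w b) = hf w b" for b
    proof -
      obtain w' where "w' \<in> ewords" "acts (\<lambda>x\<in>{0..<1}. x) w w'"
        "compose (edges F) s t (hf w b) = hf w' b" using n[OF w(1)] w(2) by auto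
      then show ?thesis using acts_unique[OF _ acts_id[OF w(1)]] w(1) by metis
    qed
    then have "s (hf v b) = hf w b" for b using t w hf_in_edges by (simp add: compose_def)
    then show ?thesis using w by blast
  qed
  then show ?thesis unfolding realizes_def by blast
qed

text \<open>All representatives give the same germ of the composition, so the union in the product
  has only one distinct member. Nonemptiness is needed, since otherwise the union would be
  empty.\<close>

lemma germ_of_mult:
  assumes f: "f \<in> carrier thompson_V" and g: "g \<in> carrier thompson_V"
    and ne: "germ_of f \<noteq> {}" "germ_of g \<noteq> {}"
  shows "germ_of f \<otimes>\<^bsub>germ_group F\<^esub> germ_of g = germ_of (compose {0..<1} f g)"
proof -
  have "germ F (compose (edges F) s t) = germ_of (compose {0..<1} f g)"
    if "s \<in> germ_of f" "t \<in> germ_of g" for s t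
    using that g by (intro germ_eq_germ_of realizes_compose) (auto simp: germ_of_def)
  then show ?thesis using ne by (auto simp: germ_group_def)
qed

lemma germ_of_one: "\<one>\<^bsub>germ_group F\<^esub> = germ_of (\<lambda>x\<in>{0..<1}. x)"
  using germ_eq_germ_of[OF realizes_id] by (simp add: germ_group_def)

lemma germ_of_carrier: "germ_of f \<noteq> {} \<Longrightarrow> germ_of f \<in> carrier (germ_group F)"
  using germ_eq_germ_of by (force simp: germ_group_def germ_of_def)

text \<open>The inverse is a definite description, so uniqueness has to be checked against every
  combinatorial germ \<open>y\<close> and not only against those coming from V. A member
  \<open>u\<close> of the identity germ yields representatives \<open>s\<close> and \<open>t\<close>
  of the two factors, to which \<open>realizes_left_inverse\<close> applies.\<close>

lemma germ_of_inv:
  assumes f: "f \<in> carrier thompson_V"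
    and ne: "\<And>g. g \<in> carrier thompson_V \<Longrightarrow> germ_of g \<noteq> {}"
  shows "inv\<^bsub>germ_group F\<^esub> (germ_of f) = germ_of (V_inv f)"
proof -
  let ?G = "germ_group F" and ?id = "\<lambda>x\<in>{0..<1::real}. x"
  have V: "V_inv f \<in> carrier thompson_V" using f by (rule thompson_V_inv)
  have bij: "f \<in> Bij {0..<1}" using f by (rule thompson_V_Bij)
  then have b: "inj_on f {0..<1}" "f ` {0..<1} = {0..<1}" by (auto simp: Bij_def bij_betw_def)
  have c1: "compose {0..<1} f (V_inv f) = ?id" using b by (auto simp: compose_def f_inv_into_f)
  have "V_inv f (f x) = x" if "x \<in> {0..<1}" for x
    using that b by (metis image_eqI inv_into_f_f restrict_apply')
  then have c2: "compose {0..<1} (V_inv f) f = ?id" by (auto simp: compose_def)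
  show ?thesis
    unfolding m_inv_def
  proof (rule the_equality)
    show "germ_of (V_inv f) \<in> carrier ?G \<and> germ_of f \<otimes>\<^bsub>?G\<^esub> germ_of (V_inv f) = \<one>\<^bsub>?G\<^esub> \<and>
        germ_of (V_inv f) \<otimes>\<^bsub>?G\<^esub> germ_of f = \<one>\<^bsub>?G\<^esub>"
      using f V ne germ_of_carrier c1 c2 by (simp add: germ_of_mult germ_of_one)
  next
    fix y
    assume y: "y \<in> carrier ?G \<and> germ_of f \<otimes>\<^bsub>?G\<^esub> y = \<one>\<^bsub>?G\<^esub> \<and> y \<otimes>\<^bsub>?G\<^esub> germ_of f = \<one>\<^bsub>?G\<^esub>"
    then obtain r where r: "r \<in> near_auts F" "y = germ F r" by (auto simp: germ_group_def)
    obtain u where "u \<in> germ_of ?id" using ne[OF thompson_V_id] by blast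
    then have "u \<in> y \<otimes>\<^bsub>?G\<^esub> germ_of f" using y germ_of_one by simp
    then obtain s t where st: "s \<in> y" "t \<in> germ_of f" "u \<in> germ F (compose (edges F) s t)"
      by (auto simp: germ_group_def)
    have "u \<in> near_auts F" "realizes ?id u" using \<open>u \<in> germ_of ?id\<close> by (auto simp: germ_of_def)
    moreover obtain T where T: "finite_subtree F T"
      "\<forall>e\<in>edges (remove F T). u e = compose (edges F) s t e" using st(3) by (auto simp: germ_def)
    ultimately have "realizes ?id (compose (edges F) s t)" using realizes_agree[of ?id u T] by metis
    then have s: "realizes (V_inv f) s"
      using realizes_left_inverse[OF f] st(2) by (auto simp: germ_of_def)
    obtain T where "finite_subtree F T" "\<forall>e\<in>edges (remove F T). s e = r e"
      using st(1) r by (auto simp: germ_def)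
    then have "realizes (V_inv f) r" using s realizes_agree[of "V_inv f" s T] by metis
    then show "y = germ_of (V_inv f)" using r germ_eq_germ_of by simp
  qed
qed

text \<open>Reduces the theorem to three facts. By \<open>real\<close> and closure under the
  operations, every generated germ is some \<open>germ_of f\<close>; by \<open>gen\<close> all of
  these occur; by \<open>ne\<close> each has a representative, which determines \<open>f\<close>.
  The isomorphism is the inverse of \<open>germ_of\<close>.\<close>

lemma generated_germs_iso:
  assumes ne: "\<And>f. f \<in> carrier thompson_V \<Longrightarrow> germ_of f \<noteq> {}"
    and gen: "\<And>f. f \<in> carrier thompson_V \<Longrightarrow>
      germ_of f \<in> generate (germ_group F) (carrier (germ_group F) \<inter> germ F ` S)"
    and real: "\<And>s. s \<in> S \<Longrightarrow> \<exists>f\<in>carrier thompson_V. realizes f s"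
  shows "subgroup_generated (germ_group F) (germ F ` S) \<cong> thompson_V"
proof -
  let ?K = "generate (germ_group F) (carrier (germ_group F) \<inter> germ F ` S)"
  let ?h = "inv_into (carrier thompson_V) germ_of"
  have "\<exists>f\<in>carrier thompson_V. A = germ_of f" if "A \<in> ?K" for A
    using that
  proof induction
    case one
    then show ?case using germ_of_one thompson_V_id by blast
  next
    case (incl A)
    then show ?case using real germ_eq_germ_of by blast
  next
    case (inv A)
    then obtain s where "s \<in> S" "A = germ F s" by blast
    then obtain f where "f \<in> carrier thompson_V" "A = germ_of f" using real germ_eq_germ_of by blast
    then show ?case using germ_of_inv ne thompson_V_inv by metis
  next
    case (eng A B)
    then show ?case using germ_of_mult ne thompson_V_compose by metis
  qed
  then have K: "?K = germ_of ` carrier thompson_V" using gen by auto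
  have inj: "inj_on germ_of (carrier thompson_V)"
  proof (rule inj_onI)
    fix f g assume fg: "f \<in> carrier thompson_V" "g \<in> carrier thompson_V" "germ_of f = germ_of g"
    then obtain t where "t \<in> germ_of f" using ne by blast
    then have "realizes f t" "realizes g t" using fg by (auto simp: germ_of_def)
    then show "f = g" using realizes_unique fg by blast
  qed
  have carr: "carrier (subgroup_generated (germ_group F) (germ F ` S)) = ?K"
    by (simp add: subgroup_generated_def)
  have mult: "f \<otimes>\<^bsub>thompson_V\<^esub> g = compose {0..<1} f g"
    if "f \<in> carrier thompson_V" "g \<in> carrier thompson_V" for f g
  proof -
    have "f \<in> Bij {0..<1}" "g \<in> Bij {0..<1}" using that thompson_V_Bij by blast+
    then show ?thesis unfolding thompson_V_def BijGroup_def by simp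
  qed
  have "?h \<in> iso (subgroup_generated (germ_group F) (germ F ` S)) thompson_V"
  proof (rule isoI)
    show "bij_betw ?h (carrier (subgroup_generated (germ_group F) (germ F ` S))) (carrier thompson_V)"
      unfolding carr K using inj by (intro bij_betw_inv_into) (simp add: bij_betw_def)
    show "?h \<in> hom (subgroup_generated (germ_group F) (germ F ` S)) thompson_V"
    proof (rule homI)
      fix A assume "A \<in> carrier (subgroup_generated (germ_group F) (germ F ` S))"
      then show "?h A \<in> carrier thompson_V" unfolding carr K by (rule inv_into_into)
    next
      fix A B assume "A \<in> carrier (subgroup_generated (germ_group F) (germ F ` S))"
        "B \<in> carrier (subgroup_generated (germ_group F) (germ F ` S))"
      then obtain f g where fg: "f \<in> carrier thompson_V" "A = germ_of f"
        "g \<in> carrier thompson_V" "B = germ_of g" unfolding carr K by blast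
      have "A \<otimes>\<^bsub>subgroup_generated (germ_group F) (germ F ` S)\<^esub> B = germ_of (compose {0..<1} f g)"
        using germ_of_mult fg ne by (simp add: subgroup_generated_def)
      then show "?h (A \<otimes>\<^bsub>subgroup_generated (germ_group F) (germ F ` S)\<^esub> B) = ?h A \<otimes>\<^bsub>thompson_V\<^esub> ?h B"
        using fg inj thompson_V_compose[of f g] mult[of f g] by (simp add: inv_into_f_f)
    qed
  qed
  then show ?thesis by (auto simp: is_iso_def)
qed

section \<open>Generators act on the boundary circle\<close>

text \<open>Tells vertices apart by rotation alone: at a midpoint, rotating twice returns to the
  same half edge.\<close>

lemma rot_rot_Inl_neq:
  assumes "v \<in> words" "e \<in> incident F (Inl v)"
  shows "rot F (Inl v) (rot F (Inl v) e) \<noteq> e"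
proof (cases "v = []")
  case True
  then obtain a where a: "e = hf [a] False" "a < 3" using assms incident_root by auto
  have "((a + 1) mod 3 + 1) mod 3 \<noteq> a" using a by (simp add: mod_Suc)
  then show ?thesis using a True rot_farey_root by (simp add: hf_def)
next
  case False
  with assms have v: "v \<in> ewords" by (simp add: words_eq)
  then have "hf (v @ [0]) False \<noteq> hf (v @ [1]) False" "hf v True \<noteq> hf (v @ [1]) False"
    "hf v True \<noteq> hf (v @ [0]) False"
    by (auto simp: hf_def)
  then show ?thesis using assms(2) rot_farey_Inl[OF False] incident_Inl[OF v] by auto
qed

text \<open>What the two kinds of generators have in common: \<open>T\<close> is the deleted source
  subtree for a ribbon near-automorphism and the shuffled vertex for a shuffle.\<close>

locale ribbon_off =
  fixes T :: "(nat list + nat list) set"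
    and \<phi> :: "nat list + nat list \<Rightarrow> nat list + nat list"
    and \<sigma> :: "nat list \<times> nat list \<Rightarrow> nat list \<times> nat list"
  assumes fin: "finite T"
    and bij: "\<sigma> \<in> Bij (edges F)"
    and inj: "inj_on \<phi> (verts F - T)"
    and vert: "\<And>x. x \<in> verts F - T \<Longrightarrow> \<phi> x \<in> verts F"
    and ends: "\<And>x e. x \<in> verts F - T \<Longrightarrow> e \<in> incident F x \<Longrightarrow> \<phi> x \<in> ends F (\<sigma> e)"
    and rot: "\<And>x e. x \<in> verts F - T \<Longrightarrow> e \<in> incident F x \<Longrightarrow> \<sigma> (rot F x e) = rot F (\<phi> x) (\<sigma> e)"
begin

lemma inj_edges: "inj_on \<sigma> (edges F)" and surj_edges: "\<sigma> ` edges F = edges F"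
  using bij by (auto simp: Bij_def bij_betw_def)

lemma incident_image: "x \<in> verts F - T \<Longrightarrow> e \<in> incident F x \<Longrightarrow> \<sigma> e \<in> incident F (\<phi> x)"
  using ends surj_edges by (auto simp: incident_def)

text \<open>A midpoint must go to a midpoint, since its rotation has period 2. The flag
  \<open>c\<close> tells whether the outer half goes to the outer half.\<close>

lemma edge_image:
  assumes w: "w \<in> ewords" "Inr w \<notin> T"
  shows "\<exists>v c. v \<in> ewords \<and> \<phi> (Inr w) = Inr v \<and> (\<forall>b. \<sigma> (hf w b) = hf v (b = c))"
proof -
  have x: "Inr w \<in> verts F - T" using w by (simp add: verts_farey)
  have inc: "hf w b \<in> incident F (Inr w)" for b using w hf_in_incident by blast
  consider v where "v \<in> ewords" "\<phi> (Inr w) = Inr v" | v where "v \<in> words" "\<phi> (Inr w) = Inl v"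
    using vert[OF x] by (auto simp: verts_farey)
  then show ?thesis
  proof cases
    case 1
    have "\<sigma> (hf w False) \<in> incident F (Inr v)" using incident_image[OF x inc] 1 by simp
    then obtain c where c: "\<sigma> (hf w False) = hf v (\<not> c)"
      using incident_Inr[OF 1(1)] by (metis (full_types) empty_iff insert_iff)
    moreover have "\<sigma> (hf w True) = rot F (Inr v) (\<sigma> (hf w False))"
      using rot[OF x inc, of False] rot_farey_Inr[OF w(1)] 1 by simp
    ultimately have "\<sigma> (hf w b) = hf v (b = c)" for b
      using rot_farey_Inr[OF 1(1)] by (cases b) auto
    then show ?thesis using 1 by blast
  next
    case 2
    have "\<sigma> (rot F (Inr w) (rot F (Inr w) (hf w True)))
        = rot F (Inl v) (rot F (Inl v) (\<sigma> (hf w True)))"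
      using rot[OF x inc] 2 rot_farey_Inr[OF w(1)] by metis
    moreover have "\<sigma> (hf w True) \<in> incident F (Inl v)" using incident_image[OF x inc] 2 by simp
    ultimately have False
      using rot_rot_Inl_neq[OF 2(1), of "\<sigma> (hf w True)"] rot_farey_Inr[OF w(1)] by metis
    then show ?thesis ..
  qed
qed

text \<open>Here \<open>m w\<close> is the image of the edge \<open>w\<close>, and
  \<open>c w\<close> says that it keeps its direction. Where direction is kept, compatibility with
  the rotation sends child \<open>d\<close> to child \<open>d\<close>. From some level on this holds
  everywhere, so \<open>m\<close> copies appended letters, and by bijectivity of \<sigma> the images
  of one level cut the circle into disjoint intervals.\<close>

lemma realized: "\<exists>f\<in>carrier thompson_V. realizes f \<sigma>"
proof -
  obtain n0 where n0: "\<And>w. Inl w \<in> T \<Longrightarrow> length w < n0" "\<And>w. Inr w \<in> T \<Longrightarrow> length w < n0"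
    using finite_vertices_bound[OF fin] by blast
  define n where "n = Suc n0"
  have out: "Inl w \<in> verts F - T" "Inr w \<in> verts F - T" if "w \<in> ewords" "n \<le> length w" for w
    using that n0[of w] by (auto simp: verts_farey words_eq n_def)
  have "\<exists>v c. w \<in> ewords \<longrightarrow> n \<le> length w \<longrightarrow>
      v \<in> ewords \<and> \<phi> (Inr w) = Inr v \<and> (\<forall>b. \<sigma> (hf w b) = hf v (b = c))" for w
    using edge_image[of w] out(2)[of w] by blast
  then obtain m c where mc: "\<And>w. w \<in> ewords \<Longrightarrow> n \<le> length w \<Longrightarrow> m w \<in> ewords"
    "\<And>w. w \<in> ewords \<Longrightarrow> n \<le> length w \<Longrightarrow> \<phi> (Inr w) = Inr (m w)"
    "\<And>w b. w \<in> ewords \<Longrightarrow> n \<le> length w \<Longrightarrow> \<sigma> (hf w b) = hf (m w) (b = c w)"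
    by metis
  have phi: "\<phi> (Inl w) = Inl (if c w then m w else butlast (m w))"
    if w: "w \<in> ewords" "n \<le> length w" for w
  proof -
    have "\<phi> (Inl w) \<in> ends F (\<sigma> (hf w True))"
      using ends[OF out(1)[OF w]] hf_in_incident[OF w(1)] by simp
    moreover have "\<phi> (Inl w) \<noteq> \<phi> (Inr w)" using inj out[OF w] by (auto dest: inj_onD)
    ultimately show ?thesis using mc(2,3)[OF w] by (auto simp: ends_farey split: if_splits)
  qed
  have child: "w @ [d] \<in> ewords" "n \<le> length (w @ [d])" "hf (w @ [d]) False \<in> incident F (Inl w)"
    if "w \<in> ewords" "n \<le> length w" "d \<in> {0, 1}" for w d
  proof -
    show wd: "w @ [d] \<in> ewords" using that by auto
    show "n \<le> length (w @ [d])" using that by auto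
    show "hf (w @ [d]) False \<in> incident F (Inl w)" using hf_in_incident[OF wd] by simp
  qed
  have straight: "c (w @ [d]) \<and> m (w @ [d]) = m w @ [d]"
    if w: "w \<in> ewords" "n \<le> length w" and d: "d \<in> {0, 1}" and "c w" for w d
  proof -
    have ne: "w \<noteq> []" "m w \<noteq> []" using w mc(1)[OF w] by auto
    have inc: "hf w True \<in> incident F (Inl w)" using hf_in_incident[OF w(1)] by simp
    have p: "\<phi> (Inl w) = Inl (m w)" using phi[OF w] that by simp
    have s: "\<sigma> (hf w True) = hf (m w) True" using mc(3)[OF w] that by simp
    have s0: "\<sigma> (hf (w @ [0]) False) = hf (m w @ [0]) False"
      using rot[OF out(1)[OF w] inc] rot_farey_Inl(1)[OF ne(1)] rot_farey_Inl(1)[OF ne(2)] p s by simp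
    have s1: "\<sigma> (hf (w @ [1]) False) = hf (m w @ [1]) False"
      using rot[OF out(1)[OF w] child(3)[OF w, of 0]] rot_farey_Inl(2)[OF ne(1)]
        rot_farey_Inl(2)[OF ne(2)] p s0 by simp
    have "\<sigma> (hf (w @ [d]) False) = hf (m w @ [d]) False" using s0 s1 d by auto
    then have "hf (m (w @ [d])) (\<not> c (w @ [d])) = hf (m w @ [d]) False"
      using mc(3)[OF child(1,2)[OF w d], of False] by simp
    then show ?thesis using hf_eq_iff[OF mc(1)[OF child(1,2)[OF w d]]] by simp
  qed
  \<comment> \<open>For a reversed edge \<open>w\<close>, the vertex \<open>w\<close> goes to the
    inner end of \<open>m w\<close>. A child edge that is reversed too attaches there by its outer
    half, so that vertex is its name.\<close>
  have flipped: "c (w @ [d]) \<or> m (w @ [d]) = butlast (m w)"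
    if w: "w \<in> ewords" "n \<le> length w" and d: "d \<in> {0, 1}" and "\<not> c w" for w d
  proof (cases "c (w @ [d])")
    case False
    have "\<sigma> (hf (w @ [d]) False) \<in> incident F (Inl (butlast (m w)))"
      using incident_image[OF out(1)[OF w] child(3)[OF w d]] phi[OF w] that by simp
    then have "hf (m (w @ [d])) True \<in> incident F (Inl (butlast (m w)))"
      using mc(3)[OF child(1,2)[OF w d], of False] False by simp
    then show ?thesis using hf_in_incident[OF mc(1)[OF child(1,2)[OF w d]]] by simp
  qed simp
  text \<open>An edge whose halves are interchanged points to the root after \<open>\<sigma>\<close>; going away from the root
    in the source, its image moves towards the root, which can only happen finitely often.\<close>
  have shrink: "c (w @ u) \<or> length (m (w @ u)) + length u \<le> length (m w)"
    if w: "w \<in> ewords" "n \<le> length w" and "u \<in> bwords" for w u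
    using that(3)
  proof (induction u rule: rev_induct)
    case (snoc d u)
    then have u: "u \<in> bwords" "d \<in> {0, 1}" by auto
    have wu: "w @ u \<in> ewords" "n \<le> length (w @ u)" using w u by auto
    show ?case
    proof (cases "c (w @ u)")
      case True
      then show ?thesis using straight[OF wu u(2)] by simp
    next
      case False
      have "m (w @ u) \<noteq> []" using mc(1)[OF wu] by auto
      then obtain k where "length (m (w @ u)) = Suc k" by (cases "m (w @ u)") auto
      then show ?thesis using flipped[OF wu u(2) False] snoc.IH[OF u(1)] False by auto
    qed
  qed simp
  have "\<exists>k. \<forall>w\<in>{w \<in> ewords. length w = n}. length (m w) \<le> k"
    using finite_nat_set_iff_bounded_le[of "(\<lambda>w. length (m w)) ` {w \<in> ewords. length w = n}"]
      finite_ewords_eq by auto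
  then obtain k where k: "\<And>w. w \<in> ewords \<Longrightarrow> length w = n \<Longrightarrow> length (m w) \<le> k" by blast
  \<comment> \<open>After \<open>k\<close> further letters, \<open>shrink\<close> would leave a
    reversed image of length 0, but edge words are nonempty.\<close>
  define N where "N = n + k"
  have N: "n \<le> N" "0 < n" by (auto simp: N_def n_def)
  have c: "c w" if w: "w \<in> ewords" "N \<le> length w" for w
  proof -
    define p u where "p = take n w" and "u = drop n w"
    have p: "w = p @ u" "p \<in> ewords" "length p = n" "k \<le> length u" "u \<in> bwords"
      using w N ewords_take[OF w(1) N(2)] ewords_drop[OF w(1) N(2)] by (auto simp: p_def u_def N_def)
    have "m (p @ u) \<noteq> []" using mc(1)[of "p @ u"] p w by auto
    then obtain j where "length (m (p @ u)) = Suc j" by (cases "m (p @ u)") auto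
    then show ?thesis using shrink[OF p(2) _ p(5)] k[OF p(2,3)] p by auto
  qed
  have sig: "\<sigma> (hf w b) = hf (m w) b" if "w \<in> ewords" "N \<le> length w" for w b
    using mc(3)[OF that(1), of b] c[OF that] that N by simp
  have mE: "m w \<in> ewords" if "w \<in> ewords" "N \<le> length w" for w
    using mc(1) that N by simp
  have app: "m (w @ u) = m w @ u" if w: "w \<in> ewords" "N \<le> length w" and "u \<in> bwords" for w u
    using that(3)
  proof (induction u rule: rev_induct)
    case (snoc d u)
    then have u: "u \<in> bwords" "d \<in> {0, 1}" by auto
    have wu: "w @ u \<in> ewords" "N \<le> length (w @ u)" using w u by auto
    then have "n \<le> length (w @ u)" using N by simp
    then show ?case using straight[OF wu(1) _ u(2) c[OF wu]] snoc.IH[OF u(1)] by simp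
  qed simp
  have minj: "w = v" if w: "w \<in> ewords" "N \<le> length w" and v: "v \<in> ewords" "N \<le> length v"
    and "m w = m v" for w v
  proof -
    have "\<sigma> (hf w True) = \<sigma> (hf v True)" using that sig by simp
    then have "hf w True = hf v True"
      using inj_edges hf_in_edges[OF w(1)] hf_in_edges[OF v(1)] by (auto dest: inj_onD)
    then show ?thesis using hf_eq_iff w by blast
  qed
  define L where "L = {w \<in> ewords. length w = N}"
  have L: "finite L" "L \<subseteq> ewords" "m ` L \<subseteq> ewords"
    using finite_ewords_eq mE by (auto simp: L_def)
  \<comment> \<open>Bounds the images of the finitely many edges that are not under control. A
    target word of length at least \<open>B\<close> must therefore come from an edge of level at
    least \<open>N\<close>.\<close>
  define X where "X = (\<lambda>(w, b). length (snd (\<sigma> (hf w b)))) ` ({w \<in> ewords. length w < N} \<times> UNIV)"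
  have "finite X"
    unfolding X_def using finite_ewords_less by (intro finite_imageI finite_SigmaI) auto
  then obtain B where B: "\<forall>n\<in>X. n < B" unfolding finite_nat_set_iff_bounded by blast
  have cover: "\<exists>w u. w \<in> L \<and> u \<in> bwords \<and> v = m w @ u" if v: "v \<in> ewords" "B \<le> length v" for v
  proof -
    obtain e where "e \<in> edges F" "hf v True = \<sigma> e" using surj_edges hf_in_edges[OF v(1)] by blast
    then obtain w b where w: "w \<in> ewords" "hf v True = \<sigma> (hf w b)" by (metis edges_fareyE)
    have len: "N \<le> length w"
    proof (rule ccontr)
      assume "\<not> N \<le> length w"
      then have "length (snd (\<sigma> (hf w b))) \<in> X" unfolding X_def using w(1) by force
      then show False using B v w(2)[symmetric] by (simp add: hf_def not_less[symmetric])
    qed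
    then have "v = m w" using w sig hf_eq_iff[OF v(1)] by simp
    define p u where "p = take N w" and "u = drop N w"
    have p: "w = p @ u" "p \<in> L" "u \<in> bwords"
      using w len N ewords_take[OF w(1), of N] ewords_drop[OF w(1), of N]
      by (auto simp: p_def u_def L_def)
    then have "v = m p @ u" using \<open>v = m w\<close> app[of p u] by (auto simp: L_def)
    then show ?thesis using p by blast
  qed
  have code: "(\<exists>!w. w \<in> L \<and> x \<in> pe w ` {0..<1}) \<and> (\<exists>!w. w \<in> L \<and> x \<in> pe (m w) ` {0..<1})"
    if x: "x \<in> {0..<1}" for x :: real
  proof
    obtain w t where w: "w \<in> ewords" "length w = N" "t \<in> {0..<1}" "x = pe w t"
      using pe_ex[OF x, of N] N by auto
    show "\<exists>!w. w \<in> L \<and> x \<in> pe w ` {0..<1}"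
    proof (rule ex1I[of _ w])
      show "w \<in> L \<and> x \<in> pe w ` {0..<1}" using w by (simp add: L_def)
      show "v = w" if v: "v \<in> L \<and> x \<in> pe v ` {0..<1}" for v
      proof -
        from v obtain s where "s \<in> {0..<1}" "x = pe v s" by blast
        then show ?thesis using v w pe_same_length(1)[of v w s t] by (auto simp: L_def)
      qed
    qed
    obtain v s where v: "v \<in> ewords" "length v = Suc B" "s \<in> {0..<1}" "x = pe v s"
      using pe_ex[OF x, of "Suc B"] by auto
    obtain l u where l: "l \<in> L" "u \<in> bwords" "v = m l @ u" using cover[OF v(1)] v(2) by auto
    have ml: "m l \<in> ewords" using l L by blast
    show "\<exists>!w. w \<in> L \<and> x \<in> pe (m w) ` {0..<1}"
    proof (rule ex1I[of _ l])
      have "x = pe (m l) (pt u s)" using v l pe_append[OF ml] by simp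
      then show "l \<in> L \<and> x \<in> pe (m l) ` {0..<1}" using l pt_range[OF l(2) v(3)] by blast
      \<comment> \<open>Overlapping image intervals are nested, so \<open>m w'\<close> extends
        \<open>m w\<close> by some \<open>u\<close>. Then \<open>m w' = m (w @ u)\<close>,
        injectivity gives \<open>w' = w @ u\<close>, and equal lengths make \<open>u\<close>
        empty.\<close>
      have le: "w = w'" if w: "w \<in> L" "w' \<in> L" "length (m w) \<le> length (m w')"
        and ts: "t \<in> {0..<1}" "t' \<in> {0..<1}" "pe (m w) t = pe (m w') t'" for w w' t t'
      proof -
        have E: "m w \<in> ewords" "m w' \<in> ewords" using w L by blast+
        obtain u where u: "m w' = m w @ u" "u \<in> bwords" "t = pt u t'"
          by (rule pe_prefix[OF E ts w(3)])
        have "w \<in> ewords" "w' \<in> ewords" "length w = N" "length w' = N" using w by (auto simp: L_def)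
        then have "w' = w @ u" using minj[of w' "w @ u"] app[of w u] u by simp
        then show ?thesis using \<open>length w = N\<close> \<open>length w' = N\<close> by simp
      qed
      show "w = l" if "w \<in> L \<and> x \<in> pe (m w) ` {0..<1}" for w
      proof -
        from that obtain t where t: "w \<in> L" "t \<in> {0..<1}" "x = pe (m w) t" by blast
        have "pt u s \<in> {0..<1}" "x = pe (m l) (pt u s)"
          using pt_range[OF l(2) v(3)] \<open>x = pe (m l) (pt u s)\<close> by auto
        then show ?thesis
          using le[of w l t "pt u s"] le[of l w "pt u s" t] t l(1) by (metis nle_le)
      qed
    qed
  qed
  obtain f where f: "f \<in> carrier thompson_V" "\<forall>w\<in>L. acts f w (m w)"
    by (rule thompson_V_from_code[OF L conjunct1[OF code] conjunct2[OF code]])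
  have "\<exists>v\<in>ewords. acts f w v \<and> (\<forall>b. \<sigma> (hf w b) = hf v b)" if w: "w \<in> ewords" "N \<le> length w" for w
  proof -
    define p u where "p = take N w" and "u = drop N w"
    have p: "w = p @ u" "p \<in> L" "u \<in> bwords"
      using w N ewords_take[OF w(1), of N] ewords_drop[OF w(1), of N]
      by (auto simp: p_def u_def L_def)
    then have pE: "p \<in> ewords" "m p \<in> ewords" "N \<le> length p" using L by (auto simp: L_def)
    have "acts f w (m p @ u)" using acts_append[OF f(2)[rule_format, OF p(2)] pE(1,2) p(3)] p by simp
    moreover have "m w = m p @ u" using app[OF pE(1,3) p(3)] p by simp
    ultimately show ?thesis using mE[OF w] sig[OF w] by auto
  qed
  then show ?thesis using f(1) unfolding realizes_def by blast
qed

end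

lemma ribbon_near_auts_realized:
  assumes "\<sigma> \<in> ribbon_near_auts F"
  shows "\<exists>f\<in>carrier thompson_V. realizes f \<sigma>"
proof -
  obtain T1 T2 \<phi> where s: "\<sigma> \<in> Bij (edges F)" and T: "finite_subtree F T1"
    and iso: "ribbon_iso (remove F T1) (remove F T2) \<phi> \<sigma>"
    using assms unfolding ribbon_near_auts_def by blast
  have inc: "incident (remove F T1) x = incident F x" if "x \<in> verts F - T1" for x
    using that by (auto simp: incident_def remove_def)
  have bij: "bij_betw \<phi> (verts F - T1) (verts F - T2)"
    using iso by (simp add: ribbon_iso_def graph_iso_def remove_def)
  have ends: "ends F (\<sigma> e) - T2 = \<phi> ` (ends F e - T1)" if "e \<in> edges (remove F T1)" for e
  proof -
    have "\<forall>e\<in>edges (remove F T1). ends (remove F T2) (\<sigma> e) = \<phi> ` ends (remove F T1) e"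
      using iso unfolding ribbon_iso_def graph_iso_def by blast
    then show ?thesis using that by (simp add: remove_def del: split_paired_All)
  qed
  have rot: "\<sigma> (rot F x e) = rot F (\<phi> x) (\<sigma> e)" if x: "x \<in> verts F - T1" "e \<in> incident F x" for x e
  proof -
    have "x \<in> verts (remove F T1)" "e \<in> incident (remove F T1) x"
      using x inc by (simp_all add: remove_def)
    then have "\<sigma> (rot (remove F T1) x e) = rot (remove F T2) (\<phi> x) (\<sigma> e)"
      using iso unfolding ribbon_iso_def by blast
    then show ?thesis by (simp add: remove_def)
  qed
  interpret ribbon_off T1 \<phi> \<sigma>
  proof
    show "finite T1" using T by (simp add: finite_subtree_def)
    show "\<phi> x \<in> ends F (\<sigma> e)" if x: "x \<in> verts F - T1" "e \<in> incident F x" for x e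
    proof -
      have "e \<in> edges (remove F T1)" "x \<in> ends F e - T1" using x by (auto simp: incident_def remove_def)
      then show ?thesis using ends by blast
    qed
  qed (use s bij rot in \<open>auto simp: bij_betw_def\<close>)
  show ?thesis by (rule realized)
qed

lemma shuffles_realized:
  assumes "\<sigma> \<in> shuffles F"
  shows "\<exists>f\<in>carrier thompson_V. realizes f \<sigma>"
proof -
  obtain v \<phi> where s: "\<sigma> \<in> Bij (edges F)" and iso: "ribbon_iso (shuffle_at F v) F \<phi> \<sigma>"
    using assms unfolding shuffles_def by blast
  have inc: "incident (shuffle_at F v) x = incident F x" for x
    by (simp add: incident_def shuffle_at_def)
  have bij: "bij_betw \<phi> (verts F) (verts F)"
    using iso by (simp add: ribbon_iso_def graph_iso_def shuffle_at_def)
  have ends: "ends F (\<sigma> e) = \<phi> ` ends F e" if "e \<in> edges F" for e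
  proof -
    have "\<forall>e\<in>edges (shuffle_at F v). ends F (\<sigma> e) = \<phi> ` ends (shuffle_at F v) e"
      using iso unfolding ribbon_iso_def graph_iso_def by blast
    then show ?thesis using that by (simp add: shuffle_at_def del: split_paired_All)
  qed
  have rot: "\<sigma> (rot F x e) = rot F (\<phi> x) (\<sigma> e)" if x: "x \<in> verts F - {v}" "e \<in> incident F x" for x e
  proof -
    have "x \<in> verts (shuffle_at F v)" "e \<in> incident (shuffle_at F v) x"
      using x inc by (simp_all add: shuffle_at_def)
    then have "\<sigma> (rot (shuffle_at F v) x e) = rot F (\<phi> x) (\<sigma> e)"
      using iso unfolding ribbon_iso_def by blast
    then show ?thesis using x by (simp add: shuffle_at_def)
  qed
  interpret ribbon_off "{v}" \<phi> \<sigma>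
  proof
    show "\<phi> x \<in> ends F (\<sigma> e)" if "x \<in> verts F - {v}" "e \<in> incident F x" for x e
      using that ends by (auto simp: incident_def)
    show "inj_on \<phi> (verts F - {v})" using bij by (auto simp: bij_betw_def intro: inj_on_subset)
    show "\<phi> x \<in> verts F" if "x \<in> verts F - {v}" for x using that bij by (auto simp: bij_betw_def)
  qed (use s rot in auto)
  show ?thesis by (rule realized)
qed

section \<open>Leaves of finite subtrees\<close>

text \<open>The edges by which the branches of the complement are attached; their intervals
  partition the boundary circle.\<close>

definition leaves :: "nat list set \<Rightarrow> nat list set" where
  "leaves I = {w \<in> ewords. w \<notin> I \<and> butlast w \<in> I}"

lemma tree_dom_prefix: "tree_dom I \<Longrightarrow> p @ u \<in> I \<Longrightarrow> p \<in> I"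
  by (induction u rule: rev_induct) (force simp: tree_dom_def butlast_append)+

lemma leaves_ewords: "l \<in> leaves I \<Longrightarrow> l \<in> ewords"
  by (simp add: leaves_def)

lemma leaf_append_notin: "tree_dom I \<Longrightarrow> l \<in> leaves I \<Longrightarrow> l @ u \<notin> I"
  using tree_dom_prefix by (auto simp: leaves_def)

lemma leaf_strict_prefix_in:
  assumes "tree_dom I" "p @ d # u \<in> leaves I"
  shows "p \<in> I"
proof -
  have "butlast (p @ d # u) \<in> I" using assms by (simp add: leaves_def)
  then have "p @ butlast (d # u) \<in> I" by (simp add: butlast_append)
  then show ?thesis using tree_dom_prefix assms by blast
qed

lemma leaf_decomp:
  assumes I: "tree_dom I" and w: "w \<in> ewords" "w \<notin> I"
  obtains l u where "l \<in> leaves I" "u \<in> bwords" "w = l @ u"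
proof -
  have "\<exists>l u. l \<in> leaves I \<and> u \<in> bwords \<and> w = l @ u" using w
  proof (induction w rule: rev_induct)
    case (snoc d w)
    show ?case
    proof (cases "w \<in> I")
      case True
      then have "w @ [d] \<in> leaves I" using snoc.prems by (simp add: leaves_def)
      then show ?thesis by (intro exI[of _ "w @ [d]"] exI[of _ "[]"]) simp
    next
      case False
      then have "w \<noteq> []" using I by (auto simp: tree_dom_def)
      then have "w \<in> ewords" "[d] \<in> bwords" using snoc.prems ewords_prefix by blast+
      then obtain l u where "l \<in> leaves I" "u \<in> bwords" "w = l @ u" using snoc.IH False by blast
      then show ?thesis using \<open>[d] \<in> bwords\<close>
        by (intro exI[of _ l] exI[of _ "u @ [d]"]) simp
    qed
  qed simp
  then show thesis using that by blast
qed

lemma leaves_incomparable: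
  assumes I: "tree_dom I" and l: "l \<in> leaves I" "l' \<in> leaves I" and eq: "l' = l @ u"
  shows "u = []"
proof (cases u)
  case (Cons d v)
  then have "l \<in> I" using leaf_strict_prefix_in[OF I, of l d v] l eq by simp
  then show ?thesis using l by (simp add: leaves_def)
qed

lemma leaf_decomp_unique:
  assumes I: "tree_dom I" and l: "l \<in> leaves I" "l' \<in> leaves I" and eq: "l @ u = l' @ u'"
  shows "l = l'"
proof -
  from eq obtain v where "l = l' @ v \<or> l' = l @ v" by (auto simp: append_eq_append_conv2)
  then show ?thesis using leaves_incomparable[OF I] l by fastforce
qed

lemma finite_leaves: "tree_dom I \<Longrightarrow> finite (leaves I)"
proof (rule finite_subset)
  show "leaves I \<subseteq> (\<lambda>(v, d). v @ [d]) ` (I \<times> {0,1,2})"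
  proof
    fix w assume w: "w \<in> leaves I"
    then obtain v d where vd: "w = v @ [d]" by (metis leaves_ewords ewords_Nil rev_exhaust)
    then have "v \<in> I" "d < 3" using w by (auto simp: leaves_def ewords_snoc split: if_splits)
    then show "w \<in> (\<lambda>(v, d). v @ [d]) ` (I \<times> {0,1,2})" using vd by force
  qed
qed (simp add: tree_dom_def)

text \<open>Double counting of children. Apart from the root, each vertex that is in
  \<open>I\<close> or a leaf is the child of exactly one vertex of \<open>I\<close>; the root has
  three children and every other vertex two.\<close>

lemma card_leaves:
  assumes I: "tree_dom I"
  shows "card (leaves I) = card I + 2"
proof -
  define J where "J = I - {[]}"
  have J: "finite J" "J \<subseteq> ewords" "card I = Suc (card J)"
    using I card_Suc_Diff1[of I "[]"] by (auto simp: J_def tree_dom_def words_eq)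
  have "J \<union> leaves I = {[0], [1], [2]} \<union> (\<lambda>v. v @ [0]) ` J \<union> (\<lambda>v. v @ [1]) ` J"
  proof (intro equalityI subsetI)
    fix w assume "w \<in> J \<union> leaves I"
    then have w: "w \<in> ewords" "butlast w \<in> I"
      using J I by (auto simp: leaves_def J_def tree_dom_def)
    then obtain v d where vd: "w = v @ [d]" by (metis ewords_Nil rev_exhaust)
    show "w \<in> {[0], [1], [2]} \<union> (\<lambda>v. v @ [0]) ` J \<union> (\<lambda>v. v @ [1]) ` J"
      using w vd by (cases "v = []") (auto simp: ewords_snoc J_def)
  next
    fix w assume "w \<in> {[0], [1], [2]} \<union> (\<lambda>v. v @ [0]) ` J \<union> (\<lambda>v. v @ [1]) ` J"
    then have "w \<in> ewords" "butlast w \<in> I" using J I by (auto simp: J_def tree_dom_def)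
    then show "w \<in> J \<union> leaves I" by (auto simp: leaves_def J_def)
  qed
  moreover have "card (J \<union> leaves I) = card J + card (leaves I)"
    using J finite_leaves[OF I] by (intro card_Un_disjoint) (auto simp: leaves_def J_def)
  moreover have "card ({[0], [1], [2]} \<union> (\<lambda>v. v @ [0]) ` J \<union> (\<lambda>v. v @ [1]) ` J) = 3 + card J + card J"
  proof -
    have "card ((\<lambda>v. v @ [0]) ` J) = card J" "card ((\<lambda>v. v @ [1]) ` J) = card J"
      by (auto intro!: card_image simp: inj_on_def)
    moreover have "card ({[0], [1], [2::nat]} \<union> (\<lambda>v. v @ [0]) ` J) = 3 + card ((\<lambda>v. v @ [0]) ` J)"
      using J by (subst card_Un_disjoint) auto
    moreover have "card ({[0], [1], [2]} \<union> (\<lambda>v. v @ [0]) ` J \<union> (\<lambda>v. v @ [1]) ` J)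
        = card ({[0], [1], [2::nat]} \<union> (\<lambda>v. v @ [0]) ` J) + card ((\<lambda>v. v @ [1]) ` J)"
      using J by (intro card_Un_disjoint) auto
    ultimately show ?thesis by simp
  qed
  ultimately show ?thesis using J(3) by simp
qed

section \<open>Components of complements\<close>

definition below :: "nat list \<Rightarrow> (nat list \<times> nat list) set" where
  "below l = {hf (l @ u) b | u b. u \<in> bwords}"

lemma below_iff: "l \<in> ewords \<Longrightarrow> w \<in> ewords \<Longrightarrow> hf w b \<in> below l \<longleftrightarrow> (\<exists>u\<in>bwords. w = l @ u)"
  by (auto simp: below_def hf_eq_iff)

lemma below_append: "u \<in> bwords \<Longrightarrow> below (l @ u) \<subseteq> below l"
  unfolding below_def by fastforce

definition adj :: "(nat list + nat list) set \<Rightarrow> (nat list \<times> nat list) rel" where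
  "adj T = {(a, b). a \<in> edges (remove F T) \<and> b \<in> edges (remove F T) \<and>
     ends (remove F T) a \<inter> ends (remove F T) b \<noteq> {}}"

lemma component_adj: "component (remove F T) e = {f. (e, f) \<in> (adj T)\<^sup>*}"
  by (simp add: component_def adj_def)

lemma adj_sym: "(a, b) \<in> (adj T)\<^sup>* \<Longrightarrow> (b, a) \<in> (adj T)\<^sup>*"
proof -
  have "sym (adj T)" by (auto simp: sym_def adj_def)
  then show "(a, b) \<in> (adj T)\<^sup>* \<Longrightarrow> (b, a) \<in> (adj T)\<^sup>*" by (meson sym_rtrancl symD)
qed

lemma adj_Inr: "w \<in> ewords \<Longrightarrow> Inr w \<notin> T \<Longrightarrow> (hf w b, hf w c) \<in> adj T"
  by (auto simp: adj_def remove_def ends_farey hf_in_edges)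

lemma adj_Inl:
  assumes "w \<in> ewords" "w @ [d] \<in> ewords" "Inl w \<notin> T"
  shows "(hf (w @ [d]) False, hf w True) \<in> adj T"
  using assms by (auto simp: adj_def remove_def ends_farey hf_in_edges)

lemma adjE:
  assumes "(e, f) \<in> adj T"
  obtains w b v c x where "w \<in> ewords" "e = hf w b" "v \<in> ewords" "f = hf v c" "x \<notin> T"
    "x = Inr w \<and> v = w \<or> x = Inl (if b then w else butlast w) \<and> x = Inl (if c then v else butlast v)"
proof -
  have "e \<in> edges F" "f \<in> edges F" using assms by (auto simp: adj_def remove_def)
  then obtain w b v c where w: "w \<in> ewords" "e = hf w b" and v: "v \<in> ewords" "f = hf v c"
    by (metis edges_fareyE)
  from assms obtain x where "x \<notin> T" "x \<in> ends F e" "x \<in> ends F f" by (auto simp: adj_def remove_def)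
  then show thesis using that[OF w v, of x] w v by (auto simp: ends_farey)
qed

text \<open>Stated for general \<open>T\<close> to serve twice: for the complement of a full
  subtree, and for a branch at a single vertex. The only exit from the edges below \<open>l\<close>
  is the vertex \<open>butlast l\<close>, which is deleted.\<close>

lemma component_below:
  assumes l: "l \<in> ewords" and u: "u \<in> bwords" and T: "Inl (butlast l) \<in> T"
    and out: "\<And>u. u \<in> bwords \<Longrightarrow> Inl (l @ u) \<notin> T \<and> Inr (l @ u) \<notin> T"
  shows "component (remove F T) (hf (l @ u) b) = below l"
proof
  have top: "(hf l True, hf (l @ u) b) \<in> (adj T)\<^sup>*" if "u \<in> bwords" for u b
    using that
  proof (induction u arbitrary: b rule: rev_induct)
    case Nil
    then show ?case using adj_Inr[of l T True b] l out[of "[]"] by auto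
  next
    case (snoc d u)
    then have u: "u \<in> bwords" "[d] \<in> bwords" by auto
    then have E: "l @ u \<in> ewords" "(l @ u) @ [d] \<in> ewords" using l by auto
    have "(hf l True, hf (l @ u) True) \<in> (adj T)\<^sup>*" using snoc.IH u by blast
    also have "(hf (l @ u) True, hf ((l @ u) @ [d]) False) \<in> (adj T)\<^sup>*"
      using adj_Inl[OF E] out[OF u(1)] adj_sym by blast
    also have "(hf ((l @ u) @ [d]) False, hf ((l @ u) @ [d]) b) \<in> (adj T)\<^sup>*"
      using adj_Inr[OF E(2)] out[of "u @ [d]"] u by auto
    finally show ?case by simp
  qed
  show "below l \<subseteq> component (remove F T) (hf (l @ u) b)"
  proof
    fix f assume "f \<in> below l"
    then obtain v c where "v \<in> bwords" "f = hf (l @ v) c" unfolding below_def by blast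
    then have "(hf l True, f) \<in> (adj T)\<^sup>*" using top by blast
    then show "f \<in> component (remove F T) (hf (l @ u) b)"
      unfolding component_adj using adj_sym[OF top[OF u, of b]] by (simp add: rtrancl_trans)
  qed
  show "component (remove F T) (hf (l @ u) b) \<subseteq> below l"
  proof
    fix f assume "f \<in> component (remove F T) (hf (l @ u) b)"
    then have "(hf (l @ u) b, f) \<in> (adj T)\<^sup>*" by (simp add: component_adj)
    then show "f \<in> below l"
    proof induction
      case base
      then show ?case using u by (auto simp: below_def)
    next
      case (step e f)
      obtain w b v c x where wv: "w \<in> ewords" "e = hf w b" "v \<in> ewords" "f = hf v c" "x \<notin> T"
        "x = Inr w \<and> v = w \<or> x = Inl (if b then w else butlast w) \<and> x = Inl (if c then v else butlast v)"
        by (rule adjE[OF step.hyps(2)])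
      obtain s where s: "s \<in> bwords" "w = l @ s" using step.IH wv below_iff[OF l] by blast
      have "\<exists>s\<in>bwords. v = l @ s"
      proof (cases "v = w")
        case False
        then have x: "x = Inl (if b then w else butlast w)" "x = Inl (if c then v else butlast v)"
          using wv by auto
        \<comment> \<open>The shared vertex could lie above \<open>l\<close> only if it were the
          inner end of \<open>l\<close>, but that one belongs to \<open>T\<close>.\<close>
        have "\<exists>r\<in>bwords. (if b then w else butlast w) = l @ r"
        proof (cases "b \<or> s = []")
          case True
          then show ?thesis using s x T wv(5) by (cases b) auto
        next
          case False
          then show ?thesis using s
            by (intro bexI[of _ "butlast s"]) (auto simp: butlast_append in_lists_conv_set dest: in_set_butlastD)
        qed
        then obtain r where r: "r \<in> bwords" "(if c then v else butlast v) = l @ r" using x by auto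
        show ?thesis
        proof (cases c)
          case True
          then show ?thesis using r by auto
        next
          case False
          obtain v' d where vd: "v = v' @ [d]" using wv(3) by (metis ewords_Nil rev_exhaust)
          then have "v = l @ (r @ [d])" using r False by simp
          moreover have "r @ [d] \<in> bwords" using ewords_append[OF l, of "r @ [d]"] calculation wv(3) by simp
          ultimately show ?thesis by blast
        qed
      qed (use s in blast)
      then show ?case using wv below_iff[OF l] by blast
    qed
  qed
qed

lemma component_leaf:
  assumes I: "tree_dom I" and l: "l \<in> leaves I" and u: "u \<in> bwords"
  shows "component (remove F (full_subtree I)) (hf (l @ u) b) = below l"
proof (rule component_below[OF leaves_ewords[OF l] u])
  show "Inl (butlast l) \<in> full_subtree I" using l by (auto simp: leaves_def full_subtree_def)
  show "Inl (l @ u) \<notin> full_subtree I \<and> Inr (l @ u) \<notin> full_subtree I" for u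
    using leaf_append_notin[OF I l] by (auto simp: full_subtree_def)
qed

lemma components_full_subtree:
  assumes I: "tree_dom I"
  shows "components (remove F (full_subtree I)) = below ` leaves I"
proof (intro equalityI subsetI)
  fix A assume "A \<in> components (remove F (full_subtree I))"
  then obtain w b where w: "w \<in> ewords" "w \<notin> I" "A = component (remove F (full_subtree I)) (hf w b)"
    by (auto simp: components_def edges_remove_full_subtree[OF I])
  then obtain l u where "l \<in> leaves I" "u \<in> bwords" "w = l @ u" using leaf_decomp[OF I] by metis
  then show "A \<in> below ` leaves I" using w component_leaf[OF I] by blast
next
  fix A assume "A \<in> below ` leaves I"
  then obtain l where l: "l \<in> leaves I" "A = below l" by blast
  then have "A = component (remove F (full_subtree I)) (hf l True)" using component_leaf[OF I l(1), of "[]"] by simp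
  moreover have "hf l True \<in> edges (remove F (full_subtree I))"
    using l by (auto simp: edges_remove_full_subtree[OF I] leaves_def)
  ultimately show "A \<in> components (remove F (full_subtree I))" by (simp add: components_def)
qed

lemma branch_child:
  assumes "p @ [d] \<in> ewords"
  shows "branch F (Inl p) (hf (p @ [d]) False) = below (p @ [d])"
  unfolding branch_def using component_below[OF assms, of "[]" "{Inl p}" False] by simp

text \<open>Every half edge not strictly below \<open>p\<close> is joined to the fixed one
  \<open>hf [0] False\<close> by climbing to the root, a path that avoids the vertex
  \<open>p\<close>. Conversely, passing from this set to the edges strictly below \<open>p\<close>
  would have to cross \<open>p\<close>.\<close>

lemma branch_parent:
  assumes p: "p \<in> ewords" and w: "w \<in> ewords"
  shows "hf w b \<in> branch F (Inl p) (hf p True) \<longleftrightarrow> \<not> strict_prefix p w"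
proof
  let ?T = "{Inl p} :: (nat list + nat list) set"
  have top: "(hf w b, hf [0] False) \<in> (adj ?T)\<^sup>*" if "w \<in> ewords" "\<not> strict_prefix p w" for w b
    using that
  proof (induction w arbitrary: b rule: rev_induct)
    case (snoc d w)
    have 1: "(hf (w @ [d]) b, hf (w @ [d]) False) \<in> (adj ?T)\<^sup>*"
      using adj_Inr snoc.prems by blast
    show ?case
    proof (cases "w = []")
      case True
      have "(hf [d] False, hf [0] False) \<in> adj ?T"
      proof -
        have "[d] \<in> ewords" "[0] \<in> ewords" using snoc.prems(1) True by simp_all
        then have "hf [d] False \<in> edges F" "hf [0] False \<in> edges F" using hf_in_edges by blast+
        moreover have "p \<noteq> []" using p by auto
        ultimately show ?thesis unfolding adj_def remove_def
          by (simp add: ends_farey del: ewords_Cons)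
      qed
      moreover have "(hf [d] b, hf [d] False) \<in> (adj ?T)\<^sup>*" using 1 unfolding True append_Nil .
      ultimately show ?thesis unfolding True append_Nil by (metis rtrancl.rtrancl_into_rtrancl)
    next
      case False
      then have w: "w \<in> ewords" using snoc.prems ewords_prefix by blast
      have np: "\<not> strict_prefix p w" "w \<noteq> p"
        using snoc.prems(2) by (auto simp: strict_prefix_def)
      have "(hf (w @ [d]) False, hf w True) \<in> adj ?T" using adj_Inl[OF w snoc.prems(1)] np by simp
      then show ?thesis using 1 snoc.IH[OF w np(1), of True] by (meson r_into_rtrancl rtrancl_trans)
    qed
  qed simp
  show "hf w b \<in> branch F (Inl p) (hf p True)" if "\<not> strict_prefix p w"
  proof -
    have "(hf p True, hf [0] False) \<in> (adj ?T)\<^sup>*" using top[OF p] by simp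
    then have "(hf p True, hf w b) \<in> (adj ?T)\<^sup>*" using adj_sym[OF top[OF w that]] by (metis rtrancl_trans)
    then show ?thesis by (simp add: branch_def component_adj)
  qed
  assume "hf w b \<in> branch F (Inl p) (hf p True)"
  then have "(hf p True, hf w b) \<in> (adj ?T)\<^sup>*" by (simp add: branch_def component_adj)
  then have "\<exists>v c. v \<in> ewords \<and> hf w b = hf v c \<and> \<not> strict_prefix p v"
  proof (induction "hf w b" arbitrary: w b)
    case base
    then show ?case using p by (metis prefix_order.less_irrefl)
  next
    case (step e)
    obtain w' b' v c x where wv: "w' \<in> ewords" "e = hf w' b'" "v \<in> ewords" "hf w b = hf v c" "x \<notin> ?T"
      "x = Inr w' \<and> v = w' \<or> x = Inl (if b' then w' else butlast w') \<and> x = Inl (if c then v else butlast v)"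
      by (rule adjE[OF step.hyps(2)])
    have n: "\<not> strict_prefix p w'" using step.hyps(3)[OF wv(2)] wv hf_eq_iff by metis
    have "\<not> strict_prefix p v"
    proof (cases "v = w'")
      case False
      define q where "q = (if b' then w' else butlast w')"
      have q: "q = (if c then v else butlast v)" "q \<noteq> p" using wv False by (auto simp: q_def)
      have "prefix q w'" by (auto simp: q_def prefixeq_butlast)
      then have nq: "\<not> prefix p q"
        using n q(2) prefix_order.less_le_trans[of p q w'] by (auto simp: strict_prefix_def)
      obtain v' d where "v = v' @ [d]" using wv(3) by (metis ewords_Nil rev_exhaust)
      then show ?thesis using q nq by (auto simp: strict_prefix_def split: if_splits)
    qed (use n in simp)
    then show ?case using wv by blast
  qed
  then show "\<not> strict_prefix p w" using w hf_eq_iff by metis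
qed

section \<open>The cyclic order of the leaves\<close>

text \<open>Orders incomparable words from left to right. It does not separate comparable ones:
  \<open>w\<close> and \<open>w @ [0]\<close> have the same left end.\<close>

definition pos :: "nat list \<Rightarrow> real" where
  "pos w = pe w 0"

lemma pos_less:
  assumes "q @ i # u \<in> ewords" "q @ j # v \<in> ewords" "i < j"
  shows "pos (q @ i # u) < pos (q @ j # v)"
proof (cases "q = []")
  case True
  then have u: "u \<in> bwords" "v \<in> bwords" "i = 0 \<and> j = 1 \<or> i = 0 \<and> j = 2 \<or> i = 1 \<and> j = 2"
    using assms by auto
  then have "pt u 0 \<in> {0..<1}" "pt v 0 \<in> {0..<1}" using pt_range by auto
  then show ?thesis using u(3) unfolding True
    by (elim disjE) (auto simp: pos_def pe_def field_simps)
next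
  case False
  then have q: "q \<in> ewords" "i # u \<in> bwords" "j # v \<in> bwords"
    using assms ewords_prefix by blast+
  then have u: "u \<in> bwords" "v \<in> bwords" "i = 0" "j = 1" using assms(3) by auto
  then have "pt u 0 \<in> {0..<1}" "pt v 0 \<in> {0..<1}" using pt_range by auto
  then have "pt (i # u) 0 < pt (j # v) 0" using u by simp
  then show ?thesis
    using pe_affine[of q "pt (i # u) 0"] pe_affine[of q "pt (j # v) 0"]
    by (simp only: pos_def pe_append[OF q(1)]) (simp add: divide_strict_right_mono)
qed

lemma pos_less_iff:
  assumes "q @ i # u \<in> ewords" "q @ j # v \<in> ewords" "i \<noteq> j"
  shows "pos (q @ i # u) < pos (q @ j # v) \<longleftrightarrow> i < j"
  using pos_less[OF assms(1,2)] pos_less[OF assms(2,1)] assms(3) by (meson linorder_neqE_nat order_less_asym)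

text \<open>The strict cyclic order induced by the linear order of the line, that is, the order on
  the circle cut open at one point.\<close>

definition cyc :: "real \<Rightarrow> real \<Rightarrow> real \<Rightarrow> bool" where
  "cyc x y z \<longleftrightarrow> x < y \<and> y < z \<or> y < z \<and> z < x \<or> z < x \<and> x < y"

lemma leaves_diverge:
  assumes I: "tree_dom I" and l: "a \<in> leaves I" "b \<in> leaves I" "a \<noteq> b"
  obtains q i u j v where "a = q @ i # u" "b = q @ j # v" "i \<noteq> j"
proof -
  have "\<not> prefix a b" "\<not> prefix b a"
    using leaves_incomparable[OF I] l by (auto simp: prefix_def)
  then have "parallel a b" by (simp add: parallel_def)
  then show thesis using parallel_decomp that by metis
qed

lemma leaves_pos_inj:
  assumes I: "tree_dom I" and l: "a \<in> leaves I" "b \<in> leaves I" "a \<noteq> b"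
  shows "pos a \<noteq> pos b"
proof -
  obtain q i u j v where "a = q @ i # u" "b = q @ j # v" "i \<noteq> j" by (rule leaves_diverge[OF I l])
  then show ?thesis using leaves_ewords[OF l(1)] leaves_ewords[OF l(2)] pos_less by (metis linorder_neqE_nat order_less_irrefl)
qed

text \<open>The words \<open>a\<close> and \<open>p\<close> are incomparable, and the letter at
  which they diverge decides the comparison of \<open>a\<close> with everything below
  \<open>p\<close> at once.\<close>

lemma leaf_outside:
  assumes I: "tree_dom I" and p: "p \<in> I" "p @ [d] \<in> ewords" and a: "a \<in> leaves I" "\<not> strict_prefix p a"
  obtains "\<And>e u. p @ e # u \<in> ewords \<Longrightarrow> pos a < pos (p @ e # u)"
  | "\<And>e u. p @ e # u \<in> ewords \<Longrightarrow> pos (p @ e # u) < pos a"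
proof -
  have "p \<noteq> a" using p a by (auto simp: leaves_def)
  then have "\<not> prefix p a" using a by (auto simp: strict_prefix_def)
  moreover have "\<not> prefix a p"
    using tree_dom_prefix[OF I] p(1) a(1) by (auto simp: prefix_def leaves_def)
  ultimately have "parallel a p" by (simp add: parallel_def)
  then obtain q i u j v where d: "i \<noteq> j" "a = q @ i # u" "p = q @ j # v" using parallel_decomp by blast
  have aE: "q @ i # u \<in> ewords" using leaves_ewords[OF a(1)] d by simp
  show thesis
  proof (cases "i < j")
    case True
    then have "pos a < pos (p @ e # u')" if "p @ e # u' \<in> ewords" for e u'
      using pos_less[OF aE, of j "v @ e # u'"] that d by simp
    then show thesis by (rule that(1))
  next
    case False
    then have "pos (p @ e # u') < pos a" if "p @ e # u' \<in> ewords" for e u'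
      using pos_less[OF _ aE, of j "v @ e # u'"] that d by simp
    then show thesis by (rule that(2))
  qed
qed

lemma hf_in_below_prefix:
  assumes "p @ [d] \<in> ewords" "a \<in> ewords" "hf a True \<in> below (p @ [d])"
  obtains u where "a = p @ d # u"
  using assms below_iff[OF assms(1,2), of True] by auto

lemma below_subsetD: "below a \<subseteq> B \<Longrightarrow> hf a True \<in> B"
proof -
  have "hf (a @ []) True \<in> below a" unfolding below_def by blast
  then have "hf a True \<in> below a" by simp
  then show "below a \<subseteq> B \<Longrightarrow> hf a True \<in> B" by blast
qed

text \<open>A midpoint has too few edges to be the median vertex. At a vertex other than the root, a
  leaf on the parent side lies to the left or to the right of everything below both children, and
  either way the cyclic order is parent, child 0, child 1. The fact \<open>key\<close> treats this
  arrangement and the others are rotations of it.\<close>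

lemma cyclic_ord_imp_cyc:
  assumes I: "tree_dom I" and l: "a \<in> leaves I" "b \<in> leaves I" "c \<in> leaves I"
    and ord: "cyclic_ord F (full_subtree I) (below a) (below b) (below c)"
  shows "cyc (pos a) (pos b) (pos c)"
proof -
  obtain x e1 e2 e3 where x: "x \<in> full_subtree I"
    and e: "e1 \<in> incident F x" "e2 \<in> incident F x" "e3 \<in> incident F x"
    "e1 \<noteq> e2" "e2 \<noteq> e3" "e3 \<noteq> e1" "e2 = rot F x e1" "e3 = rot F x e2"
    and "below a \<subseteq> branch F x e1" "below b \<subseteq> branch F x e2" "below c \<subseteq> branch F x e3"
    using ord unfolding cyclic_ord_def by blast
  then have br: "hf a True \<in> branch F x e1" "hf b True \<in> branch F x e2" "hf c True \<in> branch F x e3"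
    by (auto intro: below_subsetD)
  have lE: "a \<in> ewords" "b \<in> ewords" "c \<in> ewords" using l leaves_ewords by blast+
  consider w where "x = Inr w" "w \<in> ewords" | "x = Inl []" | p where "x = Inl p" "p \<in> I" "p \<in> ewords"
    using x I by (auto simp: full_subtree_def tree_dom_def words_eq)
  then show ?thesis
  proof cases
    case 1
    then show ?thesis using e incident_Inr by auto
  next
    case 2
    then obtain i where i: "i < 3" "e1 = hf [i] False" using e(1) incident_root by auto
    define j k where "j = (i + 1) mod 3" and "k = (j + 1) mod 3"
    have e': "e2 = hf [j] False" "e3 = hf [k] False"
      using e 2 i rot_farey_root by (auto simp: j_def k_def)
    have jk: "j < 3" "k < 3" by (auto simp: j_def k_def)
    have s: "branch F x (hf [d] False) = below [d]" if "d < 3" for d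
      using branch_child[of "[]" d] that 2 by simp
    obtain u1 where u1: "a = [] @ i # u1"
      by (rule hf_in_below_prefix[of "[]" i a]) (use br s i lE in auto)
    obtain u2 where u2: "b = [] @ j # u2"
      by (rule hf_in_below_prefix[of "[]" j b]) (use br s e' jk lE in auto)
    obtain u3 where u3: "c = [] @ k # u3"
      by (rule hf_in_below_prefix[of "[]" k c]) (use br s e' jk lE in auto)
    have ijk: "i = 0 \<and> j = 1 \<and> k = 2 \<or> i = 1 \<and> j = 2 \<and> k = 0 \<or> i = 2 \<and> j = 0 \<and> k = 1"
      using i by (auto simp: j_def k_def mod_Suc)
    have "i < j \<Longrightarrow> pos a < pos b" "j < k \<Longrightarrow> pos b < pos c" "k < i \<Longrightarrow> pos c < pos a"
      using pos_less lE unfolding u1 u2 u3 by blast+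
    then show ?thesis using ijk by (auto simp: cyc_def)
  next
    case 3
    then have ne: "p \<noteq> []" by auto
    have pd: "p @ [d] \<in> ewords" if "d \<in> {0, 1}" for d using 3 that by auto
    have key: "cyc (pos a) (pos b) (pos c)"
      if l: "a \<in> leaves I" "b \<in> leaves I" "c \<in> leaves I"
        and br: "hf a True \<in> branch F x (hf p True)" "hf b True \<in> branch F x (hf (p @ [0]) False)"
          "hf c True \<in> branch F x (hf (p @ [1]) False)" for a b c
    proof -
      have lE: "a \<in> ewords" "b \<in> ewords" "c \<in> ewords" using l leaves_ewords by blast+
      obtain u2 where u2: "b = p @ 0 # u2"
        by (rule hf_in_below_prefix[OF pd[of 0] lE(2)]) (use br branch_child[OF pd[of 0]] 3 in auto)
      obtain u3 where u3: "c = p @ 1 # u3"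
        by (rule hf_in_below_prefix[OF pd[of 1] lE(3)]) (use br branch_child[OF pd[of 1]] 3 in auto)
      have bc: "pos b < pos c" using pos_less lE unfolding u2 u3 by simp
      have "\<not> strict_prefix p a" using br(1) branch_parent[OF 3(3) lE(1)] 3 by simp
      then show ?thesis
      proof (rule leaf_outside[OF I 3(2) pd[of 0] l(1), rotated])
        assume *: "\<And>e u. p @ e # u \<in> ewords \<Longrightarrow> pos a < pos (p @ e # u)"
        then show ?thesis using bc lE u2 by (auto simp: cyc_def)
      next
        assume *: "\<And>e u. p @ e # u \<in> ewords \<Longrightarrow> pos (p @ e # u) < pos a"
        then show ?thesis using bc lE u3 by (auto simp: cyc_def)
      qed simp
    qed
    have r: "rot F x (hf p True) = hf (p @ [0]) False" "rot F x (hf (p @ [0]) False) = hf (p @ [1]) False"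
      "rot F x (hf (p @ [1]) False) = hf p True"
      using rot_farey_Inl[OF ne] 3 by simp_all
    consider "e1 = hf p True" | "e1 = hf (p @ [0]) False" | "e1 = hf (p @ [1]) False"
      using e(1) 3 incident_Inl by auto
    then show ?thesis
    proof cases
      case 1
      then show ?thesis using key[OF l] br e(7,8) r by simp
    next
      case 2
      then have "cyc (pos c) (pos a) (pos b)" using key[OF l(3,1,2)] br e(7,8) r by simp
      then show ?thesis by (auto simp: cyc_def)
    next
      case 3
      then have "cyc (pos b) (pos c) (pos a)" using key[OF l(2,3,1)] br e(7,8) r by simp
      then show ?thesis by (auto simp: cyc_def)
    qed
  qed
qed

lemma cyclic_ord_rotate:
  assumes "x \<in> full_subtree I" "e1 \<in> incident F x" "e2 \<in> incident F x" "e3 \<in> incident F x"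
    "e1 \<noteq> e2" "e2 \<noteq> e3" "e3 \<noteq> e1" "e2 = rot F x e1" "e3 = rot F x e2" "e1 = rot F x e3"
    and "A \<subseteq> branch F x e1" "B \<subseteq> branch F x e2" "C \<subseteq> branch F x e3"
  shows "cyclic_ord F (full_subtree I) A B C \<and> cyclic_ord F (full_subtree I) B C A \<and> cyclic_ord F (full_subtree I) C A B"
  unfolding cyclic_ord_def using assms by blast

lemma below_child_subset: "p @ d # u \<in> ewords \<Longrightarrow> below (p @ d # u) \<subseteq> branch F (Inl p) (hf (p @ [d]) False)"
proof -
  assume w: "p @ d # u \<in> ewords"
  then have "p @ [d] \<in> ewords" "u \<in> bwords" using ewords_prefix[of "p @ [d]" u] by simp_all
  then show ?thesis using branch_child below_append[of u "p @ [d]"] by simp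
qed

lemma below_parent_subset:
  assumes p: "p \<in> ewords" and l: "l \<in> ewords" "\<not> prefix p l" "\<not> prefix l p"
  shows "below l \<subseteq> branch F (Inl p) (hf p True)"
proof
  fix e assume "e \<in> below l"
  then obtain u b where u: "u \<in> bwords" "e = hf (l @ u) b" by (auto simp: below_def)
  have "\<not> strict_prefix p (l @ u)"
    using l by (auto simp: strict_prefix_def prefix_append)
  then show "e \<in> branch F (Inl p) (hf p True)" using branch_parent[OF p, of "l @ u" b] u l by simp
qed

text \<open>The words \<open>a\<close> and \<open>b\<close> part at \<open>q\<close>, and
  \<open>b\<close> and \<open>c\<close> at \<open>r\<close>. Both are prefixes of \<open>b\<close>,
  hence comparable, and the longer one is the median; the leaf that has parted earlier is on its
  parent side. If \<open>q = r\<close>, three different letters follow, which happens only at the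
  root.\<close>

lemma sorted_leaves_cyclic_ord:
  assumes I: "tree_dom I" and l: "a \<in> leaves I" "b \<in> leaves I" "c \<in> leaves I"
    and lt: "pos a < pos b" "pos b < pos c"
  shows "cyclic_ord F (full_subtree I) (below a) (below b) (below c) \<and>
    cyclic_ord F (full_subtree I) (below b) (below c) (below a) \<and> cyclic_ord F (full_subtree I) (below c) (below a) (below b)"
proof -
  have lE: "a \<in> ewords" "b \<in> ewords" "c \<in> ewords" using l leaves_ewords by blast+
  have "a \<noteq> b" "b \<noteq> c" using lt by auto
  obtain q i u j v where q: "a = q @ i # u" "b = q @ j # v" "i \<noteq> j"
    by (rule leaves_diverge[OF I l(1,2) \<open>a \<noteq> b\<close>])
  obtain r k w m z where r: "b = r @ k # w" "c = r @ m # z" "k \<noteq> m"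
    by (rule leaves_diverge[OF I l(2,3) \<open>b \<noteq> c\<close>])
  have ij: "i < j" using pos_less_iff lE q lt by metis
  have km: "k < m" using pos_less_iff lE r lt by metis
  have rI: "r \<in> I" using leaf_strict_prefix_in[OF I, of r k w] r l by simp
  have qI: "q \<in> I" using leaf_strict_prefix_in[OF I, of q i u] q l by simp
  have parent: "cyclic_ord F (full_subtree I) (below a) (below b) (below c) \<and>
      cyclic_ord F (full_subtree I) (below b) (below c) (below a) \<and> cyclic_ord F (full_subtree I) (below c) (below a) (below b)"
    if p: "p \<in> I" "p \<noteq> []" and l: "a \<in> ewords" "b \<in> ewords" "c \<in> ewords"
      and a: "\<not> prefix p a" "\<not> prefix a p" and bc: "b = p @ i # s" "c = p @ j # t" "i < j" for p a b c i j s t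
  proof -
    have pE: "p \<in> ewords" using p I by (auto simp: tree_dom_def words_eq)
    then have "i # s \<in> bwords" "j # t \<in> bwords" using l bc by auto
    then have ij: "i = 0" "j = 1" using bc(3) by auto
    have E: "p @ [0] \<in> ewords" "p @ [1] \<in> ewords" using pE by auto
    show ?thesis
    proof (rule cyclic_ord_rotate)
      show "Inl p \<in> full_subtree I" using p by (simp add: full_subtree_def)
      show "hf p True \<in> incident F (Inl p)" "hf (p @ [0]) False \<in> incident F (Inl p)"
        "hf (p @ [1]) False \<in> incident F (Inl p)" using incident_Inl[OF pE] by auto
      show "hf p True \<noteq> hf (p @ [0]) False" "hf (p @ [1]) False \<noteq> hf p True"
        "hf (p @ [0]) False \<noteq> hf (p @ [1]) False"
        using hf_eq_iff E pE by simp_all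
      show "hf (p @ [0]) False = rot F (Inl p) (hf p True)"
        "hf (p @ [1]) False = rot F (Inl p) (hf (p @ [0]) False)"
        "hf p True = rot F (Inl p) (hf (p @ [1]) False)"
        using rot_farey_Inl[OF p(2)] by simp_all
      show "below a \<subseteq> branch F (Inl p) (hf p True)" by (rule below_parent_subset[OF pE l(1) a])
      show "below b \<subseteq> branch F (Inl p) (hf (p @ [0]) False)"
        using below_child_subset l bc ij by simp
      show "below c \<subseteq> branch F (Inl p) (hf (p @ [1]) False)"
        using below_child_subset[of p 1 t] l bc ij by simp
    qed
  qed
  have "q @ j # v = r @ k # w" using q r by simp
  then obtain s where "q = r @ s \<and> s @ j # v = k # w \<or> q @ s = r \<and> j # v = s @ k # w"
    by (auto simp: append_eq_append_conv2)
  then have "q = r \<and> j = k \<or> (\<exists>s. r = q @ j # s) \<or> (\<exists>s. q = r @ k # s)"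
    by (cases s) auto
  then consider "q = r" "j = k" | s where "r = q @ j # s" | s where "q = r @ k # s" by blast
  then show ?thesis
  proof cases
    case 1
    have "q = []"
    proof (rule ccontr)
      assume "q \<noteq> []"
      moreover have "q @ i # u \<in> ewords" "q @ m # z \<in> ewords" using lE q r 1 by simp_all
      ultimately have "i # u \<in> bwords" "m # z \<in> bwords" using ewords_prefix by blast+
      then have "i \<in> {0, 1}" "m \<in> {0, 1}" by simp_all
      then show False using ij km 1 by auto
    qed
    moreover have "m < 3" using lE r 1 calculation by simp
    ultimately have *: "i = 0" "j = 1" "m = 2" "q = []" "k = 1" "r = []" using ij km 1 by auto
    show ?thesis
    proof (rule cyclic_ord_rotate)
      show "Inl [] \<in> full_subtree I" using I by (simp add: full_subtree_def tree_dom_def)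
      show "hf [0] False \<in> incident F (Inl [])" "hf [1] False \<in> incident F (Inl [])"
        "hf [2] False \<in> incident F (Inl [])" using incident_root by auto
      show "hf [0] False \<noteq> hf [1] False" "hf [1] False \<noteq> hf [2] False" "hf [2] False \<noteq> hf [0] False"
        by (auto simp: hf_def)
      show "hf [1] False = rot F (Inl []) (hf [0] False)" "hf [2] False = rot F (Inl []) (hf [1] False)"
        "hf [0] False = rot F (Inl []) (hf [2] False)" by (simp_all add: rot_farey_root numeral_2_eq_2)
      show "below a \<subseteq> branch F (Inl []) (hf [0] False)"
        using below_child_subset[of "[]" 0 u] lE q * by simp
      show "below b \<subseteq> branch F (Inl []) (hf [1] False)"
        using below_child_subset[of "[]" 1 v] lE q * by simp
      show "below c \<subseteq> branch F (Inl []) (hf [2] False)"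
        using below_child_subset[of "[]" 2 z] lE r * by simp
    qed
  next
    case 2
    have "\<not> prefix r a" "\<not> prefix a r" using q 2 by (auto simp: prefix_def)
    then show ?thesis using parent[OF rI _ lE _ _ r(1,2) km] 2 by simp
  next
    case 3
    have "\<not> prefix q c" "\<not> prefix c q" using r 3 by (auto simp: prefix_def)
    then show ?thesis using parent[OF qI _ lE(3,1,2) _ _ q(1,2) ij] 3 by simp
  qed
qed

lemma cyc_imp_cyclic_ord:
  assumes "tree_dom I" "a \<in> leaves I" "b \<in> leaves I" "c \<in> leaves I" "cyc (pos a) (pos b) (pos c)"
  shows "cyclic_ord F (full_subtree I) (below a) (below b) (below c)"
  using assms sorted_leaves_cyclic_ord unfolding cyc_def by blast

section \<open>Near-automorphisms from bijections of words\<close>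

text \<open>The test \<open>fst e = snd e\<close> recognizes the outer half, whose vertex carries
  the same name as the edge.\<close>

definition lift_edges :: "(nat list \<Rightarrow> nat list) \<Rightarrow> nat list \<times> nat list \<Rightarrow> nat list \<times> nat list" where
  "lift_edges \<gamma> = (\<lambda>e\<in>edges F. hf (\<gamma> (snd e)) (fst e = snd e))"

lemma lift_edges_hf: "w \<in> ewords \<Longrightarrow> lift_edges \<gamma> (hf w b) = hf (\<gamma> w) b"
proof -
  assume "w \<in> ewords"
  then have "butlast w \<noteq> w" "hf w b \<in> edges F" by (cases w rule: rev_cases, auto intro: hf_in_edges)
  then show ?thesis by (auto simp: lift_edges_def hf_def)
qed

lemma lift_edges_Bij:
  assumes \<gamma>: "bij_betw \<gamma> ewords ewords"
  shows "lift_edges \<gamma> \<in> Bij (edges F)"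
proof -
  have E: "\<gamma> w \<in> ewords" if "w \<in> ewords" for w using \<gamma> that by (auto simp: bij_betw_def)
  have "inj_on (lift_edges \<gamma>) (edges F)"
  proof (rule inj_onI)
    fix e f assume ef: "e \<in> edges F" "f \<in> edges F" "lift_edges \<gamma> e = lift_edges \<gamma> f"
    obtain w b where w: "w \<in> ewords" "e = hf w b" using ef(1) by (rule edges_fareyE)
    obtain v c where v: "v \<in> ewords" "f = hf v c" using ef(2) by (rule edges_fareyE)
    have "\<gamma> w = \<gamma> v" "b = c" using ef(3) w v by (simp_all add: lift_edges_hf hf_eq_iff E)
    then show "e = f" using w v \<gamma> by (auto simp: bij_betw_def inj_on_def)
  qed
  moreover have "lift_edges \<gamma> ` edges F = edges F"
  proof (intro equalityI subsetI)
    fix e assume "e \<in> lift_edges \<gamma> ` edges F"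
    then obtain f where f: "f \<in> edges F" "e = lift_edges \<gamma> f" by blast
    obtain w b where "w \<in> ewords" "f = hf w b" using f(1) by (rule edges_fareyE)
    then show "e \<in> edges F" using f E by (simp add: lift_edges_hf hf_in_edges)
  next
    fix e assume "e \<in> edges F"
    then obtain w b where w: "w \<in> ewords" "e = hf w b" by (rule edges_fareyE)
    obtain v where v: "v \<in> ewords" "w = \<gamma> v" using w(1) \<gamma> by (auto simp: bij_betw_def)
    then have "e = lift_edges \<gamma> (hf v b)" using w by (simp add: lift_edges_hf)
    then show "e \<in> lift_edges \<gamma> ` edges F" using v hf_in_edges by blast
  qed
  ultimately show ?thesis by (simp add: Bij_def bij_betw_def lift_edges_def)
qed

lemma lift_edges_twins:
  assumes \<gamma>: "bij_betw \<gamma> ewords ewords" and ef: "e \<in> edges F" "f \<in> edges F" "twins F e f"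
  shows "twins F (lift_edges \<gamma> e) (lift_edges \<gamma> f)"
proof -
  obtain w b where w: "w \<in> ewords" "e = hf w b" using ef(1) by (rule edges_fareyE)
  obtain v c where v: "v \<in> ewords" "f = hf v c" using ef(2) by (rule edges_fareyE)
  have "\<gamma> w \<in> ewords" using w \<gamma> by (auto simp: bij_betw_def)
  then show ?thesis using ef(3) w v by (simp add: lift_edges_hf twins_iff)
qed

text \<open>The inner edges may be matched in any way at all; outside \<open>I1\<close> the map is
  prefix replacement, so whole branches are carried rigidly onto branches.\<close>

locale word_bij =
  fixes I1 I2 :: "nat list set" and \<gamma> :: "nat list \<Rightarrow> nat list"
  assumes dom: "tree_dom I1" "tree_dom I2"
    and bij: "bij_betw \<gamma> ewords ewords"
    and inner: "\<gamma> ` (I1 - {[]}) = I2 - {[]}"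
    and child: "\<And>w d. w \<in> ewords \<Longrightarrow> w \<notin> I1 \<Longrightarrow> d \<in> {0, 1} \<Longrightarrow> \<gamma> (w @ [d]) = \<gamma> w @ [d]"
begin

lemma ewords_image: "w \<in> ewords \<Longrightarrow> \<gamma> w \<in> ewords"
  using bij by (auto simp: bij_betw_def)

lemma mem_iff: "w \<in> ewords \<Longrightarrow> \<gamma> w \<in> I2 \<longleftrightarrow> w \<in> I1"
proof
  assume w: "w \<in> ewords"
  show "\<gamma> w \<in> I2" if "w \<in> I1"
  proof -
    have "w \<in> I1 - {[]}" using that w by auto
    then show ?thesis using inner by blast
  qed
  assume "\<gamma> w \<in> I2"
  then have "\<gamma> w \<in> \<gamma> ` (I1 - {[]})" using inner ewords_image[OF w] by auto
  then obtain v where v: "v \<in> I1 - {[]}" "\<gamma> w = \<gamma> v" by blast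
  then have "v \<in> ewords" using dom(1) by (auto simp: tree_dom_def words_eq)
  then show "w \<in> I1" using v w bij by (auto simp: bij_betw_def inj_on_def)
qed

lemma butlast_image:
  assumes w: "w \<in> ewords" "butlast w \<notin> I1"
  shows "\<gamma> (butlast w) = butlast (\<gamma> w)" "butlast w \<in> ewords"
proof -
  obtain v d where vd: "w = v @ [d]" using w(1) by (metis ewords_Nil rev_exhaust)
  have "v \<noteq> []" using w(2) dom(1) vd by (auto simp: tree_dom_def)
  then have v: "v \<in> ewords" "d \<in> {0, 1}" using w(1) vd by (auto simp: ewords_snoc)
  then show "\<gamma> (butlast w) = butlast (\<gamma> w)" "butlast w \<in> ewords" using child[OF v(1)] w vd by simp_all
qed

text \<open>If the parent of \<open>\<gamma> w\<close> were outside \<open>I2\<close>, it would be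
  the image of some \<open>u\<close> outside \<open>I1\<close>. By \<open>child\<close> and
  injectivity \<open>w\<close> would then be a child of \<open>u\<close>, and so not a leaf.\<close>

lemma leaf_image: "w \<in> leaves I1 \<Longrightarrow> \<gamma> w \<in> leaves I2"
proof -
  assume w: "w \<in> leaves I1"
  then have E: "w \<in> ewords" "w \<notin> I1" "butlast w \<in> I1" by (auto simp: leaves_def)
  have "butlast (\<gamma> w) \<in> I2"
  proof (rule ccontr)
    assume n: "butlast (\<gamma> w) \<notin> I2"
    obtain v d where vd: "\<gamma> w = v @ [d]" using ewords_image[OF E(1)] by (metis ewords_Nil rev_exhaust)
    have "v \<noteq> []" using n dom(2) vd by (auto simp: tree_dom_def)
    then have v: "v \<in> ewords" "d \<in> {0, 1}" using ewords_image[OF E(1)] vd by (auto simp: ewords_snoc)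
    then obtain u where u: "u \<in> ewords" "v = \<gamma> u" using bij by (auto simp: bij_betw_def)
    then have uI: "u \<notin> I1" using n vd mem_iff by auto
    then have "\<gamma> w = \<gamma> (u @ [d])" using child[OF u(1) uI v(2)] vd u by simp
    moreover have "u @ [d] \<in> ewords" using u v by auto
    ultimately have "w = u @ [d]" using E(1) bij by (auto simp: bij_betw_def inj_on_def)
    then show False using E(3) uI by simp
  qed
  then show ?thesis using mem_iff[OF E(1)] ewords_image[OF E(1)] E by (simp add: leaves_def)
qed

lemma append_image: "w \<in> ewords \<Longrightarrow> w \<notin> I1 \<Longrightarrow> u \<in> bwords \<Longrightarrow> \<gamma> (w @ u) = \<gamma> w @ u"
proof (induction u rule: rev_induct)
  case (snoc d u)
  have "w @ u \<notin> I1" using tree_dom_prefix[OF dom(1)] snoc.prems by blast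
  then show ?case using child[of "w @ u" d] snoc by simp
qed simp

lemma ends_image:
  assumes w: "w \<in> ewords" "w \<notin> I1"
  shows "ends F (hf (\<gamma> w) b) - full_subtree I2 = map_sum \<gamma> \<gamma> ` (ends F (hf w b) - full_subtree I1)"
proof -
  have 1: "Inl w \<notin> full_subtree I1" "Inr w \<notin> full_subtree I1" using w by (auto simp: full_subtree_def)
  have 2: "Inl (\<gamma> w) \<notin> full_subtree I2" "Inr (\<gamma> w) \<notin> full_subtree I2" using w mem_iff by (auto simp: full_subtree_def)
  show ?thesis
  proof (cases b)
    case True
    then show ?thesis using 1 2 by (simp add: ends_farey insert_Diff_if)
  next
    case False
    show ?thesis
    proof (cases "butlast w \<in> I1")
      case True
      then have "butlast (\<gamma> w) \<in> I2" using leaf_image[of w] w by (auto simp: leaves_def)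
      then have "Inl (butlast (\<gamma> w)) \<in> full_subtree I2" "Inl (butlast w) \<in> full_subtree I1"
        using True by (auto simp: full_subtree_def)
      then show ?thesis using 1 2 False by (simp add: ends_farey insert_Diff_if)
    next
      case n: False
      then have "\<gamma> (butlast w) = butlast (\<gamma> w)" "butlast (\<gamma> w) \<notin> I2"
        using butlast_image[OF w(1) n] mem_iff by metis+
      moreover from this have "Inl (butlast (\<gamma> w)) \<notin> full_subtree I2" "Inl (butlast w) \<notin> full_subtree I1"
        using n by (auto simp: full_subtree_def)
      ultimately show ?thesis using 1 2 False by (simp add: ends_farey insert_Diff_if)
    qed
  qed
qed

lemma verts_remove_full_subtree:
  assumes "tree_dom I" shows "verts (remove F (full_subtree I)) = Inl ` (ewords - I) \<union> Inr ` (ewords - I)"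
  using assms by (auto simp: remove_def verts_farey full_subtree_def tree_dom_def words_eq)

lemma bij_outside: "bij_betw \<gamma> (ewords - I1) (ewords - I2)"
proof (rule bij_betw_imageI)
  show "inj_on \<gamma> (ewords - I1)" using bij by (auto simp: bij_betw_def intro: inj_on_subset)
  have "\<gamma> ` ewords = ewords" using bij by (simp add: bij_betw_def)
  then show "\<gamma> ` (ewords - I1) = ewords - I2" using mem_iff by fast
qed

lemma ribbon_iso_lift:
  "ribbon_iso (remove F (full_subtree I1)) (remove F (full_subtree I2)) (map_sum \<gamma> \<gamma>) (lift_edges \<gamma>)"
  unfolding ribbon_iso_def graph_iso_def
proof (intro conjI ballI)
  show "bij_betw (map_sum \<gamma> \<gamma>) (verts (remove F (full_subtree I1))) (verts (remove F (full_subtree I2)))"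
    unfolding verts_remove_full_subtree[OF dom(1)] verts_remove_full_subtree[OF dom(2)]
  proof (rule bij_betw_imageI)
    show "inj_on (map_sum \<gamma> \<gamma>) (Inl ` (ewords - I1) \<union> Inr ` (ewords - I1))"
      using bij_outside by (auto simp: bij_betw_def inj_on_def)
    show "map_sum \<gamma> \<gamma> ` (Inl ` (ewords - I1) \<union> Inr ` (ewords - I1))
        = Inl ` (ewords - I2) \<union> Inr ` (ewords - I2)"
      using bij_outside by (simp add: bij_betw_def image_Un image_image flip: image_image[of Inl \<gamma>] image_image[of Inr \<gamma>])
  qed
  show "bij_betw (lift_edges \<gamma>) (edges (remove F (full_subtree I1))) (edges (remove F (full_subtree I2)))"
  proof (rule bij_betw_imageI)
    have "inj_on (lift_edges \<gamma>) (edges F)"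
      using lift_edges_Bij[OF bij] by (simp add: Bij_def bij_betw_def)
    then show "inj_on (lift_edges \<gamma>) (edges (remove F (full_subtree I1)))"
      by (rule inj_on_subset) (simp add: remove_def)
    show "lift_edges \<gamma> ` edges (remove F (full_subtree I1)) = edges (remove F (full_subtree I2))"
      unfolding edges_remove_full_subtree[OF dom(1)] edges_remove_full_subtree[OF dom(2)]
    proof (intro equalityI subsetI)
      fix e assume "e \<in> lift_edges \<gamma> ` {hf w b | w b. w \<in> ewords \<and> w \<notin> I1}"
      then obtain w b where "w \<in> ewords" "w \<notin> I1" "e = lift_edges \<gamma> (hf w b)" by blast
      then show "e \<in> {hf w b | w b. w \<in> ewords \<and> w \<notin> I2}"
        using lift_edges_hf ewords_image mem_iff by blast
    next
      fix e assume "e \<in> {hf w b | w b. w \<in> ewords \<and> w \<notin> I2}"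
      then obtain w b where w: "w \<in> ewords - I2" "e = hf w b" by blast
      then obtain v where "v \<in> ewords - I1" "w = \<gamma> v" using bij_outside by (metis bij_betw_def imageE)
      then have "e = lift_edges \<gamma> (hf v b)" "v \<in> ewords" "v \<notin> I1" using w lift_edges_hf by auto
      then show "e \<in> lift_edges \<gamma> ` {hf w b | w b. w \<in> ewords \<and> w \<notin> I1}" by blast
    qed
  qed
next
  fix e assume "e \<in> edges (remove F (full_subtree I1))"
  then obtain w b where w: "w \<in> ewords" "w \<notin> I1" "e = hf w b" unfolding edges_remove_full_subtree[OF dom(1)] by blast
  then show "ends (remove F (full_subtree I2)) (lift_edges \<gamma> e) = map_sum \<gamma> \<gamma> ` ends (remove F (full_subtree I1)) e"
    using ends_image[OF w(1,2), of b] lift_edges_hf[OF w(1), of \<gamma> b] by (simp add: remove_def)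
next
  fix v e assume v: "v \<in> verts (remove F (full_subtree I1))" and e: "e \<in> incident (remove F (full_subtree I1)) v"
  have inc: "e \<in> incident F v" using e by (auto simp: incident_def remove_def)
  consider w where "v = Inl w" "w \<in> ewords" "w \<notin> I1" | w where "v = Inr w" "w \<in> ewords" "w \<notin> I1"
    using v unfolding verts_remove_full_subtree[OF dom(1)] by blast
  then have "lift_edges \<gamma> (rot F v e) = rot F (map_sum \<gamma> \<gamma> v) (lift_edges \<gamma> e)"
  proof cases
    case 1
    have ne: "w \<noteq> []" "\<gamma> w \<noteq> []" using 1(2) ewords_image[OF 1(2)] by auto
    have E: "w @ [0] \<in> ewords" "w @ [1] \<in> ewords" using 1(2) by auto
    have c: "\<gamma> (w @ [0]) = \<gamma> w @ [0]" "\<gamma> (w @ [1]) = \<gamma> w @ [1]" using child[OF 1(2,3)] by auto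
    have "e = hf w True \<or> e = hf (w @ [0]) False \<or> e = hf (w @ [1]) False"
      using inc 1 incident_Inl[OF 1(2)] by auto
    then show ?thesis
      using 1(1) rot_farey_Inl[OF ne(1)] rot_farey_Inl[OF ne(2)] c
        lift_edges_hf[OF 1(2)] lift_edges_hf[OF E(1)] lift_edges_hf[OF E(2)]
      by (elim disjE) simp_all
  next
    case 2
    then obtain b where "e = hf w b" using inc incident_Inr[OF 2(2)] by auto
    then show ?thesis
      using 2(1) rot_farey_Inr[OF 2(2)] rot_farey_Inr[OF ewords_image[OF 2(2)]] lift_edges_hf[OF 2(2)] by simp
  qed
  then show "lift_edges \<gamma> (rot (remove F (full_subtree I1)) v e) =
      rot (remove F (full_subtree I2)) (map_sum \<gamma> \<gamma> v) (lift_edges \<gamma> e)" by (simp add: remove_def)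
qed

lemma lift_near_auts: "lift_edges \<gamma> \<in> near_auts F"
  unfolding near_auts_def
  using lift_edges_Bij[OF bij] lift_edges_twins[OF bij] ribbon_iso_lift
    finite_full_subtree[OF dom(1)] finite_full_subtree[OF dom(2)]
  unfolding ribbon_iso_def by blast

lemma lift_below: "l \<in> leaves I1 \<Longrightarrow> lift_edges \<gamma> ` below l = below (\<gamma> l)"
proof -
  assume "l \<in> leaves I1"
  then have l: "l \<in> ewords" "l \<notin> I1" by (auto simp: leaves_def)
  have "lift_edges \<gamma> (hf (l @ u) b) = hf (\<gamma> l @ u) b" if "u \<in> bwords" for u b
    using that l append_image lift_edges_hf by simp
  then have 1: "lift_edges \<gamma> ` below l \<subseteq> below (\<gamma> l)" unfolding below_def by blast
  have "below (\<gamma> l) \<subseteq> lift_edges \<gamma> ` below l"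
  proof
    fix e assume "e \<in> below (\<gamma> l)"
    then obtain u b where u: "u \<in> bwords" "e = hf (\<gamma> l @ u) b" unfolding below_def by blast
    then have "e = lift_edges \<gamma> (hf (l @ u) b)" using l append_image lift_edges_hf by simp
    moreover have "hf (l @ u) b \<in> below l" unfolding below_def using u(1) by blast
    ultimately show "e \<in> lift_edges \<gamma> ` below l" by blast
  qed
  with 1 show ?thesis by blast
qed

lemma lift_ribbon_near_auts:
  assumes "\<And>a b c. a \<in> leaves I1 \<Longrightarrow> b \<in> leaves I1 \<Longrightarrow> c \<in> leaves I1 \<Longrightarrow>
      cyc (pos a) (pos b) (pos c) \<Longrightarrow> cyc (pos (\<gamma> a)) (pos (\<gamma> b)) (pos (\<gamma> c))"
  shows "lift_edges \<gamma> \<in> ribbon_near_auts F"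
proof -
  have "cyclic_ord F (full_subtree I2) (lift_edges \<gamma> ` A) (lift_edges \<gamma> ` B) (lift_edges \<gamma> ` C)"
    if ABC: "A \<in> components (remove F (full_subtree I1))" "B \<in> components (remove F (full_subtree I1))"
      "C \<in> components (remove F (full_subtree I1))" and ord: "cyclic_ord F (full_subtree I1) A B C" for A B C
  proof -
    obtain a b c where l: "a \<in> leaves I1" "b \<in> leaves I1" "c \<in> leaves I1"
      and eq: "A = below a" "B = below b" "C = below c"
      using ABC unfolding components_full_subtree[OF dom(1)] by blast
    have "cyc (pos a) (pos b) (pos c)" using cyclic_ord_imp_cyc[OF dom(1) l] ord eq by simp
    then have "cyc (pos (\<gamma> a)) (pos (\<gamma> b)) (pos (\<gamma> c))" using assms l by blast
    then show ?thesis
      using cyc_imp_cyclic_ord[OF dom(2)] leaf_image l lift_below eq by simp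
  qed
  then have "\<exists>T1 T2 \<phi>. finite_subtree F T1 \<and> finite_subtree F T2 \<and>
      ribbon_iso (remove F T1) (remove F T2) \<phi> (lift_edges \<gamma>) \<and>
      (\<forall>A\<in>components (remove F T1). \<forall>B\<in>components (remove F T1). \<forall>C\<in>components (remove F T1).
         cyclic_ord F T1 A B C \<longrightarrow>
         cyclic_ord F T2 (lift_edges \<gamma> ` A) (lift_edges \<gamma> ` B) (lift_edges \<gamma> ` C))"
    by (intro exI[of _ "full_subtree I1"] exI[of _ "full_subtree I2"] exI[of _ "map_sum \<gamma> \<gamma>"] conjI ballI impI
        ribbon_iso_lift finite_full_subtree dom)
  then show ?thesis
    unfolding ribbon_near_auts_def mem_Collect_eq
    using lift_edges_Bij[OF bij] lift_edges_twins[OF bij] by (intro conjI ballI impI)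
qed

end

section \<open>Elements of Thompson's group as bijections between leaves\<close>

lemma extend_leaf_bij:
  assumes I: "tree_dom I1" "tree_dom I2" and g: "bij_betw g (leaves I1) (leaves I2)"
  obtains \<gamma> where "word_bij I1 I2 \<gamma>" "\<forall>l\<in>leaves I1. \<gamma> l = g l"
proof -
  have "card (leaves I1) = card (leaves I2)" using g by (rule bij_betw_same_card)
  then have "card I1 = card I2" using card_leaves I by simp
  then have "card (I1 - {[]}) = card (I2 - {[]})" using I by (simp add: tree_dom_def)
  then obtain h where h: "bij_betw h (I1 - {[]}) (I2 - {[]})"
    using I by (metis finite_Diff finite_same_card_bij tree_dom_def)
  \<comment> \<open>The choice is forced: leaves are incomparable, so a word outside
    \<open>I1\<close> extends exactly one of them.\<close>
  define lf where "lf w = (SOME l. l \<in> leaves I1 \<and> prefix l w)" for w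
  define \<gamma> where "\<gamma> w = (if w \<in> I1 then h w else g (lf w) @ drop (length (lf w)) w)" for w
  have \<gamma>: "\<gamma> (l @ u) = g l @ u" if l: "l \<in> leaves I1" for l u
  proof -
    have "lf (l @ u) = l"
      unfolding lf_def
    proof (rule some_equality)
      show "l \<in> leaves I1 \<and> prefix l (l @ u)" using l by simp
      show "l' = l" if "l' \<in> leaves I1 \<and> prefix l' (l @ u)" for l'
        using that leaf_decomp_unique[OF I(1) _ l, of l' _ u] by (auto simp: prefix_def)
    qed
    then show ?thesis using leaf_append_notin[OF I(1) l] by (simp add: \<gamma>_def)
  qed
  have gl: "g l \<in> leaves I2" if "l \<in> leaves I1" for l using g that by (auto simp: bij_betw_def)
  have out: "bij_betw \<gamma> (ewords - I1) (ewords - I2)"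
  proof (rule bij_betw_imageI)
    show "inj_on \<gamma> (ewords - I1)"
    proof (rule inj_onI)
      fix w v assume w: "w \<in> ewords - I1" and v: "v \<in> ewords - I1" and eq: "\<gamma> w = \<gamma> v"
      obtain l u where l: "l \<in> leaves I1" "u \<in> bwords" "w = l @ u" using leaf_decomp[OF I(1)] w by blast
      obtain l' u' where l': "l' \<in> leaves I1" "u' \<in> bwords" "v = l' @ u'" using leaf_decomp[OF I(1)] v by blast
      have e: "g l @ u = g l' @ u'" using eq l l' \<gamma> by simp
      then have "g l = g l'" using leaf_decomp_unique[OF I(2) gl gl] l l' by blast
      then have "l = l'" "u = u'" using e g l l' by (auto simp: bij_betw_def inj_on_def)
      then show "w = v" using l l' by simp
    qed
    show "\<gamma> ` (ewords - I1) = ewords - I2"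
    proof (intro equalityI subsetI)
      fix v assume "v \<in> \<gamma> ` (ewords - I1)"
      then obtain w where w: "w \<in> ewords - I1" "v = \<gamma> w" by blast
      obtain l u where l: "l \<in> leaves I1" "u \<in> bwords" "w = l @ u" using leaf_decomp[OF I(1)] w by blast
      then have "v = g l @ u" using w \<gamma> by simp
      then show "v \<in> ewords - I2"
        using leaf_append_notin[OF I(2) gl[OF l(1)]] leaves_ewords[OF gl[OF l(1)]] l by simp
    next
      fix v assume "v \<in> ewords - I2"
      then obtain l u where l: "l \<in> leaves I2" "u \<in> bwords" "v = l @ u" using leaf_decomp[OF I(2)] by blast
      then obtain k where k: "k \<in> leaves I1" "l = g k" using g by (auto simp: bij_betw_def)
      then have "v = \<gamma> (k @ u)" using l \<gamma> by simp
      moreover have "k @ u \<in> ewords - I1"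
        using leaf_append_notin[OF I(1) k(1)] leaves_ewords[OF k(1)] l by simp
      ultimately show "v \<in> \<gamma> ` (ewords - I1)" by blast
    qed
  qed
  have inn: "bij_betw \<gamma> (I1 - {[]}) (I2 - {[]})"
    using h by (subst bij_betw_cong[of _ _ h]) (auto simp: \<gamma>_def)
  have E: "ewords = (I1 - {[]}) \<union> (ewords - I1)" "ewords = (I2 - {[]}) \<union> (ewords - I2)"
    using I by (auto simp: tree_dom_def words_eq)
  have "word_bij I1 I2 \<gamma>"
  proof
    have "bij_betw \<gamma> ((I1 - {[]}) \<union> (ewords - I1)) ((I2 - {[]}) \<union> (ewords - I2))"
      by (rule bij_betw_combine[OF inn out]) auto
    then show "bij_betw \<gamma> ewords ewords" using E by simp
    show "\<gamma> ` (I1 - {[]}) = I2 - {[]}" using inn by (simp add: bij_betw_def)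
    fix w d assume "w \<in> ewords" "w \<notin> I1" "d \<in> {0, 1::nat}"
    then obtain l u where "l \<in> leaves I1" "u \<in> bwords" "w = l @ u" using leaf_decomp[OF I(1)] by blast
    then show "\<gamma> (w @ [d]) = \<gamma> w @ [d]" using \<gamma>[of l u] \<gamma>[of l "u @ [d]"] by simp
  qed (use I in auto)
  moreover have "\<forall>l\<in>leaves I1. \<gamma> l = g l" using \<gamma>[of _ "[]"] by simp
  ultimately show thesis using that by blast
qed

lemma (in word_bij) realizes_lift:
  assumes "\<forall>l\<in>leaves I1. acts f l (\<gamma> l)"
  shows "realizes f (lift_edges \<gamma>)"
proof -
  have "finite I1" using dom by (simp add: tree_dom_def)
  then obtain n where n: "\<And>w. w \<in> I1 \<Longrightarrow> length w \<le> n"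
    using finite_nat_set_iff_bounded_le[of "length ` I1"] by auto
  have "\<exists>v\<in>ewords. acts f w v \<and> (\<forall>b. lift_edges \<gamma> (hf w b) = hf v b)"
    if w: "w \<in> ewords" "Suc n \<le> length w" for w
  proof -
    have "w \<notin> I1" using n[of w] w by auto
    then obtain l u where l: "l \<in> leaves I1" "u \<in> bwords" "w = l @ u" using leaf_decomp[OF dom(1) w(1)] by blast
    then have lE: "l \<in> ewords" "l \<notin> I1" by (auto simp: leaves_def)
    have "acts f w (\<gamma> l @ u)" using acts_append[OF _ lE(1) ewords_image[OF lE(1)] l(2)] assms l by blast
    then have "acts f w (\<gamma> w)" using append_image[OF lE l(2)] l by simp
    then show ?thesis using ewords_image[OF w(1)] lift_edges_hf[OF w(1)] by blast
  qed
  then show ?thesis unfolding realizes_def by blast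
qed

text \<open>Sharpens a statement about long words to the leaves themselves: each point below
  \<open>l\<close> also lies below some long extension \<open>l @ u\<close>, where the lift still
  replaces the prefix \<open>l\<close> by \<open>\<gamma> l\<close>.\<close>

lemma (in word_bij) realizes_lift_acts:
  assumes "realizes f (lift_edges \<gamma>)" "l \<in> leaves I1"
  shows "acts f l (\<gamma> l)"
  unfolding acts_def
proof
  fix t :: real assume "t \<in> {0..<1}"
  obtain n where n: "\<And>w. w \<in> ewords \<Longrightarrow> n \<le> length w \<Longrightarrow>
    \<exists>w'\<in>ewords. acts f w w' \<and> (\<forall>b. lift_edges \<gamma> (hf w b) = hf w' b)" using realizesE[OF assms(1)] by blast
  obtain u s where u: "u \<in> bwords" "length u = n" "s \<in> {0..<1}" "t = pt u s"
    using pt_ex[OF \<open>t \<in> {0..<1}\<close>] by blast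
  have l: "l \<in> ewords" "l \<notin> I1" using assms by (auto simp: leaves_def)
  have lu: "l @ u \<in> ewords" "n \<le> length (l @ u)" using l u by auto
  obtain v where v: "v \<in> ewords" "acts f (l @ u) v" "\<forall>b. lift_edges \<gamma> (hf (l @ u) b) = hf v b"
    using n[OF lu] by blast
  have "hf (\<gamma> (l @ u)) True = hf v True" using v(3) lift_edges_hf[OF lu(1), of \<gamma> True] by simp
  then have "v = \<gamma> l @ u" using hf_eq_iff[OF ewords_image[OF lu(1)]] append_image[OF l u(1)] by simp
  then have "f (pe (l @ u) s) = pe (\<gamma> l @ u) s" using v(2) u(3) by (simp add: acts_def)
  then show "f (pe l t) = pe (\<gamma> l) t" using u(4) pe_append l ewords_image by simp
qed

lemma leaves_ball:
  assumes "0 < n" shows "leaves {w \<in> words. length w < n} = {w \<in> ewords. length w = n}"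
proof (intro equalityI subsetI)
  fix w assume "w \<in> leaves {w \<in> words. length w < n}"
  then show "w \<in> {w \<in> ewords. length w = n}" by (auto simp: leaves_def words_eq)
next
  fix w assume w: "w \<in> {w \<in> ewords. length w = n}"
  then have "butlast w \<in> words" using butlast_words by blast
  then show "w \<in> leaves {w \<in> words. length w < n}" using w assms by (auto simp: leaves_def words_eq)
qed

lemma thompson_V_code:
  assumes f: "f \<in> carrier thompson_V"
  obtains n I g where "2 \<le> n" "tree_dom I" "bij_betw g (leaves {w \<in> words. length w < n}) (leaves I)"
    "\<forall>l\<in>leaves {w \<in> words. length w < n}. acts f l (g l)"
proof -
  obtain k where k: "\<And>w. w \<in> ewords \<Longrightarrow> k \<le> length w \<Longrightarrow> \<exists>w'\<in>ewords. acts f w w'"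
    using f by (auto simp: thompson_V_carrier_iff)
  \<comment> \<open>At least 2, so that some vertex other than the root has both its children among
    the leaves; the shuffle used for the transposition is made there.\<close>
  define n where "n = k + 2"
  define W where "W = {w \<in> ewords. length w = n}"
  have W: "leaves {w \<in> words. length w < n} = W" unfolding W_def by (rule leaves_ball) (simp add: n_def)
  have "\<exists>w'. w' \<in> ewords \<and> acts f w w'" if "w \<in> W" for w
    using k[of w] that by (auto simp: W_def n_def Bex_def)
  then obtain g where g: "\<And>w. w \<in> W \<Longrightarrow> g w \<in> ewords" "\<And>w. w \<in> W \<Longrightarrow> acts f w (g w)" by metis
  have bij: "inj_on f {0..<1}" "f ` {0..<1} = {0..<1}"
    using thompson_V_Bij[OF f] by (auto simp: Bij_def bij_betw_def)
  \<comment> \<open>Covers two facts at once: injectivity of \<open>g\<close> when \<open>u\<close>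
    is empty, and that no image is a proper prefix of another.\<close>
  have ginj: "w = v \<and> u = []" if w: "w \<in> W" "v \<in> W" and eq: "g w = g v @ u" "u \<in> bwords" for w v u
  proof -
    have E: "w \<in> ewords" "v \<in> ewords" "length w = length v" using w by (auto simp: W_def)
    have p: "pt u 0 \<in> {0..<1}" using pt_range[OF eq(2)] by simp
    have "f (pe w 0) = pe (g w) 0" using g(2)[OF w(1)] by (simp add: acts_def)
    also have "\<dots> = pe (g v) (pt u 0)" using eq pe_append[OF g(1)[OF w(2)]] by simp
    also have "\<dots> = f (pe v (pt u 0))" using g(2)[OF w(2)] p by (simp add: acts_def)
    finally have "pe w 0 = pe v (pt u 0)"
      using bij(1) pe_range[OF E(1), of 0] pe_range[OF E(2) p] by (auto dest: inj_onD)
    then have "w = v" using pe_same_length(1)[OF E(1,2) _ p _ E(3), of 0] by simp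
    then show ?thesis using eq by simp
  qed
  have Wfin: "finite W" unfolding W_def by (rule finite_ewords_eq)
  then obtain B where B: "\<And>w. w \<in> W \<Longrightarrow> length (g w) \<le> B"
    using finite_nat_set_iff_bounded_le[of "(\<lambda>w. length (g w)) ` W"] by auto
  have cover: "\<exists>w\<in>W. \<exists>u\<in>bwords. v = g w @ u" if v: "v \<in> ewords" "B \<le> length v" for v
  proof -
    have "pe v 0 \<in> {0..<1}" using v pe_range by simp
    then obtain x where x: "x \<in> {0..<1}" "pe v 0 = f x" using bij(2) by (metis imageE)
    obtain w t where w: "w \<in> ewords" "length w = n" "t \<in> {0..<1}" "x = pe w t"
      using pe_ex[OF x(1), of n] by (auto simp: n_def)
    then have wW: "w \<in> W" by (simp add: W_def)
    have eq: "pe (g w) t = pe v 0" using g(2)[OF wW] w x by (simp add: acts_def)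
    obtain u where "v = g w @ u" "u \<in> bwords"
      by (rule pe_prefix[OF g(1)[OF wW] v(1) w(3) _ eq]) (use B[OF wW] v in auto)
    then show ?thesis using wW by blast
  qed
  \<comment> \<open>The tree that the words \<open>g w\<close> cut off. It is finite because every
    word of length at least \<open>B\<close> extends some \<open>g w\<close>.\<close>
  define I where "I = {v \<in> words. \<forall>w\<in>W. \<not> prefix (g w) v}"
  have "I \<subseteq> insert [] {v \<in> ewords. length v \<le> B}"
    using cover by (fastforce simp: I_def words_eq)
  then have "finite I" using finite_ewords_length[of B] by (meson finite.insertI finite_subset)
  moreover have "g w \<noteq> []" if "w \<in> W" for w using g(1)[OF that] by auto
  then have "[] \<in> I" by (auto simp: I_def words_eq)
  moreover have "butlast v \<in> I" if v: "v \<in> I" for v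
  proof -
    have "butlast v \<in> words" using v butlast_words by (auto simp: I_def words_eq)
    moreover have "\<not> prefix (g w) (butlast v)" if "w \<in> W" for w
      using v that prefix_order.trans[OF _ prefixeq_butlast, of "g w" v] unfolding I_def by blast
    ultimately show ?thesis by (simp add: I_def)
  qed
  ultimately have I: "tree_dom I" by (auto simp: tree_dom_def I_def)
  have "leaves I = g ` W"
  proof (intro equalityI subsetI)
    fix v assume v: "v \<in> leaves I"
    then have vE: "v \<in> ewords" "v \<notin> I" "butlast v \<in> I" by (auto simp: leaves_def)
    then obtain w where w: "w \<in> W" "prefix (g w) v" by (auto simp: I_def words_eq)
    obtain v' d where vd: "v = v' @ [d]" using vE(1) by (metis ewords_Nil rev_exhaust)
    then have "g w = v" using w vE(3) by (auto simp: I_def)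
    then show "v \<in> g ` W" using w by blast
  next
    fix v assume "v \<in> g ` W"
    then obtain w where w: "w \<in> W" "v = g w" by blast
    have vE: "v \<in> ewords" using g w by simp
    have "v \<notin> I" using w by (auto simp: I_def)
    moreover have "\<not> prefix (g w') (butlast v)" if w': "w' \<in> W" for w'
    proof
      assume "prefix (g w') (butlast v)"
      then obtain s where s: "butlast v = g w' @ s" by (auto simp: prefix_def)
      obtain v' d where vd: "v = v' @ [d]" using vE by (metis ewords_Nil rev_exhaust)
      then have eq: "g w = g w' @ (s @ [d])" using s w by simp
      moreover have "s @ [d] \<in> bwords" using ewords_append[OF g(1)[OF w'], of "s @ [d]"] eq vE w by simp
      ultimately show False using ginj[OF w(1) w'] by blast
    qed
    ultimately show "v \<in> leaves I" using vE butlast_words by (auto simp: leaves_def I_def)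
  qed
  moreover have "inj_on g W" using ginj[of _ _ "[]"] by (auto simp: inj_on_def)
  ultimately have "bij_betw g W (leaves I)" by (simp add: bij_betw_def)
  then show thesis by (intro that[of n I g]) (use I g W in \<open>auto simp: n_def\<close>)
qed

lemma germ_of_nonempty:
  assumes f: "f \<in> carrier thompson_V"
  shows "germ_of f \<noteq> {}"
proof -
  obtain n I g where n: "2 \<le> n" and I: "tree_dom I"
    and g: "bij_betw g (leaves {w \<in> words. length w < n}) (leaves I)"
      "\<forall>l\<in>leaves {w \<in> words. length w < n}. acts f l (g l)" by (rule thompson_V_code[OF f])
  have B: "tree_dom {w \<in> words. length w < n}" using n by (intro tree_dom_ball) simp
  obtain \<gamma> where \<gamma>: "word_bij {w \<in> words. length w < n} I \<gamma>"
    "\<forall>l\<in>leaves {w \<in> words. length w < n}. \<gamma> l = g l" by (rule extend_leaf_bij[OF B I g(1)])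
  interpret word_bij "{w \<in> words. length w < n}" I \<gamma> by (rule \<gamma>(1))
  have "realizes f (lift_edges \<gamma>)" using realizes_lift \<gamma>(2) g(2) by simp
  then show ?thesis using lift_near_auts by (auto simp: germ_of_def)
qed

section \<open>Permutations of the leaves\<close>

lemma enumerate_leaves:
  assumes I: "tree_dom I"
  obtains c where "bij_betw c {..<card (leaves I)} (leaves I)"
    "\<And>i j. i < card (leaves I) \<Longrightarrow> j < card (leaves I) \<Longrightarrow> pos (c i) < pos (c j) \<longleftrightarrow> i < j"
proof -
  define L where "L = leaves I"
  have L: "finite L" "inj_on pos L"
    using finite_leaves[OF I] leaves_pos_inj[OF I] by (auto simp: L_def inj_on_def)
  define xs where "xs = sorted_list_of_set (pos ` L)"
  have xs: "sorted_wrt (<) xs" "set xs = pos ` L" "length xs = card L" "distinct xs"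
    using L by (simp_all add: xs_def card_image)
  define c where "c i = inv_into L pos (xs ! i)" for i
  have pc: "pos (c i) = xs ! i" "c i \<in> L" if "i < card L" for i
  proof -
    have "xs ! i \<in> pos ` L" using that xs nth_mem[of i xs] by simp
    then show "pos (c i) = xs ! i" "c i \<in> L" by (simp_all add: c_def f_inv_into_f inv_into_into)
  qed
  have mono: "pos (c i) < pos (c j)" if "i < j" "j < card L" for i j
    using that pc xs sorted_wrt_nth_less[OF xs(1), of i j] by simp
  have iff: "pos (c i) < pos (c j) \<longleftrightarrow> i < j" if "i < card L" "j < card L" for i j
    using mono[of i j] mono[of j i] that by (metis linorder_neqE_nat order_less_asym order_less_irrefl)
  have "inj_on c {..<card L}"
    using iff by (intro inj_onI) (metis lessThan_iff linorder_neqE_nat order_less_irrefl)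
  moreover from this have "c ` {..<card L} = L"
    using L pc by (intro card_subset_eq) (auto simp: card_image)
  ultimately have "bij_betw c {..<card L} L" by (simp add: bij_betw_def)
  then show thesis using that iff by (simp add: L_def)
qed

lemma cyc_rotate_index:
  assumes "i < m" "j < m" "k < m" "s < m" "cyc (real i) (real j) (real k)"
  shows "cyc (real ((i + s) mod m)) (real ((j + s) mod m)) (real ((k + s) mod m))"
proof -
  have m: "(a + s) mod m = (if a + s < m then a + s else a + s - m)" if "a < m" for a
    using that assms(4) by (simp add: mod_if)
  show ?thesis
    using assms unfolding m[OF assms(1)] m[OF assms(2)] m[OF assms(3)] cyc_def by auto
qed

definition rotation :: "nat \<Rightarrow> nat \<Rightarrow> nat \<Rightarrow> nat" where
  "rotation m s i = (if i < m then (i + s) mod m else i)"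

lemma rotation_permutes:
  assumes "s < m" shows "rotation m s permutes {..<m}"
proof (rule bij_imp_permutes)
  have "inj_on (rotation m s) {..<m}"
    using assms by (auto simp: inj_on_def rotation_def mod_if split: if_splits)
  moreover have "rotation m s ` {..<m} \<subseteq> {..<m}" using assms by (auto simp: rotation_def)
  ultimately show "bij_betw (rotation m s) {..<m} {..<m}"
    by (simp add: bij_betw_def endo_inj_surj)
qed (simp add: rotation_def)

text \<open>Conjugating one adjacent transposition by the rotations gives all adjacent ones, and
  these generate. Closure under inverses is not assumed of \<open>P\<close>, so each inverse
  rotation is supplied as another rotation.\<close>

lemma permutations_generated:
  assumes id: "id \<in> P" and comp: "\<And>p q. p \<in> P \<Longrightarrow> q \<in> P \<Longrightarrow> p \<circ> q \<in> P"
    and rot: "\<And>s. s < m \<Longrightarrow> rotation m s \<in> P"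
    and tr: "transpose i (Suc i) \<in> P" "Suc i < m"
    and p: "p permutes {..<m}"
  shows "p \<in> P"
proof -
  have adj: "transpose j (Suc j) \<in> P" if j: "Suc j < m" for j
  proof -
    \<comment> \<open>Rotation by \<open>s\<close> takes \<open>i\<close> to \<open>j\<close>, and
      \<open>r\<close> is its negative modulo \<open>m\<close>. The case \<open>i = j\<close> stands
      apart in \<open>r\<close> because \<open>m\<close> itself is not a permitted shift.\<close>
    define s r where "s = (if i \<le> j then j - i else m + j - i)"
      and "r = (if i = j then 0 else if i \<le> j then m + i - j else i - j)"
    have sr: "s < m" "r < m" using j tr by (auto simp: s_def r_def)
    have "rotation m s \<circ> transpose i (Suc i) \<circ> rotation m r = transpose j (Suc j)"
    proof
      fix x
      show "(rotation m s \<circ> transpose i (Suc i) \<circ> rotation m r) x = transpose j (Suc j) x"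
      proof (cases "x < m")
        case True
        have rs: "rotation m s (rotation m r x) = x"
          using True sr j tr by (auto simp: rotation_def s_def r_def mod_if)
        have i: "rotation m s i = j" "rotation m s (Suc i) = Suc j"
          using sr j tr by (auto simp: rotation_def s_def mod_if)
        have inj: "rotation m s a = rotation m s b \<longleftrightarrow> a = b" for a b
          using permutes_inj[OF rotation_permutes[OF sr(1)]] by (auto dest: injD)
        show ?thesis
        proof (cases "rotation m r x = i \<or> rotation m r x = Suc i")
          case True
          then show ?thesis using rs i by (auto simp: transpose_def)
        next
          case False
          then have "x \<noteq> j" "x \<noteq> Suc j" using rs i inj by metis+
          then show ?thesis using False rs by (simp add: transpose_def)
        qed
      next
        case False
        then show ?thesis using j tr by (simp add: rotation_def transpose_def)
      qed
    qed
    then show ?thesis using comp[OF comp[OF rot[OF sr(1)] tr(1)] rot[OF sr(2)]] by simp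
  qed
  have tr: "transpose a (a + Suc k) \<in> P" if "a + Suc k < m" for a k
    using that
  proof (induction k)
    case 0
    then show ?case using adj by simp
  next
    case (Suc k)
    let ?b = "a + Suc k"
    \<comment> \<open>Conjugation by an adjacent transposition moves the far end of a transposition
      one place further.\<close>
    have "transpose ?b (Suc ?b) \<circ> transpose a ?b \<circ> transpose ?b (Suc ?b) = transpose a (Suc ?b)"
      by (auto simp: fun_eq_iff transpose_def)
    moreover have "transpose ?b (Suc ?b) \<in> P" using adj Suc.prems by simp
    moreover have "transpose a ?b \<in> P" using Suc by simp
    ultimately show ?case using comp by (metis add_Suc_right)
  qed
  have tr': "transpose a b \<in> P" if "a < m" "b < m" for a b
  proof -
    consider "a = b" | k where "b = a + Suc k" | k where "a = b + Suc k"
      by (metis less_imp_Suc_add linorder_neqE_nat add_Suc_right)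
    then show ?thesis
      using that id tr by cases (simp_all add: transpose_commute del: add_Suc_right)
  qed
  show ?thesis
  proof (rule permutes_induct[where P = "\<lambda>p. p \<in> P", OF p])
    show "transpose a b \<circ> q \<in> P" if "a \<in> {..<m}" "b \<in> {..<m}" "q \<in> P" for a b q
      using comp[OF tr'] that by simp
  qed (use id in auto)
qed

section \<open>Shuffles as transpositions of sibling leaves\<close>

text \<open>On words, the shuffle at \<open>v\<close> normalized to fix the branch towards the root
  and to interchange the branches at the two children.\<close>

definition swap_children :: "nat list \<Rightarrow> nat list \<Rightarrow> nat list" where
  "swap_children v w = (if length v < length w \<and> take (length v) w = v
     then w[length v := 1 - w ! length v] else w)"

lemma swap_children_below: "swap_children v (v @ d # u) = v @ (1 - d) # u"
  by (simp add: swap_children_def)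

lemma swap_children_other: "\<not> strict_prefix v w \<Longrightarrow> swap_children v w = w"
proof -
  assume n: "\<not> strict_prefix v w"
  have "\<not> (length v < length w \<and> take (length v) w = v)"
  proof
    assume a: "length v < length w \<and> take (length v) w = v"
    then have "prefix v w" by (metis take_is_prefix)
    then show False using n a by (auto simp: strict_prefix_def)
  qed
  then show ?thesis unfolding swap_children_def by (rule if_not_P)
qed

lemma length_swap_children: "length (swap_children v w) = length w"
  by (simp add: swap_children_def)

context
  fixes v :: "nat list"
  assumes v: "v \<in> ewords"
begin

lemma swap_children_cases:
  assumes "w \<in> words"
  obtains "\<not> strict_prefix v w" "swap_children v w = w"
  | d u where "w = v @ d # u" "d \<in> {0, 1}" "u \<in> bwords" "swap_children v w = v @ (1 - d) # u"
proof (cases "strict_prefix v w")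
  case True
  then obtain d u where w: "w = v @ d # u" by (metis strict_prefixE')
  then have "d # u \<in> bwords" using assms v by (auto simp: words_eq)
  then show thesis using that(2)[OF w] w swap_children_below by simp
qed (use that swap_children_other in blast)

lemma swap_children_ewords:
  assumes "w \<in> ewords"
  shows "swap_children v w \<in> ewords"
proof -
  have "w \<in> words" using assms by (simp add: words_eq)
  then show ?thesis by (rule swap_children_cases) (use assms v in auto)
qed

lemma swap_children_involution: "w \<in> words \<Longrightarrow> swap_children v (swap_children v w) = w"
  using swap_children_cases[of w] swap_children_below by (metis diff_diff_cancel diff_self_eq_0 diff_zero insertE singletonD)

lemma swap_children_snoc:
  assumes "w \<in> words" "w \<noteq> v"
  shows "swap_children v (w @ [d]) = swap_children v w @ [d]"
proof (rule swap_children_cases[OF assms(1)])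
  assume n: "\<not> strict_prefix v w" "swap_children v w = w"
  then have "\<not> strict_prefix v (w @ [d])" using assms(2) by (auto simp: strict_prefix_def)
  then show ?thesis using swap_children_other n by simp
next
  fix e u assume "w = v @ e # u" "swap_children v w = v @ (1 - e) # u"
  then show ?thesis using swap_children_below[of v e "u @ [d]"] by simp
qed

lemma swap_children_self: "swap_children v v = v" "swap_children v [] = []"
  using v by (auto intro!: swap_children_other simp: strict_prefix_def)

lemma swap_children_butlast:
  assumes "w \<in> ewords"
  shows "butlast (swap_children v w) = swap_children v (butlast w)"
proof -
  obtain w' d where w: "w = w' @ [d]" using assms by (metis ewords_Nil rev_exhaust)
  have w': "w' \<in> words" using butlast_words[OF assms] w by simp
  show ?thesis
  proof (cases "w' = v")
    case True
    then show ?thesis using w swap_children_below[of v d "[]"] swap_children_self by simp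
  next
    case False
    then show ?thesis using w swap_children_snoc[OF w'] by simp
  qed
qed

lemma swap_children_bij: "bij_betw (swap_children v) ewords ewords"
  using swap_children_ewords swap_children_involution
  by (intro bij_betw_byWitness[of _ "swap_children v"]) (auto simp: words_eq)

text \<open>Makes \<open>realizes_lift_acts\<close> available, which reads off the permutation of
  the leaves of the ball. That the lift is a shuffle is shown separately. The bound puts
  \<open>v\<close> inside the ball, away from the words where letters must be copied.\<close>

lemma swap_children_word_bij:
  assumes "length v < n"
  shows "word_bij {w \<in> words. length w < n} {w \<in> words. length w < n} (swap_children v)"
proof
  let ?B = "{w \<in> words. length w < n}"
  show "tree_dom ?B" using assms by (auto intro!: tree_dom_ball)
  show "bij_betw (swap_children v) ewords ewords" by (rule swap_children_bij)
  have B: "?B - {[]} = {w \<in> ewords. length w < n}" by (auto simp: words_eq)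
  show "swap_children v ` (?B - {[]}) = ?B - {[]}"
    unfolding B
  proof (intro equalityI subsetI)
    fix w assume "w \<in> swap_children v ` {w \<in> ewords. length w < n}"
    then show "w \<in> {w \<in> ewords. length w < n}"
      using swap_children_ewords length_swap_children by auto
  next
    fix w assume w: "w \<in> {w \<in> ewords. length w < n}"
    then have "w = swap_children v (swap_children v w)"
      using swap_children_involution by (simp add: words_eq)
    moreover have "swap_children v w \<in> {w \<in> ewords. length w < n}"
      using w swap_children_ewords length_swap_children by simp
    ultimately show "w \<in> swap_children v ` {w \<in> ewords. length w < n}" by blast
  qed
  fix w d assume "w \<in> ewords" "w \<notin> ?B"
  then have "w \<in> words" "w \<noteq> v" using assms by (auto simp: words_eq)
  then show "swap_children v (w @ [d]) = swap_children v w @ [d]" by (rule swap_children_snoc)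
qed

lemma rot_shuffle_at:
  "rot (shuffle_at F (Inl v)) (Inl v) (hf v True) = hf (v @ [1]) False"
  "rot (shuffle_at F (Inl v)) (Inl v) (hf (v @ [1]) False) = hf (v @ [0]) False"
  "rot (shuffle_at F (Inl v)) (Inl v) (hf (v @ [0]) False) = hf v True"
proof -
  have ne: "v \<noteq> []" using v by auto
  have E: "v @ [0] \<in> ewords" "v @ [1] \<in> ewords" using v by auto
  have d: "hf v True \<noteq> hf (v @ [0]) False" "hf v True \<noteq> hf (v @ [1]) False"
    "hf (v @ [0]) False \<noteq> hf (v @ [1]) False" using hf_eq_iff v E by simp_all
  have inj: "inj_on (rot F (Inl v)) (incident F (Inl v))"
    unfolding incident_Inl[OF v] using rot_farey_Inl[OF ne] d d[symmetric] by (simp add: inj_on_def)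
  have inv: "inv_into (incident F (Inl v)) (rot F (Inl v)) e = f"
    if "f \<in> incident F (Inl v)" "rot F (Inl v) f = e" for e f
    using inj that by (rule inv_into_f_eq)
  have S: "rot (shuffle_at F (Inl v)) (Inl v) e = f"
    if "f \<in> incident F (Inl v)" "rot F (Inl v) f = e" for e f
    using inv[OF that] by (simp add: shuffle_at_def)
  have mem: "hf v True \<in> incident F (Inl v)" "hf (v @ [0]) False \<in> incident F (Inl v)"
    "hf (v @ [1]) False \<in> incident F (Inl v)" unfolding incident_Inl[OF v] by simp_all
  show "rot (shuffle_at F (Inl v)) (Inl v) (hf v True) = hf (v @ [1]) False"
    using mem(3) rot_farey_Inl(3)[OF ne] by (rule S)
  show "rot (shuffle_at F (Inl v)) (Inl v) (hf (v @ [1]) False) = hf (v @ [0]) False"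
    using mem(2) rot_farey_Inl(2)[OF ne] by (rule S)
  show "rot (shuffle_at F (Inl v)) (Inl v) (hf (v @ [0]) False) = hf v True"
    using mem(1) rot_farey_Inl(1)[OF ne] by (rule S)
qed

lemma swap_children_ribbon_iso:
  "ribbon_iso (shuffle_at F (Inl v)) F (map_sum (swap_children v) (swap_children v))
     (lift_edges (swap_children v))"
  unfolding ribbon_iso_def graph_iso_def
proof (intro conjI ballI)
  let ?s = "swap_children v" and ?S = "shuffle_at F (Inl v)"
  let ?L = "lift_edges ?s"
  have G: "verts ?S = verts F" "edges ?S = edges F" "ends ?S = ends F" "incident ?S x = incident F x" for x
    by (simp_all add: shuffle_at_def incident_def)
  have words_s: "?s w \<in> words" if "w \<in> words" for w
    using that swap_children_ewords swap_children_self by (auto simp: words_eq)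
  show "bij_betw (map_sum ?s ?s) (verts ?S) (verts F)"
    unfolding G verts_farey
    by (rule bij_betw_byWitness[of _ "map_sum ?s ?s"])
      (use words_s swap_children_ewords swap_children_involution in \<open>auto simp: words_eq\<close>)
  show "bij_betw ?L (edges ?S) (edges F)"
    using lift_edges_Bij[OF swap_children_bij] by (simp add: G Bij_def)
  show "ends F (?L e) = map_sum ?s ?s ` ends ?S e" if e: "e \<in> edges ?S" for e
  proof -
    obtain w b where "w \<in> ewords" "e = hf w b" using e unfolding G by (rule edges_fareyE)
    then show ?thesis by (simp add: G lift_edges_hf ends_farey swap_children_butlast)
  qed
  show "?L (rot ?S x e) = rot F (map_sum ?s ?s x) (?L e)" if x: "x \<in> verts ?S" and e: "e \<in> incident ?S x" for x e
  proof -
    have e: "e \<in> incident F x" using e G by simp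
    have far: "rot ?S x = rot F x" if "x \<noteq> Inl v" using that by (simp add: shuffle_at_def)
    have "x = Inl v \<or> x = Inl [] \<or> (\<exists>w\<in>ewords. w \<noteq> v \<and> x = Inl w) \<or> (\<exists>w\<in>ewords. x = Inr w)"
      using x unfolding G verts_farey words_eq by blast
    then consider "x = Inl v" | "x = Inl []" | w where "x = Inl w" "w \<in> ewords" "w \<noteq> v"
      | w where "x = Inr w" "w \<in> ewords" by blast
    then show ?thesis
    proof cases
      case 1
      have E: "v @ [0] \<in> ewords" "v @ [1] \<in> ewords" using v by auto
      have s: "?s (v @ [0]) = v @ [1]" "?s (v @ [1]) = v @ [0]"
        using swap_children_below[of v 0 "[]"] swap_children_below[of v 1 "[]"] by simp_all
      have ne: "v \<noteq> []" using v by auto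
      have "e = hf v True \<or> e = hf (v @ [0]) False \<or> e = hf (v @ [1]) False"
        using e 1 incident_Inl[OF v] by auto
      then show ?thesis
        using 1 rot_shuffle_at rot_farey_Inl[OF ne] lift_edges_hf[OF v] lift_edges_hf[OF E(1)]
          lift_edges_hf[OF E(2)] s swap_children_self(1)
        by (elim disjE) simp_all
    next
      case 2
      then obtain a where a: "a < 3" "e = hf [a] False" using e incident_root by auto
      have s: "?s [b] = [b]" for b
      proof (rule swap_children_other)
        show "\<not> strict_prefix v [b]" using v by (auto simp: strict_prefix_def prefix_Cons)
      qed
      have "Inl [] \<noteq> (Inl v :: nat list + nat list)" using v by auto
      then show ?thesis
        using a 2 far swap_children_self(2) s rot_farey_root lift_edges_hf[of "[a]"]
          lift_edges_hf[of "[(a + 1) mod 3]"] by simp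
    next
      case 3
      have E: "w @ [0] \<in> ewords" "w @ [1] \<in> ewords" using 3 by auto
      have ww: "w \<in> words" using 3 by (simp add: words_eq)
      have s: "?s (w @ [d]) = ?s w @ [d]" for d using swap_children_snoc[OF ww 3(3)] .
      have ne: "w \<noteq> []" "?s w \<noteq> []" using 3 swap_children_ewords[OF 3(2)] by auto
      have "e = hf w True \<or> e = hf (w @ [0]) False \<or> e = hf (w @ [1]) False"
        using e 3 incident_Inl[OF 3(2)] by auto
      then show ?thesis
        using 3(1,3) far rot_farey_Inl[OF ne(1)] rot_farey_Inl[OF ne(2)] lift_edges_hf[OF 3(2)]
          lift_edges_hf[OF E(1)] lift_edges_hf[OF E(2)] s
        by (elim disjE) simp_all
    next
      case 4
      then obtain b where "e = hf w b" using e incident_Inr[OF 4(2)] by auto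
      then show ?thesis
        using 4 far rot_farey_Inr[OF 4(2)] rot_farey_Inr[OF swap_children_ewords[OF 4(2)]]
          lift_edges_hf[OF 4(2)] by simp
    qed
  qed
qed

lemma swap_children_shuffle: "lift_edges (swap_children v) \<in> shuffles F"
proof -
  have "Inl v \<in> verts F" "degree F (Inl v) = 3"
    using v by (auto simp: verts_farey words_eq intro!: degree_Inl)
  then show ?thesis
    unfolding shuffles_def using lift_edges_Bij[OF swap_children_bij] swap_children_ribbon_iso by blast
qed

end

section \<open>Generation\<close>

abbreviation gens :: "(nat list \<times> nat list \<Rightarrow> nat list \<times> nat list) set" where
  "gens \<equiv> ribbon_near_auts F \<union> shuffles F"

definition generated :: "(real \<Rightarrow> real) set" where
  "generated = {f \<in> carrier thompson_V.
     germ_of f \<in> generate (germ_group F) (carrier (germ_group F) \<inter> germ F ` gens)}"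

section \<open>Closure properties and two families of generated elements\<close>

lemma generatedD: "f \<in> generated \<Longrightarrow> f \<in> carrier thompson_V"
  by (simp add: generated_def)

lemma gens_realized: "s \<in> gens \<Longrightarrow> \<exists>f\<in>carrier thompson_V. realizes f s"
  using ribbon_near_auts_realized shuffles_realized by blast

lemma generated_compose:
  assumes "f \<in> generated" "g \<in> generated"
  shows "compose {0..<1} f g \<in> generated"
proof -
  have V: "f \<in> carrier thompson_V" "g \<in> carrier thompson_V" using assms generatedD by blast+
  have "germ_of f \<otimes>\<^bsub>germ_group F\<^esub> germ_of g \<in> generate (germ_group F) (carrier (germ_group F) \<inter> germ F ` gens)"
    using assms by (auto simp: generated_def intro: generate.eng)
  then show ?thesis
    using germ_of_mult[OF V germ_of_nonempty[OF V(1)] germ_of_nonempty[OF V(2)]] thompson_V_compose[OF V]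
    by (simp add: generated_def)
qed

lemma generated_id: "(\<lambda>x\<in>{0..<1}. x) \<in> generated"
  unfolding generated_def mem_Collect_eq germ_of_one[symmetric]
  using thompson_V_id generate.one by blast

lemma generator_in_generated:
  assumes "s \<in> gens" "f \<in> carrier thompson_V" "realizes f s"
  shows "f \<in> generated"
proof -
  have "germ F s = germ_of f" using germ_eq_germ_of assms by blast
  then have "germ_of f \<in> carrier (germ_group F) \<inter> germ F ` gens"
    using germ_of_carrier[OF germ_of_nonempty[OF assms(2)]] assms(1) by blast
  then show ?thesis using assms(2) by (auto simp: generated_def intro: generate.incl)
qed

text \<open>Used twice: with the same tree on both sides it gives the rotations of the leaves of a
  ball, and with \<open>s = 0\<close> the order-preserving map between two trees with equally many
  leaves.\<close>

lemma rotation_generated: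
  assumes I: "tree_dom I1" "tree_dom I2" and m: "card (leaves I1) = m" "card (leaves I2) = m"
    and c: "bij_betw c {..<m} (leaves I1)" "\<And>i j. i < m \<Longrightarrow> j < m \<Longrightarrow> pos (c i) < pos (c j) \<longleftrightarrow> i < j"
    and d: "bij_betw d {..<m} (leaves I2)" "\<And>i j. i < m \<Longrightarrow> j < m \<Longrightarrow> pos (d i) < pos (d j) \<longleftrightarrow> i < j"
    and s: "s < m"
  obtains f where "f \<in> generated" "\<forall>i<m. acts f (c i) (d (rotation m s i))"
proof -
  define g where "g = d \<circ> rotation m s \<circ> inv_into {..<m} c"
  have r: "bij_betw (rotation m s) {..<m} {..<m}"
    using rotation_permutes[OF s] by (rule permutes_imp_bij)
  have g: "bij_betw g (leaves I1) (leaves I2)"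
    unfolding g_def by (intro bij_betw_trans[OF bij_betw_inv_into[OF c(1)]] bij_betw_trans[OF r d(1)])
  have gc: "g (c i) = d (rotation m s i)" if "i < m" for i
    using that c(1) by (simp add: g_def bij_betw_def)
  obtain \<gamma> where \<gamma>: "word_bij I1 I2 \<gamma>" "\<forall>l\<in>leaves I1. \<gamma> l = g l" by (rule extend_leaf_bij[OF I g])
  interpret word_bij I1 I2 \<gamma> by (rule \<gamma>(1))
  have cL: "c i \<in> leaves I1" if "i < m" for i using that c(1) by (auto simp: bij_betw_def)
  have ex: "\<exists>i<m. a = c i" if "a \<in> leaves I1" for a using that c(1) by (auto simp: bij_betw_def)
  have "lift_edges \<gamma> \<in> ribbon_near_auts F"
  proof (rule lift_ribbon_near_auts)
    fix a1 a2 a3 assume a: "a1 \<in> leaves I1" "a2 \<in> leaves I1" "a3 \<in> leaves I1"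
      and cy: "cyc (pos a1) (pos a2) (pos a3)"
    obtain i j k where ijk: "i < m" "a1 = c i" "j < m" "a2 = c j" "k < m" "a3 = c k"
      using ex a by metis
    have "cyc (real i) (real j) (real k)" using cy ijk c(2) by (simp add: cyc_def)
    then have "cyc (real (rotation m s i)) (real (rotation m s j)) (real (rotation m s k))"
      using cyc_rotate_index[OF ijk(1,3,5) s] ijk by (simp add: rotation_def)
    moreover have "rotation m s i < m" "rotation m s j < m" "rotation m s k < m"
      using ijk by (auto simp: rotation_def)
    ultimately show "cyc (pos (\<gamma> a1)) (pos (\<gamma> a2)) (pos (\<gamma> a3))"
      using \<gamma>(2) a ijk gc d(2) by (simp add: cyc_def)
  qed
  moreover from this obtain f where f: "f \<in> carrier thompson_V" "realizes f (lift_edges \<gamma>)"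
    using ribbon_near_auts_realized by blast
  ultimately have "f \<in> generated" using generator_in_generated by blast
  moreover have "\<forall>i<m. acts f (c i) (d (rotation m s i))"
    using realizes_lift_acts[OF f(2)] cL \<gamma>(2) gc by metis
  ultimately show thesis using that by blast
qed

lemma leaf_permutation_generated:
  assumes n: "2 \<le> n" and L: "leaves {w \<in> words. length w < n} = L" "card L = m"
    and c: "bij_betw c {..<m} L" "\<And>i j. i < m \<Longrightarrow> j < m \<Longrightarrow> pos (c i) < pos (c j) \<longleftrightarrow> i < j"
    and p: "p permutes {..<m}"
  obtains f where "f \<in> generated" "\<forall>i<m. acts f (c i) (c (p i))"
proof -
  let ?B = "{w \<in> words. length w < n}"
  have B: "tree_dom ?B" using n by (intro tree_dom_ball) simp
  have Lw: "L = {w \<in> ewords. length w = n}" using leaves_ball[of n] n L by simp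
  have cL: "c i \<in> L" if "i < m" for i using that c(1) by (auto simp: bij_betw_def)
  then have cE: "c i \<in> ewords" if "i < m" for i using that Lw by simp
  have ex: "\<exists>i<m. a = c i" if "a \<in> L" for a using that c(1) by (auto simp: bij_betw_def)
  define P where "P = {p. p permutes {..<m} \<and> (\<exists>f\<in>generated. \<forall>i<m. acts f (c i) (c (p i)))}"
  \<comment> \<open>A vertex on the last level inside the ball, so its children are leaves; it
    differs from the root because \<open>n\<close> is at least 2, and hence has only two
    children.\<close>
  define v :: "nat list" where "v = replicate (n - 1) 0"
  have "v \<noteq> []" using n by (simp add: v_def)
  then have v: "v \<in> ewords" "length v < n" "length v = n - 1"
    using n by (auto simp: v_def ewords_def in_set_replicate dest: in_set_replicate[THEN iffD1] list.set_sel(2))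
  have w: "v @ [0] \<in> L" "v @ [1] \<in> L" using v n by (auto simp: Lw)
  obtain i where i: "i < m" "v @ [0] = c i" using ex w by blast
  obtain j where j: "j < m" "v @ [1] = c j" using ex w by blast
  have ij: "i < j" using c(2)[OF i(1) j(1)] pos_less[of v 0 "[]" 1 "[]"] i j w Lw by auto
  text \<open>No leaf lies strictly between the siblings \<open>v0\<close> and \<open>v1\<close>: a leaf that is not below \<open>v\<close> lies on
    one side of everything below \<open>v\<close>.\<close>
  have "j = Suc i"
  proof (rule ccontr)
    assume "j \<noteq> Suc i"
    then have k: "Suc i < m" "Suc i < j" using ij j by auto
    have between: "pos (v @ [0]) < pos (c (Suc i))" "pos (c (Suc i)) < pos (v @ [1])"
      using c(2) i j k by simp_all
    have ne: "c (Suc i) \<noteq> v @ [0]" "c (Suc i) \<noteq> v @ [1]" using between by auto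
    have len: "length (c (Suc i)) = n" "c (Suc i) \<in> ewords" using cL[OF k(1)] Lw by auto
    show False
    proof (cases "strict_prefix v (c (Suc i))")
      case True
      then obtain d u where "c (Suc i) = v @ d # u" by (metis strict_prefixE')
      then show False using len v ne n by auto
    next
      case False
      have vB: "v \<in> ?B" using v by (simp add: words_eq)
      have v0: "v @ [0] \<in> ewords" and v1: "v @ [1] \<in> ewords" using w Lw by auto
      have "c (Suc i) \<in> leaves ?B" using cL[OF k(1)] L by simp
      then show False
      proof (rule leaf_outside[OF B vB v0 _ False])
        assume "\<And>e u. v @ e # u \<in> ewords \<Longrightarrow> pos (c (Suc i)) < pos (v @ e # u)"
        then show False using v0 between by fastforce
      next
        assume "\<And>e u. v @ e # u \<in> ewords \<Longrightarrow> pos (v @ e # u) < pos (c (Suc i))"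
        then show False using v1 between by fastforce
      qed
    qed
  qed
  have "id \<in> P"
    using generated_id acts_id cE by (auto simp: P_def permutes_id)
  moreover have "p \<circ> q \<in> P" if p: "p \<in> P" and q: "q \<in> P" for p q
  proof -
    obtain f g where f: "f \<in> generated" "\<forall>i<m. acts f (c i) (c (p i))"
      and g: "g \<in> generated" "\<forall>i<m. acts g (c i) (c (q i))" using p q by (auto simp: P_def)
    have pq: "p permutes {..<m}" "q permutes {..<m}" using p q by (auto simp: P_def)
    have "acts (compose {0..<1} f g) (c i) (c ((p \<circ> q) i))" if "i < m" for i
    proof -
      have "q i < m" using permutes_in_image[OF pq(2), of i] that by simp
      then show ?thesis using acts_compose[of f "c (q i)" "c (p (q i))" g "c i"] f g that cE by simp
    qed
    then show ?thesis using generated_compose[OF f(1) g(1)] permutes_compose[OF pq(2,1)] by (auto simp: P_def)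
  qed
  moreover have "rotation m s \<in> P" if s: "s < m" for s
  proof -
    obtain f where "f \<in> generated" "\<forall>i<m. acts f (c i) (c (rotation m s i))"
      by (rule rotation_generated[OF B B _ _ _ _ _ _ s, of c c]) (use L c in auto)
    then show ?thesis using rotation_permutes[OF s] by (auto simp: P_def)
  qed
  moreover have "transpose i (Suc i) \<in> P"
  proof -
    interpret word_bij ?B ?B "swap_children v" by (rule swap_children_word_bij[OF v(1,2)])
    have sh: "lift_edges (swap_children v) \<in> gens" using swap_children_shuffle[OF v(1)] by blast
    then obtain f where f: "f \<in> carrier thompson_V" "realizes f (lift_edges (swap_children v))"
      using gens_realized by blast
    have "swap_children v (c k) = c (transpose i (Suc i) k)" if k: "k < m" for k
    proof -
      consider "k = i" | "k = j" | "k \<noteq> i" "k \<noteq> j" by blast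
      then show ?thesis
      proof cases
        case 1
        then show ?thesis using i(2) j(2) \<open>j = Suc i\<close> swap_children_below[of v 0 "[]"] by simp
      next
        case 2
        then show ?thesis using i(2) j(2) \<open>j = Suc i\<close> swap_children_below[of v 1 "[]"] by simp
      next
        case 3
        have "c k \<noteq> c i" "c k \<noteq> c j" using 3 c(1) k i j by (auto simp: bij_betw_def inj_on_def)
        moreover have "length (c k) = n" "c k \<in> ewords" using cL[OF k] Lw by auto
        ultimately have "\<not> strict_prefix v (c k)"
          using v n i(2) j(2) by (auto elim!: strict_prefixE')
        then show ?thesis using 3 \<open>j = Suc i\<close> swap_children_other by simp
      qed
    qed
    then have "\<forall>k<m. acts f (c k) (c (transpose i (Suc i) k))"
      using realizes_lift_acts[OF f(2)] cL L by metis
    moreover have "transpose i (Suc i) permutes {..<m}"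
      using i j \<open>j = Suc i\<close> by (intro permutes_swap_id) auto
    ultimately show ?thesis using generator_in_generated[OF sh f] by (auto simp: P_def)
  qed
  ultimately have "p \<in> P"
    using permutations_generated[of P m i p] p j \<open>j = Suc i\<close> by blast
  then show thesis using that by (auto simp: P_def)
qed

lemma thompson_V_generated:
  assumes f: "f \<in> carrier thompson_V"
  shows "f \<in> generated"
proof -
  obtain n I g where n: "2 \<le> n" and I: "tree_dom I"
    and g: "bij_betw g (leaves {w \<in> words. length w < n}) (leaves I)"
      "\<forall>l\<in>leaves {w \<in> words. length w < n}. acts f l (g l)" by (rule thompson_V_code[OF f])
  let ?B = "{w \<in> words. length w < n}"
  define m where "m = card (leaves ?B)"
  have B: "tree_dom ?B" using n by (intro tree_dom_ball) simp
  have m: "card (leaves ?B) = m" "card (leaves I) = m"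
    using bij_betw_same_card[OF g(1)] by (simp_all add: m_def)
  obtain c where c: "bij_betw c {..<m} (leaves ?B)"
    "\<And>i j. i < m \<Longrightarrow> j < m \<Longrightarrow> pos (c i) < pos (c j) \<longleftrightarrow> i < j"
    using enumerate_leaves[OF B] m by metis
  obtain d where d: "bij_betw d {..<m} (leaves I)"
    "\<And>i j. i < m \<Longrightarrow> j < m \<Longrightarrow> pos (d i) < pos (d j) \<longleftrightarrow> i < j"
    using enumerate_leaves[OF I] m by metis
  \<comment> \<open>This is \<open>g\<close> with the leaves on both sides numbered from left to
    right.\<close>
  define p where "p i = (if i < m then inv_into {..<m} d (g (c i)) else i)" for i
  have "bij_betw (inv_into {..<m} d \<circ> (g \<circ> c)) {..<m} {..<m}"
    by (intro bij_betw_trans[OF bij_betw_trans[OF c(1) g(1)]] bij_betw_inv_into[OF d(1)])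
  then have "bij_betw p {..<m} {..<m}" by (subst bij_betw_cong[of _ _ "inv_into {..<m} d \<circ> (g \<circ> c)"]) (auto simp: p_def)
  then have p: "p permutes {..<m}" by (rule bij_imp_permutes) (simp add: p_def)
  have dp: "d (p i) = g (c i)" "p i < m" if "i < m" for i
  proof -
    have "g (c i) \<in> d ` {..<m}" using that c(1) g(1) d(1) by (auto simp: bij_betw_def)
    then show "d (p i) = g (c i)" using that by (simp add: p_def f_inv_into_f)
    show "p i < m" using permutes_in_image[OF p, of i] that by simp
  qed
  obtain h where h: "h \<in> generated" "\<forall>i<m. acts h (c i) (c (p i))"
    by (rule leaf_permutation_generated[OF n refl m(1) c p])
  have "0 < m" using m card_leaves[OF B] by simp
  then obtain k where k: "k \<in> generated" "\<forall>i<m. acts k (c i) (d (rotation m 0 i))"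
    using rotation_generated[OF B I m c d] by blast
  \<comment> \<open>First \<open>h\<close> rearranges the leaves of the ball into the order of their
    images, then \<open>k\<close> maps them in order onto the leaves of \<open>I\<close>.\<close>
  have "f = compose {0..<1} k h"
  proof (rule thompson_V_eqI[OF f, of _ "n - 1"])
    show "compose {0..<1} k h \<in> carrier thompson_V"
      using generatedD[OF generated_compose[OF k(1) h(1)]] .
    fix w assume "w \<in> ewords" "length w = Suc (n - 1)"
    then have w: "w \<in> leaves ?B" "w \<in> ewords" using leaves_ball[of n] n by auto
    then obtain i where i: "i < m" "w = c i" using c(1) by (auto simp: bij_betw_def)
    have "acts k (c (p i)) (d (p i))" using k(2) dp(2)[OF i(1)] by (simp add: rotation_def)
    then have "acts (compose {0..<1} k h) w (g w)"
      using acts_compose[of k "c (p i)" "d (p i)" h "c i"] h(2) i dp(1)[OF i(1)] w by simp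
    then show "\<exists>w'. acts f w w' \<and> acts (compose {0..<1} k h) w w'" using g(2) w by blast
  qed
  then show ?thesis using generated_compose[OF k(1) h(1)] by simp
qed

theorem theorem7p3:
  shows "Aut_inf_s farey_tree \<cong> thompson_V"
  unfolding Aut_inf_s_def
proof (rule generated_germs_iso)
  show "germ_of f \<noteq> {}" if "f \<in> carrier thompson_V" for f using germ_of_nonempty[OF that] .
  show "germ_of f \<in> generate (germ_group F) (carrier (germ_group F) \<inter> germ F ` gens)"
    if "f \<in> carrier thompson_V" for f
    using thompson_V_generated[OF that] by (simp add: generated_def)
  show "\<exists>f\<in>carrier thompson_V. realizes f s" if "s \<in> gens" for s using gens_realized[OF that] .
qed

end
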